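(* Let $\kappa\in\{1,-1\}$ and $n_1,n_2\in\mathbb N_0$. The coefficients $e(-\kappa;n_1,n_2)$ obtained from the continuation formula (see context) are given by the limit formula $$e(-\kappa;n_1,n_2)=-\pi\lim_{m\to\infty}\frac{\Gamma(1+m)}{\Gamma(1+\mu(\kappa)+m)\,\Gamma(-\mu(-\kappa)-\frac23n_1-\frac13n_2+m)}(2\kappa s_0)^m\sum_{j_1=0}^{n_1}\sum_{j_2=0}^{n_2}b(\kappa;m,j_1,j_2)\frac{(2\kappa t_{10})^{n_1-j_1}}{(n_1-j_1)!}\frac{(2\kappa t_{20})^{n_2-j_2}}{(n_2-j_2)!}.$$
   Context: Setting. $D_1,\dots,D_6,B_1,\dots,B_6,L$ are real, $B_6>0$, $L\ge0$ (parameters of the equation $z^2f''+zf'-[\sum_{m=1}^6 D_mz^{-m}+L^2+\sum_{m=1}^6 B_mz^m]f=0$). Put $p_3=\frac13\sqrt{B_6}$, $p_2=\frac{B_5}{12p_3}$, $p_1=\frac{B_4-4p_2^2}{6p_3}$, $s_0=p_3$, $t_{10}=p_2$, $t_{20}=p_1$, and for $\kappa\in\{1,-1\}$ $$\tau(\kappa)=\tfrac32-\tfrac16\frac{B_3}{\kappa p_3}+\tfrac23\frac{p_1p_2}{\kappa p_3}.$$ Coefficients $b$. For $\kappa\in\{1,-1\}$ the numbers $b(\kappa;m,n_1,n_2)$ are given by $$\begin{aligned}&6\kappa s_0(3m-2n_1-n_2)b(\kappa;m,n_1,n_2)=[(3m-2n_1-n_2+\tau(\kappa)-3)^2-L^2]\,b(\kappa;m-1,n_1,n_2)\\&+[-4\kappa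 t_{10}(3m-2n_1-n_2+\tau(\kappa)-2)+t_{20}^2-B_2]\,b(\kappa;m-1,n_1-1,n_2)\\&+[-2\kappa t_{20}(3m-2n_1-n_2+\tau(\kappa)-\tfrac52)-B_1]\,b(\kappa;m-1,n_1,n_2-1)\\&-D_1b(\kappa;m-2,n_1-1,n_2)-D_2b(\kappa;m-2,n_1,n_2-1)-D_3b(\kappa;m-2,n_1,n_2)\\&-D_4b(\kappa;m-3,n_1-1,n_2)-D_5b(\kappa;m-3,n_1,n_2-1)-D_6b(\kappa;m-3,n_1,n_2),\end{aligned}$$ with $b(\kappa;0,0,0)=1$; $b(\kappa;m,n_1,n_2)=0$ if $3m-2n_1-n_2=0$ and $(m,n_1,n_2)\ne(0,0,0)$; and $b=0$ if any index is negative. Coefficients $E$, $e$. Let $\lambda$ be an auxiliary parameter and $\nu_1,\nu_2$ positive integers (preferentially $1$), $\mu(\kappa)=\frac13[2\nu_1+\nu_2+\lambda+\tau(\kappa)]-2$, with $\lambda$ chosen so that no $\mu(\kappa)+\varphi(r)$ is an integer, where $\varphi(r)=\frac23r_1+\frac13r_2$ for $r=(r_1,r_2)\in\mathbb N_0^2$. Define $$\begin{aligned}W(\kappa;r_1,r_2)={}&\sum_{m\ge0}\sum_{n_1=0}^m\sum_{n_2=0}^m\Gamma(\nu_1+r_1+n_1)\Gamma(\nu_2+r_2+n_2)\Gamma(-\mu(\kappa)-\varphi(r)-m)\,b(\kappa;m,n_1,n_2)(-2\kappa s_0)^m\\&\times\Big(\tfrac12-\tfrac{s}{2\kappa s_0}\Big)^{\mu(\kappa)+\varphi(r)+m}(t_1-\kappa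 t_{10})^{-\nu_1-r_1-n_1}(t_2-\kappa t_{20})^{-\nu_2-r_2-n_2},\end{aligned}$$ with powers of $\frac12\mp\frac{s}{2s_0}$ positive for $-s_0<s<s_0$, and $|t_1|,|t_2|$ sufficiently large. The coefficients $E(-\kappa;r_1,r_2;q_1,q_2)$ are those in the analytic continuation formula between the points $s=\kappa s_0$ and $s=-\kappa s_0$, $$W(\kappa;r_1,r_2)=\sum_{q_1\ge r_1}\sum_{q_2\ge r_2}E(-\kappa;r_1,r_2;q_1,q_2)\,W(-\kappa;q_1,q_2)+U(-\kappa;r_1,r_2),$$ where $U(-\kappa;r_1,r_2)$ is analytic in $s$ at $s=-\kappa s_0$. Put $e(-\kappa;q_1,q_2)=\sin(\pi\mu(\kappa))\,E(-\kappa;0,0;q_1,q_2)$ (independent of $\lambda$). *)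

theory Defs
  imports "HOL-Complex_Analysis.Complex_Analysis"
begin

(* The parameters D_1..D_6 and B_1..B_6 are passed as functions D, B :: nat => real of which
   only the values at 1..6 are used; the sign kappa is a real number from {1,-1}. *)

definition p3 :: "(nat \<Rightarrow> real) \<Rightarrow> real" where
  "p3 B = 1/3 * sqrt (B 6)"

definition p2 :: "(nat \<Rightarrow> real) \<Rightarrow> real" where
  "p2 B = B 5 / (12 * p3 B)"

definition p1 :: "(nat \<Rightarrow> real) \<Rightarrow> real" where
  "p1 B = (B 4 - 4 * (p2 B)\<^sup>2) / (6 * p3 B)"

abbreviation s0 :: "(nat \<Rightarrow> real) \<Rightarrow> real" where "s0 \<equiv> p3"
abbreviation t10 :: "(nat \<Rightarrow> real) \<Rightarrow> real" where "t10 \<equiv> p2"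
abbreviation t20 :: "(nat \<Rightarrow> real) \<Rightarrow> real" where "t20 \<equiv> p1"

definition tau :: "(nat \<Rightarrow> real) \<Rightarrow> real \<Rightarrow> real" where
  "tau B \<kappa> = 3/2 - 1/6 * (B 3 / (\<kappa> * p3 B)) + 2/3 * (p1 B * p2 B / (\<kappa> * p3 B))"

function b_coeff ::
  "(nat \<Rightarrow> real) \<Rightarrow> (nat \<Rightarrow> real) \<Rightarrow> real \<Rightarrow> real \<Rightarrow> int \<Rightarrow> int \<Rightarrow> int \<Rightarrow> real" where
  "b_coeff D B L \<kappa> m n1 n2 =
    (if m < 0 \<or> n1 < 0 \<or> n2 < 0 then 0
     else if m = 0 \<and> n1 = 0 \<and> n2 = 0 then 1
     else if 3*m - 2*n1 - n2 = 0 then 0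
     else
      (((of_int (3*m - 2*n1 - n2) + tau B \<kappa> - 3)\<^sup>2 - L\<^sup>2) * b_coeff D B L \<kappa> (m - 1) n1 n2
       + (- 4 * \<kappa> * t10 B * (of_int (3*m - 2*n1 - n2) + tau B \<kappa> - 2) + (t20 B)\<^sup>2 - B 2)
           * b_coeff D B L \<kappa> (m - 1) (n1 - 1) n2
       + (- 2 * \<kappa> * t20 B * (of_int (3*m - 2*n1 - n2) + tau B \<kappa> - 5/2) - B 1)
           * b_coeff D B L \<kappa> (m - 1) n1 (n2 - 1)
       - D 1 * b_coeff D B L \<kappa> (m - 2) (n1 - 1) n2
       - D 2 * b_coeff D B L \<kappa> (m - 2) n1 (n2 - 1)
       - D 3 * b_coeff D B L \<kappa> (m - 2) n1 n2
       - D 4 * b_coeff D B L \<kappa> (m - 3) (n1 - 1) n2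
       - D 5 * b_coeff D B L \<kappa> (m - 3) n1 (n2 - 1)
       - D 6 * b_coeff D B L \<kappa> (m - 3) n1 n2)
      / (6 * \<kappa> * s0 B * of_int (3*m - 2*n1 - n2)))"
  by pat_completeness auto
termination
  by (relation "Wellfounded.measure (\<lambda>(D, B, L, \<kappa>, m, n1, n2). nat (m + 1))") auto

declare b_coeff.simps [simp del]

definition mu :: "(nat \<Rightarrow> real) \<Rightarrow> nat \<Rightarrow> nat \<Rightarrow> complex \<Rightarrow> real \<Rightarrow> complex" where
  "mu B \<nu>1 \<nu>2 lam \<kappa> =
     1/3 * (2 * of_nat \<nu>1 + of_nat \<nu>2 + lam + of_real (tau B \<kappa>)) - 2"

definition phi :: "nat \<Rightarrow> nat \<Rightarrow> complex" where
  "phi r1 r2 = 2/3 * of_nat r1 + 1/3 * of_nat r2"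

(* In the lens below both 1/2 - s/(2 s_0) and 1/2 + s/(2 s_0) have positive real part, so the
   principal powers used here are the holomorphic continuations of the powers that are
   positive (for real exponents) on -s_0 < s < s_0. *)
definition W_term ::
  "(nat \<Rightarrow> real) \<Rightarrow> (nat \<Rightarrow> real) \<Rightarrow> real \<Rightarrow> nat \<Rightarrow> nat \<Rightarrow> complex \<Rightarrow> real \<Rightarrow> nat \<Rightarrow> nat \<Rightarrow>
   complex \<Rightarrow> complex \<Rightarrow> complex \<Rightarrow> nat \<times> nat \<times> nat \<Rightarrow> complex" where
  "W_term D B L \<nu>1 \<nu>2 lam \<kappa> r1 r2 s t1 t2 = (\<lambda>(m, n1, n2).
     Gamma (of_nat (\<nu>1 + r1 + n1)) * Gamma (of_nat (\<nu>2 + r2 + n2))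
     * Gamma (- mu B \<nu>1 \<nu>2 lam \<kappa> - phi r1 r2 - of_nat m)
     * of_real (b_coeff D B L \<kappa> (int m) (int n1) (int n2)) * of_real (- 2 * \<kappa> * s0 B) ^ m
     * (1/2 - s / of_real (2 * \<kappa> * s0 B)) powr (mu B \<nu>1 \<nu>2 lam \<kappa> + phi r1 r2 + of_nat m)
     / (t1 - of_real (\<kappa> * t10 B)) ^ (\<nu>1 + r1 + n1)
     / (t2 - of_real (\<kappa> * t20 B)) ^ (\<nu>2 + r2 + n2))"

definition W_index :: "(nat \<times> nat \<times> nat) set" where
  "W_index = {(m, n1, n2). n1 \<le> m \<and> n2 \<le> m}"

definition W ::
  "(nat \<Rightarrow> real) \<Rightarrow> (nat \<Rightarrow> real) \<Rightarrow> real \<Rightarrow> nat \<Rightarrow> nat \<Rightarrow> complex \<Rightarrow> real \<Rightarrow> nat \<Rightarrow> nat \<Rightarrow>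
   complex \<Rightarrow> complex \<Rightarrow> complex \<Rightarrow> complex" where
  "W D B L \<nu>1 \<nu>2 lam \<kappa> r1 r2 s t1 t2 = infsum (W_term D B L \<nu>1 \<nu>2 lam \<kappa> r1 r2 s t1 t2) W_index"

definition W_converges ::
  "(nat \<Rightarrow> real) \<Rightarrow> (nat \<Rightarrow> real) \<Rightarrow> real \<Rightarrow> nat \<Rightarrow> nat \<Rightarrow> complex \<Rightarrow> real \<Rightarrow> nat \<Rightarrow> nat \<Rightarrow>
   complex \<Rightarrow> complex \<Rightarrow> complex \<Rightarrow> bool" where
  "W_converges D B L \<nu>1 \<nu>2 lam \<kappa> r1 r2 s t1 t2 \<longleftrightarrow>
     W_term D B L \<nu>1 \<nu>2 lam \<kappa> r1 r2 s t1 t2 summable_on W_index"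

(* The common part of the discs about s_0 and -s_0 in which the series W(1;.,.) and W(-1;.,.)
   converge, each disc reaching up to the centre of the other. *)
definition lens :: "(nat \<Rightarrow> real) \<Rightarrow> complex set" where
  "lens B = ball (of_real (s0 B)) (2 * s0 B) \<inter> ball (- of_real (s0 B)) (2 * s0 B)"

(* E sg r1 r2 q1 q2 stands for E(sg; r1,r2; q1,q2).  The threshold R makes "|t1|, |t2|
   sufficiently large" precise.  The remainder U is a function of (s,t1,t2), holomorphic in s
   on a neighbourhood V of -kappa s_0 that does not depend on t1, t2, and jointly continuous. *)
definition continuation_formula ::
  "(nat \<Rightarrow> real) \<Rightarrow> (nat \<Rightarrow> real) \<Rightarrow> real \<Rightarrow> nat \<Rightarrow> nat \<Rightarrow> complex \<Rightarrow> real \<Rightarrow>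
   (real \<Rightarrow> nat \<Rightarrow> nat \<Rightarrow> nat \<Rightarrow> nat \<Rightarrow> complex) \<Rightarrow> bool" where
  "continuation_formula D B L \<nu>1 \<nu>2 lam \<kappa> E \<longleftrightarrow>
    (\<forall>r1 r2. \<exists>R>0. \<exists>V U.
       open V \<and> - of_real (\<kappa> * s0 B) \<in> V \<and>
       continuous_on (V \<times> {t. R < cmod t} \<times> {t. R < cmod t}) (\<lambda>(s, t1, t2). U s t1 t2) \<and>
       (\<forall>t1 t2. R < cmod t1 \<and> R < cmod t2 \<longrightarrow>
          (\<lambda>s. U s t1 t2) holomorphic_on V \<and>
          (\<forall>s\<in>lens B.
             W_converges D B L \<nu>1 \<nu>2 lam \<kappa> r1 r2 s t1 t2 \<and>
             (\<forall>q1\<ge>r1. \<forall>q2\<ge>r2. W_converges D B L \<nu>1 \<nu>2 lam (- \<kappa>) q1 q2 s t1 t2) \<and>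
             (\<lambda>(q1, q2). E (- \<kappa>) r1 r2 q1 q2 * W D B L \<nu>1 \<nu>2 lam (- \<kappa>) q1 q2 s t1 t2)
               summable_on ({r1..} \<times> {r2..}) \<and>
             W D B L \<nu>1 \<nu>2 lam \<kappa> r1 r2 s t1 t2 =
               (\<Sum>\<^sub>\<infinity>(q1, q2)\<in>{r1..} \<times> {r2..}.
                  E (- \<kappa>) r1 r2 q1 q2 * W D B L \<nu>1 \<nu>2 lam (- \<kappa>) q1 q2 s t1 t2)
               + U s t1 t2)))"

(* e(sg; q1,q2), where sg = -kappa *)
definition e_coeff ::
  "(nat \<Rightarrow> real) \<Rightarrow> nat \<Rightarrow> nat \<Rightarrow> complex \<Rightarrow>
   (real \<Rightarrow> nat \<Rightarrow> nat \<Rightarrow> nat \<Rightarrow> nat \<Rightarrow> complex) \<Rightarrow> real \<Rightarrow> nat \<Rightarrow> nat \<Rightarrow> complex" where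
  "e_coeff B \<nu>1 \<nu>2 lam E sg q1 q2 = sin (of_real pi * mu B \<nu>1 \<nu>2 lam (- sg)) * E sg 0 0 q1 q2"

end

theory Submission
  imports Defs "HOL-Real_Asymp.Real_Asymp"
begin

text \<open>
  Put \<open>z = 1/2 + s / (2 \<kappa> s\<^sub>0)\<close>, so that \<open>z = 0\<close> and \<open>z = 1\<close> are the two expansion points. On a
  bicircle in the variables \<open>t\<^sub>i + \<kappa> t\<^sub>i\<^sub>0\<close> one extracts the Laurent coefficient with exponents
  \<open>-\<nu>\<^sub>1 - n\<^sub>1\<close>, \<open>-\<nu>\<^sub>2 - n\<^sub>2\<close> from the continuation formula. Up to a Gamma factor, the left-hand side
  becomes \<open>(1 - z) powr \<mu>(\<kappa>)\<close> times a power series in \<open>1 - z\<close> whose coefficients contain exactly the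
  double sum of the limit formula; on the right only the finitely many \<open>q \<le> n\<close> survive, each
  contributing \<open>z powr (\<mu>(-\<kappa>) + \<phi>(q))\<close> times a power series, and \<open>U\<close> gives a function holomorphic at
  \<open>z = 0\<close>. The term \<open>q = n\<close> contributes the exponent \<open>\<mu>(-\<kappa>) + \<phi>(n)\<close>; all others are larger by a
  positive real number, because \<open>b(m,j) = 0\<close> whenever \<open>3m \<le> 2j\<^sub>1 + j\<^sub>2\<close> and \<open>(m,j) \<noteq> 0\<close>.

  That the normalized coefficients converge at all is read off their recurrence, whose terms of
  critical order cancel. The limit is then identified by Darboux's comparison of the
  coefficients with the leading singularity at \<open>z = 0\<close>. Interchanging the sum over \<open>q\<close> with the
  contour integrals needs joint absolute summability, which is not part of the continuation formula:
  for small \<open>z\<close> each \<open>W(-\<kappa>;q)\<close> is dominated by its first term, uniformly in \<open>q\<close>.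
\<close>

section \<open>The coefficients b\<close>

text \<open>Darboux's method in its usual direction would deduce the size of the coefficients from
  the behaviour of the function on the whole circle |1 - z| = 1. The continuation formula describes
  the singularity near z = 0 only, so the argument is reversed: the limit is first shown to exist,
  and then its value can be read off along real z tending to 0. In the recurrence the obstacle are
  the neighbours with a smaller index. They are larger than the coefficient under study by powers
  m^(2/3) and m^(1/3), and would swamp it unless their leading contributions on the two sides
  cancelled. One torus serves both sides because the centre \<kappa> t_i0 of W(\<kappa>) only
  changes sign with \<kappa>: the variable t_i + \<kappa> t_i0 is the natural one of W(-\<kappa>;
  q), which contains no power of it above -\<nu>_i - q_i. This makes the sum over q finite.
  Expanding W(\<kappa>) in the same variable moves its centre by 2 \<kappa> t_i0, the origin of
  these powers in the limit formula.\<close>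

locale parameters =
  fixes D B :: "nat \<Rightarrow> real" and L \<kappa> :: real
  assumes B6: "B 6 > 0" and kappa: "\<kappa> \<in> {1, -1}"
begin

abbreviation b :: "int \<Rightarrow> int \<Rightarrow> int \<Rightarrow> real" where "b \<equiv> b_coeff D B L \<kappa>"

lemma s0_pos: "s0 B > 0"
  using B6 by (simp add: p3_def)

lemma kappa_nz: "\<kappa> \<noteq> 0"
  using kappa by auto

lemma abs_kappa: "\<bar>\<kappa>\<bar> = 1"
  using kappa by auto

lemma b_neg: "m < 0 \<or> i < 0 \<or> j < 0 \<Longrightarrow> b m i j = 0"
  by (subst b_coeff.simps) auto

lemma b_000: "b 0 0 0 = 1"
  by (subst b_coeff.simps) auto

definition rec_rhs :: "int \<Rightarrow> int \<Rightarrow> int \<Rightarrow> real" where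
  "rec_rhs m i j = ((of_int (3*m - 2*i - j) + tau B \<kappa> - 3)\<^sup>2 - L\<^sup>2) * b (m - 1) i j
       + (- 4 * \<kappa> * t10 B * (of_int (3*m - 2*i - j) + tau B \<kappa> - 2) + (t20 B)\<^sup>2 - B 2)
           * b (m - 1) (i - 1) j
       + (- 2 * \<kappa> * t20 B * (of_int (3*m - 2*i - j) + tau B \<kappa> - 5/2) - B 1)
           * b (m - 1) i (j - 1)
       - D 1 * b (m - 2) (i - 1) j - D 2 * b (m - 2) i (j - 1) - D 3 * b (m - 2) i j
       - D 4 * b (m - 3) (i - 1) j - D 5 * b (m - 3) i (j - 1) - D 6 * b (m - 3) i j"

lemma b_step:
  "b m i j = (if m < 0 \<or> i < 0 \<or> j < 0 then 0 else if m = 0 \<and> i = 0 \<and> j = 0 then 1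
     else if 3*m - 2*i - j = 0 then 0 else rec_rhs m i j / (6 * \<kappa> * s0 B * of_int (3*m - 2*i - j)))"
  unfolding rec_rhs_def by (subst b_coeff.simps) (rule refl)

text \<open>Every index shift (k, k1, k2) in the recurrence has 3 k > 2 k1 + k2. The recursion thus
  strictly lowers the weight and, starting below 0, cannot reach the seed \<open>b 0 0 0\<close> of
  weight 0.\<close>

lemma b_eq_0_weight: "3*m - 2*i - j < 0 \<Longrightarrow> b m i j = 0"
proof (induction "nat (m + 1)" arbitrary: m i j rule: less_induct)
  case less
  show ?case
  proof (cases "m < 0 \<or> i < 0 \<or> j < 0")
    case False
    with less.prems have "b m i j = rec_rhs m i j / (6 * \<kappa> * s0 B * of_int (3*m - 2*i - j))"
      by (subst b_step) auto
    also have "rec_rhs m i j = 0"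
    proof -
      have "b (m - k) (i - k1) (j - k2) = 0" if "k \<ge> 1" "3 * k \<ge> 2 * k1 + k2" for k k1 k2
        by (rule less.hyps) (use that less.prems False in auto)
      from this[of 1 0 0] this[of 1 1 0] this[of 1 0 1] this[of 2 1 0] this[of 2 0 1] this[of 2 0 0]
        this[of 3 1 0] this[of 3 0 1] this[of 3 0 0]
      show ?thesis by (simp add: rec_rhs_def)
    qed
    finally show ?thesis by simp
  qed (auto simp: b_neg)
qed

lemma b_eq_0_weight':
  assumes "3*m - 2*i - j \<le> 0" "(m, i, j) \<noteq> (0, 0, 0)"
  shows "b m i j = 0"
proof (cases "3*m - 2*i - j = 0")
  case True
  with assms(2) show ?thesis by (subst b_step) auto
qed (use assms b_eq_0_weight in auto)

text \<open>If the weight \<open>3*m - 2*i - j\<close> vanishes, the recurrence still holds because all the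
  coefficients on its right-hand side have negative weight.\<close>

lemma b_rec:
  assumes "i \<ge> 0" "j \<ge> 0" "m \<ge> 1"
  shows "6 * \<kappa> * s0 B * of_int (3*m - 2*i - j) * b m i j = rec_rhs m i j"
proof (cases "3*m - 2*i - j = 0")
  case False
  with assms have "b m i j = rec_rhs m i j / (6 * \<kappa> * s0 B * of_int (3*m - 2*i - j))"
    by (subst b_step) auto
  moreover have "6 * \<kappa> * s0 B * of_int (3*m - 2*i - j) \<noteq> 0"
    using False s0_pos kappa_nz unfolding of_int_eq_0_iff mult_eq_0_iff by auto
  ultimately show ?thesis by simp
next
  case True
  have "b (m - k) (i - k1) (j - k2) = 0" if "k \<ge> 1" "3 * k > 2 * k1 + k2" for k k1 k2
    by (rule b_eq_0_weight) (use that True in auto)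
  from this[of 1 0 0] this[of 1 1 0] this[of 1 0 1] this[of 2 1 0] this[of 2 0 1] this[of 2 0 0]
    this[of 3 1 0] this[of 3 0 1] this[of 3 0 0]
  have "rec_rhs m i j = 0" by (simp add: rec_rhs_def)
  then show ?thesis using True by simp
qed

text \<open>Every shift lowers m at least as much as i + j. Consequently the weight is at least m
  wherever b does not vanish.\<close>

lemma b_eq_0_order: "i + j > m \<Longrightarrow> b m i j = 0"
proof (induction "nat (m + 1)" arbitrary: m i j rule: less_induct)
  case less
  show ?case
  proof (cases "m < 0 \<or> i < 0 \<or> j < 0")
    case False
    have "b (m - k) (i - k1) (j - k2) = 0" if "k \<ge> 1" "k \<ge> k1 + k2" for k k1 k2
      by (rule less.hyps) (use that less.prems False in auto)
    from this[of 1 0 0] this[of 1 1 0] this[of 1 0 1] this[of 2 1 0] this[of 2 0 1] this[of 2 0 0]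
      this[of 3 1 0] this[of 3 0 1] this[of 3 0 0]
    have "rec_rhs m i j = 0" by (simp add: rec_rhs_def)
    then show ?thesis using less.prems by (subst b_step) auto
  qed (auto simp: b_neg)
qed

text \<open>Up to constants the recurrence multiplies by m^2 when i, j stay fixed and by m when one
  of them drops; dividing by the weight, which is at least m, leaves m and 1. The factor m is
  absorbed by \<open>fact m\<close>. A drop of i or j changes \<open>fact (i + j)\<close> by i + j,
  which is at most m, so this factorial can be kept on the left; later it offsets Gamma factors that
  grow with i and j.\<close>

lemma b_bound:
  obtains K where "K \<ge> 1"
    "\<And>m i j. \<bar>b (int m) (int i) (int j)\<bar> * fact (i + j) \<le> K ^ m * fact m"
proof -
  \<comment> \<open>\<open>A\<close> adds up the constants in front of m^2 or m in the bounds of the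
    nine coefficients below. The 6 is 3 + 3: the weight is at most 3 m, and the offsets next to tau
    are at most 3.\<close>
  define A where "A = (\<bar>tau B \<kappa>\<bar> + 6)\<^sup>2 + L\<^sup>2 + 4 * \<bar>t10 B\<bar> * (\<bar>tau B \<kappa>\<bar> + 6) + (t20 B)\<^sup>2 + \<bar>B 2\<bar>
    + 2 * \<bar>t20 B\<bar> * (\<bar>tau B \<kappa>\<bar> + 6) + \<bar>B 1\<bar> + \<bar>D 1\<bar> + \<bar>D 2\<bar> + \<bar>D 3\<bar> + \<bar>D 4\<bar> + \<bar>D 5\<bar> + \<bar>D 6\<bar>"
  define K where "K = 1 + A / (6 * s0 B)"
  have A0: "A \<ge> 0" unfolding A_def by (intro add_nonneg_nonneg) auto
  have K: "K \<ge> 1" using A0 s0_pos by (simp add: K_def)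
  have main: "\<bar>b (int m) (int i) (int j)\<bar> * fact (i + j) \<le> K ^ m * fact m" for m i j
  proof (induction m arbitrary: i j rule: less_induct)
    case (less m)
    consider "i + j > m" | "m = 0" "i = 0" "j = 0" | "m > 0" "3 * int m - 2 * int i - int j \<le> 0"
      | "i + j \<le> m" "m > 0" "3 * int m - 2 * int i - int j > 0" by linarith
    then show ?case
    proof cases
      case 1
      then show ?thesis using b_eq_0_order[of "int m" "int i" "int j"] K by simp
    next
      case 2 then show ?thesis by (simp add: b_000)
    next
      case 3 then show ?thesis using b_eq_0_weight'[of "int m" "int i" "int j"] K by simp
    next
      case 4
      define p :: real where "p = of_int (3 * int m - 2 * int i - int j)"
      have p: "real m \<le> p" "p \<le> 3 * real m" "p > 0" using 4 by (auto simp: p_def)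
      have m1: "real m \<ge> 1" using 4 by simp
      have rec: "6 * \<kappa> * s0 B * p * b (int m) (int i) (int j) = rec_rhs (int m) (int i) (int j)"
        unfolding p_def by (rule b_rec) (use 4 in auto)
      define M where "M = K ^ (m - 1) * fact m"
      have M0: "M \<ge> 0" using K by (simp add: M_def)
      \<comment> \<open>Unshifted terms keep a spare factor m, which pays for the quadratic growth
        of their coefficient. In \<open>bnd1\<close> that factor is spent on
        \<open>fact (i + j)\<close>, where linear growth suffices.\<close>
      have bnd0: "\<bar>b (int m - int k) (int i) (int j)\<bar> * fact (i + j) * real m \<le> M"
        if "k \<ge> 1" for k
      proof (cases "k \<le> m")
        case False
        then show ?thesis using M0 by (subst b_neg) auto
      next
        case True
        have "\<bar>b (int (m - k)) (int i) (int j)\<bar> * fact (i + j) \<le> K ^ (m - k) * fact (m - k)"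
          by (rule less.IH) (use that True 4 in auto)
        then have "\<bar>b (int m - int k) (int i) (int j)\<bar> * fact (i + j) * real m
            \<le> K ^ (m - k) * fact (m - k) * real m"
          using True by (intro mult_right_mono) (auto simp: of_nat_diff)
        also have "\<dots> = K ^ (m - k) * (real m * fact (m - k))" by simp
        also have "\<dots> \<le> K ^ (m - 1) * (real m * fact (m - 1))"
          using K that by (intro mult_mono power_increasing fact_mono) auto
        also have "real m * fact (m - 1) = fact m" using 4 by (simp add: fact_reduce)
        finally show ?thesis by (simp add: M_def)
      qed
      have bnd1: "\<bar>b (int m - int k) (int i - int k1) (int j - int k2)\<bar> * fact (i + j) \<le> M"
        if "k \<ge> 1" "k1 + k2 = 1" for k k1 k2
      proof (cases "k \<le> m \<and> k1 \<le> i \<and> k2 \<le> j")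
        case False
        then show ?thesis using M0 by (subst b_neg) auto
      next
        case True
        have eq: "int m - int k = int (m - k)" "int i - int k1 = int (i - k1)" "int j - int k2 = int (j - k2)"
          using True by auto
        have "\<bar>b (int (m - k)) (int (i - k1)) (int (j - k2))\<bar> * fact (i - k1 + (j - k2))
           \<le> K ^ (m - k) * fact (m - k)"
          by (rule less.IH) (use that True 4 in auto)
        then have "(\<bar>b (int (m - k)) (int (i - k1)) (int (j - k2))\<bar> * fact (i - k1 + (j - k2))) * real (i + j)
           \<le> (K ^ (m - k) * fact (m - k)) * real m"
          by (rule mult_mono) (use 4 K in auto)
        moreover have "fact (i + j) = real (i + j) * fact (i - k1 + (j - k2))"
        proof -
          have "i + j = Suc (i - k1 + (j - k2))" using that True by linarith
          then show ?thesis by (metis fact_Suc)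
        qed
        ultimately have "\<bar>b (int m - int k) (int i - int k1) (int j - int k2)\<bar> * fact (i + j)
            \<le> K ^ (m - k) * fact (m - k) * real m"
          unfolding eq by (simp add: mult_ac)
        also have "\<dots> = K ^ (m - k) * (real m * fact (m - k))" by simp
        also have "\<dots> \<le> K ^ (m - 1) * (real m * fact (m - 1))"
          using K that by (intro mult_mono power_increasing fact_mono) auto
        also have "real m * fact (m - 1) = fact m" using 4 by (simp add: fact_reduce)
        finally show ?thesis by (simp add: M_def)
      qed
      define F :: real where "F = fact (i + j)"
      have F0: "F > 0" by (simp add: F_def)
      let ?m = "real m"
      have t0: "\<bar>c * b (int m - int k) (int i) (int j)\<bar> * F \<le> a * (?m * M)"
        if "\<bar>c\<bar> \<le> a * ?m\<^sup>2" "k \<ge> 1" for c a k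
      proof -
        have a0: "a \<ge> 0" using that(1) m1 by (smt (verit) mult_nonneg_nonneg mult_neg_pos zero_less_power)
        have "\<bar>c * b (int m - int k) (int i) (int j)\<bar> * F = \<bar>c\<bar> * (\<bar>b (int m - int k) (int i) (int j)\<bar> * F)"
          by (simp add: abs_mult)
        also have "\<dots> \<le> a * ?m\<^sup>2 * (\<bar>b (int m - int k) (int i) (int j)\<bar> * F)"
          using that(1) F0 by (intro mult_right_mono) auto
        also have "\<dots> = a * (?m * (\<bar>b (int m - int k) (int i) (int j)\<bar> * F * ?m))"
          by (simp add: power2_eq_square)
        also have "\<dots> \<le> a * (?m * M)"
          using bnd0[OF that(2)] a0 m1 by (intro mult_left_mono) (auto simp: F_def)
        finally show ?thesis .
      qed
      have t1: "\<bar>c * b (int m - int k) (int i - int k1) (int j - int k2)\<bar> * F \<le> a * (?m * M)"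
        if "\<bar>c\<bar> \<le> a * ?m" "k \<ge> 1" "k1 + k2 = 1" for c a k k1 k2
      proof -
        have "\<bar>c * b (int m - int k) (int i - int k1) (int j - int k2)\<bar> * F
          = \<bar>c\<bar> * (\<bar>b (int m - int k) (int i - int k1) (int j - int k2)\<bar> * F)"
          by (simp add: abs_mult)
        also have "\<dots> \<le> a * ?m * M"
          using bnd1[OF that(2,3)] that(1) F0 by (intro mult_mono) (auto simp: F_def)
        finally show ?thesis by simp
      qed
      define T where "T = \<bar>tau B \<kappa>\<bar> + 6"
      have pT: "\<bar>p + tau B \<kappa> - c\<bar> \<le> T * ?m" if "0 \<le> c" "c \<le> 3" for c
      proof -
        have "\<bar>p + tau B \<kappa> - c\<bar> \<le> 3 * ?m + (\<bar>tau B \<kappa>\<bar> + 3) * 1" using p that by auto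
        also have "\<dots> \<le> 3 * ?m + (\<bar>tau B \<kappa>\<bar> + 3) * ?m" using m1 by (intro add_left_mono mult_left_mono) auto
        finally show ?thesis by (simp add: T_def algebra_simps)
      qed
      have le_m: "x \<le> x * ?m" "x \<le> x * ?m\<^sup>2" if "x \<ge> 0" for x
        using m1 that mult_left_mono[of 1 ?m x] mult_left_mono[of 1 "?m\<^sup>2" x] by auto
      have c1: "\<bar>(p + tau B \<kappa> - 3)\<^sup>2 - L\<^sup>2\<bar> \<le> (T\<^sup>2 + L\<^sup>2) * ?m\<^sup>2"
      proof -
        have "(p + tau B \<kappa> - 3)\<^sup>2 \<le> (T * ?m)\<^sup>2" using pT[of 3] by (simp add: abs_le_square_iff[symmetric] T_def)
        moreover have "L\<^sup>2 \<le> L\<^sup>2 * ?m\<^sup>2" by (rule le_m) simp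
        ultimately show ?thesis
          using zero_le_power2[of "p + tau B \<kappa> - 3"] zero_le_power2[of L]
            zero_le_power2[of "T * ?m"] zero_le_power2[of "L * ?m"]
          unfolding power_mult_distrib distrib_right by linarith
      qed
      have c2: "\<bar>- 4 * \<kappa> * t10 B * (p + tau B \<kappa> - 2) + (t20 B)\<^sup>2 - B 2\<bar>
        \<le> (4 * \<bar>t10 B\<bar> * T + (t20 B)\<^sup>2 + \<bar>B 2\<bar>) * ?m"
      proof -
        have "\<bar>- 4 * \<kappa> * t10 B * (p + tau B \<kappa> - 2)\<bar> = 4 * \<bar>t10 B\<bar> * \<bar>p + tau B \<kappa> - 2\<bar>"
          using abs_kappa by (simp add: abs_mult)
        also have "\<dots> \<le> 4 * \<bar>t10 B\<bar> * (T * ?m)" by (intro mult_left_mono pT) auto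
        finally show ?thesis
          using le_m(1)[of "(t20 B)\<^sup>2"] le_m(1)[of "\<bar>B 2\<bar>"] zero_le_power2[of "t20 B"]
          unfolding distrib_right mult.assoc by linarith
      qed
      have c3: "\<bar>- 2 * \<kappa> * t20 B * (p + tau B \<kappa> - 5/2) - B 1\<bar> \<le> (2 * \<bar>t20 B\<bar> * T + \<bar>B 1\<bar>) * ?m"
      proof -
        have "\<bar>- 2 * \<kappa> * t20 B * (p + tau B \<kappa> - 5/2)\<bar> = 2 * \<bar>t20 B\<bar> * \<bar>p + tau B \<kappa> - 5/2\<bar>"
          using abs_kappa by (simp add: abs_mult)
        also have "\<dots> \<le> 2 * \<bar>t20 B\<bar> * (T * ?m)" by (intro mult_left_mono pT) auto
        finally show ?thesis using le_m(1)[of "\<bar>B 1\<bar>"] unfolding distrib_right mult.assoc by linarith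
      qed
      have "\<bar>rec_rhs (int m) (int i) (int j)\<bar> * F \<le> A * (?m * M)"
      proof -
        note T = t0[OF c1, of 1] t1[OF c2, of 1 1 0] t1[OF c3, of 1 0 1]
          t1[OF le_m(1)[OF abs_ge_zero], of 2 1 0 "D 1"] t1[OF le_m(1)[OF abs_ge_zero], of 2 0 1 "D 2"]
          t0[OF le_m(2)[OF abs_ge_zero], of 2 "D 3"]
          t1[OF le_m(1)[OF abs_ge_zero], of 3 1 0 "D 4"] t1[OF le_m(1)[OF abs_ge_zero], of 3 0 1 "D 5"]
          t0[OF le_m(2)[OF abs_ge_zero], of 3 "D 6"]
        have sum9: "\<bar>x1 + x2 + x3 - x4 - x5 - x6 - x7 - x8 - x9\<bar> * F
            \<le> (a1 + a2 + a3 + a4 + a5 + a6 + a7 + a8 + a9) * G"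
          if "\<bar>x1\<bar> * F \<le> a1 * G" "\<bar>x2\<bar> * F \<le> a2 * G" "\<bar>x3\<bar> * F \<le> a3 * G" "\<bar>x4\<bar> * F \<le> a4 * G"
            "\<bar>x5\<bar> * F \<le> a5 * G" "\<bar>x6\<bar> * F \<le> a6 * G" "\<bar>x7\<bar> * F \<le> a7 * G" "\<bar>x8\<bar> * F \<le> a8 * G"
            "\<bar>x9\<bar> * F \<le> a9 * G"
          for x1 x2 x3 x4 x5 x6 x7 x8 x9 a1 a2 a3 a4 a5 a6 a7 a8 a9 G
        proof -
          have *: "\<bar>x\<bar> * F \<le> c \<longleftrightarrow> x * F \<le> c \<and> - (x * F) \<le> c" for x c
            using F0 abs_le_iff[of "x * F" c] by (simp add: abs_mult)
          show ?thesis
            using that unfolding * distrib_right left_diff_distrib by linarith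
        qed
        have A: "A = (T\<^sup>2 + L\<^sup>2) + (4 * \<bar>t10 B\<bar> * T + (t20 B)\<^sup>2 + \<bar>B 2\<bar>) + (2 * \<bar>t20 B\<bar> * T + \<bar>B 1\<bar>)
            + \<bar>D 1\<bar> + \<bar>D 2\<bar> + \<bar>D 3\<bar> + \<bar>D 4\<bar> + \<bar>D 5\<bar> + \<bar>D 6\<bar>"
          by (simp add: A_def T_def)
        show ?thesis
          unfolding rec_rhs_def p_def[symmetric] A by (rule sum9) (use T in \<open>simp_all only: of_nat_1 of_nat_0
              diff_zero of_nat_numeral add_0_right add_0 order.refl one_le_numeral simp_thms\<close>)
      qed
      moreover have "\<bar>rec_rhs (int m) (int i) (int j)\<bar> = 6 * s0 B * p * \<bar>b (int m) (int i) (int j)\<bar>"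
        unfolding rec[symmetric] abs_mult using abs_kappa s0_pos p(3) by simp
      ultimately have "6 * s0 B * p * (\<bar>b (int m) (int i) (int j)\<bar> * F) \<le> A * (?m * M)" by simp
      \<comment> \<open>The lower bound m for the weight p turns the division by p into the gain of
        one power of m.\<close>
      also have "\<dots> \<le> A * (p * M)" using p A0 M0 by (intro mult_left_mono mult_right_mono) auto
      finally have "p * (6 * s0 B * (\<bar>b (int m) (int i) (int j)\<bar> * F)) \<le> p * (A * M)" by (simp add: mult_ac)
      then have "6 * s0 B * (\<bar>b (int m) (int i) (int j)\<bar> * F) \<le> A * M" using p(3) by simp
      then have "\<bar>b (int m) (int i) (int j)\<bar> * F \<le> A / (6 * s0 B) * M"
        using s0_pos by (simp add: field_simps)
      also have "\<dots> \<le> K * M" using M0 by (intro mult_right_mono) (auto simp: K_def)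
      also have "\<dots> = K ^ m * fact m" using 4 by (cases m) (auto simp: M_def)
      finally show ?thesis by (simp add: F_def)
    qed
  qed
  show ?thesis using that K main by blast
qed

end

section \<open>The recurrence after shifting the expansion point in t\<close>

definition shift1 :: "(nat \<Rightarrow> nat \<Rightarrow> real) \<Rightarrow> nat \<Rightarrow> nat \<Rightarrow> real" where
  "shift1 f i j = (if i = 0 then 0 else f (i - 1) j)"

definition shift2 :: "(nat \<Rightarrow> nat \<Rightarrow> real) \<Rightarrow> nat \<Rightarrow> nat \<Rightarrow> real" where
  "shift2 f i j = (if j = 0 then 0 else f i (j - 1))"

text \<open>On generating functions in two variables \<open>x, y\<close>, \<open>shift1\<close> and \<open>shift2\<close> multiply by
  \<open>x\<close> and \<open>y\<close>, \<open>emult \<alpha> \<beta>\<close> multiplies by \<open>exp (\<alpha> * x + \<beta> * y)\<close>, and \<open>wt q\<close> is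
  the Euler operator \<open>q - 2 * x * d/dx - y * d/dy\<close>.\<close>

definition emult :: "real \<Rightarrow> real \<Rightarrow> (nat \<Rightarrow> nat \<Rightarrow> real) \<Rightarrow> nat \<Rightarrow> nat \<Rightarrow> real" where
  "emult \<alpha> \<beta> f i j =
     (\<Sum>k=0..i. \<Sum>l=0..j. f k l * (\<alpha> ^ (i - k) / fact (i - k)) * (\<beta> ^ (j - l) / fact (j - l)))"

definition wt :: "real \<Rightarrow> (nat \<Rightarrow> nat \<Rightarrow> real) \<Rightarrow> nat \<Rightarrow> nat \<Rightarrow> real" where
  "wt q f i j = (q - 2 * real i - real j) * f i j"

lemma shift_linear:
  "shift1 (\<lambda>i j. f i j + g i j) i j = shift1 f i j + shift1 g i j"
  "shift1 (\<lambda>i j. c * f i j) i j = c * shift1 f i j"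
  "shift2 (\<lambda>i j. f i j + g i j) i j = shift2 f i j + shift2 g i j"
  "shift2 (\<lambda>i j. c * f i j) i j = c * shift2 f i j"
  by (simp_all add: shift1_def shift2_def)

lemma shift1_shift2: "shift1 (shift2 f) i j = shift2 (shift1 f) i j"
  by (simp add: shift1_def shift2_def)

lemma shift_wt:
  "shift1 (wt q f) i j = wt (q + 2) (shift1 f) i j"
  "shift2 (wt q f) i j = wt (q + 1) (shift2 f) i j"
  by (simp_all add: shift1_def shift2_def wt_def of_nat_diff algebra_simps)

lemma emult_add: "emult \<alpha> \<beta> (\<lambda>i j. f i j + g i j) i j = emult \<alpha> \<beta> f i j + emult \<alpha> \<beta> g i j"
  by (simp only: emult_def distrib_right sum.distrib)

lemma emult_cmult: "emult \<alpha> \<beta> (\<lambda>i j. c * f i j) i j = c * emult \<alpha> \<beta> f i j"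
  by (simp add: emult_def sum_distrib_left mult_ac)

text \<open>The product rule for x d/dx applied to exp(a x) g(x), read on coefficients: the factor n
  - k cancels into the factorial of a^(n-k) / (n-k)!.\<close>

lemma sum_exp_index:
  fixes g :: "nat \<Rightarrow> real"
  shows "(\<Sum>k=0..n. real k * g k * (a ^ (n - k) / fact (n - k))) =
    real n * (\<Sum>k=0..n. g k * (a ^ (n - k) / fact (n - k)))
    - a * (if n = 0 then 0 else \<Sum>k=0..n-1. g k * (a ^ (n - 1 - k) / fact (n - 1 - k)))"
proof (cases n)
  case (Suc m)
  have *: "real (Suc m - k) * (a ^ (Suc m - k) / fact (Suc m - k)) = a * (a ^ (m - k) / fact (m - k))"
    if "k \<le> m" for k
  proof -
    have "Suc m - k = Suc (m - k)" using that by simp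
    then show ?thesis by (simp add: fact_Suc del: of_nat_Suc)
  qed
  have "real n * (\<Sum>k=0..n. g k * (a ^ (n - k) / fact (n - k)))
      - (\<Sum>k=0..n. real k * g k * (a ^ (n - k) / fact (n - k)))
      = (\<Sum>k=0..n. g k * (real (n - k) * (a ^ (n - k) / fact (n - k))))"
    unfolding sum_distrib_left sum_subtractf[symmetric]
    by (rule sum.cong) (auto simp: of_nat_diff algebra_simps diff_divide_distrib)
  also have "\<dots> = (\<Sum>k=0..m. g k * (real (Suc m - k) * (a ^ (Suc m - k) / fact (Suc m - k))))"
    unfolding Suc by simp
  also have "\<dots> = (\<Sum>k=0..m. g k * (a * (a ^ (m - k) / fact (m - k))))"
    by (rule sum.cong[OF refl]) (subst *, auto)
  also have "\<dots> = a * (\<Sum>k=0..m. g k * (a ^ (m - k) / fact (m - k)))"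
    by (simp add: sum_distrib_left mult_ac)
  finally show ?thesis using Suc by simp
qed auto

lemma emult_index1: "emult \<alpha> \<beta> (\<lambda>k l. real k * f k l) i j =
  real i * emult \<alpha> \<beta> f i j - \<alpha> * shift1 (emult \<alpha> \<beta> f) i j"
proof -
  let ?g = "\<lambda>k. \<Sum>l=0..j. f k l * (\<beta> ^ (j - l) / fact (j - l))"
  have *: "emult \<alpha> \<beta> f n j = (\<Sum>k=0..n. ?g k * (\<alpha> ^ (n - k) / fact (n - k)))" for n
    unfolding emult_def sum_distrib_right by (intro sum.cong refl) (simp add: mult_ac)
  have **: "emult \<alpha> \<beta> (\<lambda>k l. real k * f k l) i j
      = (\<Sum>k=0..i. real k * ?g k * (\<alpha> ^ (i - k) / fact (i - k)))"
    unfolding emult_def sum_distrib_right sum_distrib_left by (intro sum.cong refl) (simp add: mult_ac)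
  show ?thesis
    unfolding ** shift1_def sum_exp_index by (simp add: *)
qed

lemma emult_swap: "emult \<alpha> \<beta> f i j = emult \<beta> \<alpha> (\<lambda>i j. f j i) j i"
  unfolding emult_def by (subst sum.swap) (intro sum.cong refl, simp only: mult_ac)

lemma emult_index2: "emult \<alpha> \<beta> (\<lambda>k l. real l * f k l) i j =
  real j * emult \<alpha> \<beta> f i j - \<beta> * shift2 (emult \<alpha> \<beta> f) i j"
  using emult_index1[of \<beta> \<alpha> "\<lambda>i j. f j i" j i]
  by (simp add: shift1_def shift2_def emult_swap[of \<alpha> \<beta> f] emult_swap[of \<alpha> \<beta> "\<lambda>k l. real l * f k l"])

lemma emult_shift1: "emult \<alpha> \<beta> (shift1 f) i j = shift1 (emult \<alpha> \<beta> f) i j"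
proof (cases i)
  case 0
  then show ?thesis by (simp add: emult_def shift1_def)
next
  case (Suc n)
  show ?thesis
    unfolding emult_def shift1_def Suc by (subst sum.atLeast0_atMost_Suc_shift) (simp add: atLeast0AtMost)
qed

lemma emult_shift2: "emult \<alpha> \<beta> (shift2 f) i j = shift2 (emult \<alpha> \<beta> f) i j"
proof -
  have "(\<lambda>i j. shift2 f j i) = shift1 (\<lambda>i j. f j i)" by (auto simp: shift1_def shift2_def fun_eq_iff)
  then show ?thesis
    by (subst emult_swap) (simp add: emult_shift1 shift1_def shift2_def emult_swap[of \<alpha> \<beta> f])
qed

text \<open>Conjugating the Euler operator by the exponential adds the derivative of the exponent: q
  - 2 x d/dx - y d/dy acquires the extra term 2 \<alpha> x + \<beta> y.\<close>

lemma emult_wt: "emult \<alpha> \<beta> (wt q f) i j =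
  wt q (emult \<alpha> \<beta> f) i j + 2 * \<alpha> * shift1 (emult \<alpha> \<beta> f) i j + \<beta> * shift2 (emult \<alpha> \<beta> f) i j"
proof -
  have "wt q f = (\<lambda>k l. q * f k l + ((-2) * (real k * f k l) + (-1) * (real l * f k l)))"
    by (auto simp: wt_def fun_eq_iff algebra_simps)
  then show ?thesis
    by (simp only: emult_add emult_cmult emult_index1 emult_index2) (simp add: wt_def algebra_simps)
qed

section \<open>The recurrence of the recentred coefficients\<close>

context parameters
begin

abbreviation \<alpha> :: real where "\<alpha> \<equiv> 2 * \<kappa> * t10 B"
abbreviation \<beta> :: real where "\<beta> \<equiv> 2 * \<kappa> * t20 B"

text \<open>\<open>c m i j\<close> is the coefficient that arises from \<open>b m\<close> when \<open>W\<close> is re-expanded in negative powers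
  of \<open>t1 + \<kappa> * t10 B\<close> and \<open>t2 + \<kappa> * t20 B\<close>.\<close>

definition c :: "int \<Rightarrow> nat \<Rightarrow> nat \<Rightarrow> real" where
  "c m = emult \<alpha> \<beta> (\<lambda>k l. b m (int k) (int l))"

lemma b_shift:
  "b m (int k - 1) (int l) = shift1 (\<lambda>k l. b m (int k) (int l)) k l"
  "b m (int k) (int l - 1) = shift2 (\<lambda>k l. b m (int k) (int l)) k l"
  by (auto simp: shift1_def shift2_def b_neg of_nat_diff)

text \<open>Because of the factor \<open>exp (\<alpha> * x + \<beta> * y)\<close> all second-order shifts cancel.\<close>

lemma c_rec:
  fixes i j :: nat
  assumes m: "m \<ge> 1"
  defines "p \<equiv> 3 * real_of_int m - 2 * real i - real j"
  shows "6 * \<kappa> * s0 B * (p * c m i j + 2 * \<alpha> * shift1 (c m) i j + \<beta> * shift2 (c m) i j) =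
    ((p + tau B \<kappa> - 3)\<^sup>2 - L\<^sup>2) * c (m - 1) i j
    + (2 * \<alpha> * (p + tau B \<kappa> - 2) + (t20 B)\<^sup>2 - B 2) * shift1 (c (m - 1)) i j
    + (\<beta> * (p + tau B \<kappa> - 5/2) - B 1) * shift2 (c (m - 1)) i j
    - D 1 * shift1 (c (m - 2)) i j - D 2 * shift2 (c (m - 2)) i j - D 3 * c (m - 2) i j
    - D 4 * shift1 (c (m - 3)) i j - D 5 * shift2 (c (m - 3)) i j - D 6 * c (m - 3) i j"
proof -
  let ?b = "\<lambda>m k l. b m (int k) (int l)"
  let ?E = "emult \<alpha> \<beta>"
  \<comment> \<open>The squared factor is \<open>wt q1\<close> applied twice. The factors with
    offsets 2 and 5/2 act on shifted arguments and become \<open>wt\<close> at q1 + 1 and q1 + 1/2;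
    their constants -4 \<kappa> t10 and -2 \<kappa> t20 are -2 \<alpha> and -\<beta>.\<close>
  define q q1 where "q = 3 * real_of_int m" and "q1 = 3 * real_of_int m + tau B \<kappa> - 3"
  have fn: "(\<lambda>k l. (6 * \<kappa> * s0 B) * wt q (?b m) k l) = (\<lambda>k l.
      wt q1 (wt q1 (?b (m - 1))) k l + ((- L\<^sup>2) * ?b (m - 1) k l
    + ((- 2 * \<alpha>) * wt (q1 + 1) (shift1 (?b (m - 1))) k l
    + (((t20 B)\<^sup>2 - B 2) * shift1 (?b (m - 1)) k l
    + ((- \<beta>) * wt (q1 + 1/2) (shift2 (?b (m - 1))) k l
    + ((- B 1) * shift2 (?b (m - 1)) k l
    + ((- D 1) * shift1 (?b (m - 2)) k l
    + ((- D 2) * shift2 (?b (m - 2)) k l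
    + ((- D 3) * ?b (m - 2) k l
    + ((- D 4) * shift1 (?b (m - 3)) k l
    + ((- D 5) * shift2 (?b (m - 3)) k l
    + (- D 6) * ?b (m - 3) k l)))))))))))" (is "?l = ?r")
  proof (intro ext)
    fix k l
    have "?l k l = rec_rhs m (int k) (int l)"
      using b_rec[of "int k" "int l" m] m by (simp add: wt_def q_def algebra_simps)
    also have "\<dots> = ?r k l"
      unfolding rec_rhs_def b_shift q1_def wt_def
      by (simp add: power2_eq_square algebra_simps)
    finally show "?l k l = ?r k l" .
  qed
  have "?E ?l i j = ?E ?r i j" by (simp only: fn)
  moreover have "?E (wt q f) = (\<lambda>i j. wt q (?E f) i j + (2 * \<alpha> * shift1 (?E f) i j + \<beta> * shift2 (?E f) i j))"
    for q f by (auto simp: fun_eq_iff emult_wt)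
  moreover have "?E (shift1 f) = shift1 (?E f)" "?E (shift2 f) = shift2 (?E f)" for f
    by (auto simp: fun_eq_iff emult_shift1 emult_shift2)
  ultimately have "6 * \<kappa> * s0 B * (wt q (c m) i j + (2 * \<alpha> * shift1 (c m) i j + \<beta> * shift2 (c m) i j)) =
     (wt q1 (\<lambda>i j. wt q1 (c (m - 1)) i j + (2 * \<alpha> * shift1 (c (m - 1)) i j + \<beta> * shift2 (c (m - 1)) i j)) i j
     + (2 * \<alpha> * shift1 (\<lambda>i j. wt q1 (c (m - 1)) i j + (2 * \<alpha> * shift1 (c (m - 1)) i j + \<beta> * shift2 (c (m - 1)) i j)) i j
     + \<beta> * shift2 (\<lambda>i j. wt q1 (c (m - 1)) i j + (2 * \<alpha> * shift1 (c (m - 1)) i j + \<beta> * shift2 (c (m - 1)) i j)) i j))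
     + ((- L\<^sup>2) * c (m - 1) i j
     + ((- 2 * \<alpha>) * (wt (q1 + 1) (shift1 (c (m - 1))) i j + (2 * \<alpha> * shift1 (shift1 (c (m - 1))) i j + \<beta> * shift2 (shift1 (c (m - 1))) i j))
     + (((t20 B)\<^sup>2 - B 2) * shift1 (c (m - 1)) i j
     + ((- \<beta>) * (wt (q1 + 1/2) (shift2 (c (m - 1))) i j + (2 * \<alpha> * shift1 (shift2 (c (m - 1))) i j + \<beta> * shift2 (shift2 (c (m - 1))) i j))
     + ((- B 1) * shift2 (c (m - 1)) i j
     + ((- D 1) * shift1 (c (m - 2)) i j
     + ((- D 2) * shift2 (c (m - 2)) i j
     + ((- D 3) * c (m - 2) i j
     + ((- D 4) * shift1 (c (m - 3)) i j
     + ((- D 5) * shift2 (c (m - 3)) i j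
     + (- D 6) * c (m - 3) i j))))))))))"
    unfolding c_def by (simp only: emult_add emult_cmult)
  \<comment> \<open>The double \<open>wt q1\<close> contributes the square of 2 \<alpha> x + \<beta>
    y. The two shifted terms contribute -(2 \<alpha> x + \<beta> y) times the same expression, so
    only first-order shifts remain.\<close>
  then show ?thesis
    unfolding shift_linear shift_wt shift1_shift2
    unfolding wt_def q_def q1_def p_def
    by (simp add: power2_eq_square algebra_simps)
qed

end

section \<open>Asymptotics of solutions of the recurrence\<close>

text \<open>A discrete Gronwall argument: a running bound for |v| + 1 grows by a factor of at most 1
  + 3 e(m), hence at most exp (3 e(m)), per step and stays bounded because e is summable. Then the
  increments are summable and v telescopes.\<close>

lemma convergent_if_small_increments:
  fixes v e :: "nat \<Rightarrow> real"
  assumes e: "summable e" "\<And>m. e m \<ge> 0"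
    and step: "\<And>m. m \<ge> N \<Longrightarrow>
      \<bar>v (m + 3) - v (m + 2)\<bar> \<le> e m * (\<bar>v (m + 2)\<bar> + \<bar>v (m + 1)\<bar> + \<bar>v m\<bar> + 1)"
  shows "convergent v"
proof -
  define W where "W = 1 + (\<Sum>k\<le>N+2. \<bar>v k\<bar>)"
  \<comment> \<open>The 3 counts the three previous values: each is at most G - 1 in absolute value,
    so the bracket in \<open>step\<close> is at most 3 G.\<close>
  define G where "G = (\<lambda>m. W * exp (3 * (\<Sum>i<m. e i)))"
  have W: "W > 0" unfolding W_def by (intro add_pos_nonneg sum_nonneg) auto
  have G_mono: "G m \<le> G (Suc m)" for m
    using W e(2)[of m] by (simp add: G_def)
  have bound: "\<bar>v k\<bar> + 1 \<le> G m" if "m \<ge> N" "k \<le> m + 2" for m k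
    using that
  proof (induction m arbitrary: k rule: nat_induct_at_least)
    case base
    have "\<bar>v k\<bar> \<le> (\<Sum>k\<le>N+2. \<bar>v k\<bar>)" using base by (intro member_le_sum) auto
    then have "\<bar>v k\<bar> + 1 \<le> W" by (simp add: W_def)
    also have "W * 1 \<le> W * exp (3 * (\<Sum>i<N. e i))"
      using W e(2) by (intro mult_left_mono) (auto intro: sum_nonneg)
    finally show ?case by (simp add: G_def)
  next
    case (Suc m)
    show ?case
    proof (cases "k \<le> m + 2")
      case True
      then show ?thesis using Suc.IH[of k] G_mono[of m] by linarith
    next
      case False
      then have k: "k = m + 3" using Suc.prems by simp
      have "\<bar>v (m + 2)\<bar> + \<bar>v (m + 1)\<bar> + \<bar>v m\<bar> + 1 \<le> 3 * G m"
        using Suc.IH[of "m + 2"] Suc.IH[of "m + 1"] Suc.IH[of m] by simp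
      then have "e m * (\<bar>v (m + 2)\<bar> + \<bar>v (m + 1)\<bar> + \<bar>v m\<bar> + 1) \<le> e m * (3 * G m)"
        using e(2) by (intro mult_left_mono)
      then have "\<bar>v (m + 3)\<bar> + 1 \<le> \<bar>v (m + 2)\<bar> + 1 + e m * (3 * G m)"
        using step[OF Suc.hyps] by linarith
      also have "\<dots> \<le> G m * (1 + 3 * e m)" using Suc.IH[of "m + 2"] by (simp add: algebra_simps)
      also have "\<dots> \<le> G m * exp (3 * e m)"
        using W by (intro mult_left_mono exp_ge_add_one_self) (auto simp: G_def)
      also have "\<dots> = G (Suc m)" by (simp add: G_def exp_add[symmetric] algebra_simps)
      finally show ?thesis by (simp add: k)
    qed
  qed
  define G' where "G' = W * exp (3 * suminf e)"
  have G': "G m \<le> G'" for m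
    unfolding G_def G'_def using W e by (intro mult_left_mono) (auto intro!: sum_le_suminf)
  have diff: "\<bar>v (m + 3) - v (m + 2)\<bar> \<le> 3 * G' * e m" if "m \<ge> N" for m
  proof -
    have "\<bar>v (m + 2)\<bar> + \<bar>v (m + 1)\<bar> + \<bar>v m\<bar> + 1 \<le> 3 * G'"
      using bound[of m "m + 2"] bound[of m "m + 1"] bound[of m m] that G'[of m] by simp
    then have "e m * (\<bar>v (m + 2)\<bar> + \<bar>v (m + 1)\<bar> + \<bar>v m\<bar> + 1) \<le> e m * (3 * G')"
      using e(2) by (intro mult_left_mono)
    then show ?thesis using step[OF that] by (simp add: mult_ac)
  qed
  have "summable (\<lambda>m. v (Suc (m + 2)) - v (m + 2))"
    by (rule summable_comparison_test[where g = "\<lambda>m. 3 * G' * e m"])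
       (use diff e in \<open>auto intro!: exI[of _ N] summable_mult simp: eval_nat_numeral\<close>)
  then have "convergent (\<lambda>n. \<Sum>m<n. v (Suc (m + 2)) - v (m + 2))"
    by (simp add: summable_iff_convergent)
  also have "(\<lambda>n. \<Sum>m<n. v (Suc (m + 2)) - v (m + 2)) = (\<lambda>n. v (n + 2) - v 2)"
    using sum_lessThan_telescope[of "\<lambda>m. v (m + 2)"] by (auto simp: fun_eq_iff numeral_2_eq_2)
  finally have "convergent (\<lambda>n. v 2 + (v (n + 2) - v 2))"
    by (intro convergent_add convergent_const)
  then show ?thesis by (simp add: convergent_ignore_initial_segment[of v 2, simplified])
qed

lemma bigo_shift_powr:
  fixes x :: "nat \<Rightarrow> real"
  assumes "x \<in> O(\<lambda>m. real m powr \<theta>)"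
  shows "(\<lambda>m. x (m - k)) \<in> O(\<lambda>m. real m powr \<theta>)"
proof -
  have "filterlim (\<lambda>m. m - k) sequentially (sequentially :: nat filter)"
    by (rule filterlim_minus_const_nat_at_top)
  from landau_o.big.compose[OF assms this]
  have "(\<lambda>m. x (m - k)) \<in> O(\<lambda>m. real (m - k) powr \<theta>)" .
  also have "(\<lambda>m. real (m - k) powr \<theta>) \<in> \<Theta>(\<lambda>m. (real m - real k) powr \<theta>)"
    by (intro bigthetaI_cong eventually_mono[OF eventually_ge_at_top[of k]]) (auto simp: of_nat_diff)
  also have "(\<lambda>m. (real m - real k) powr \<theta>) \<in> O(\<lambda>m. real m powr \<theta>)"
    by real_asymp
  finally show ?thesis .
qed

text \<open>Normalising by m^(-\<theta>) turns the leading factor 1 + \<theta>/m into 1 + O(1/m^2).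
  The increments of the normalised sequence are then controlled by the summable m^(-4/3). The third
  claim feeds the induction in \<open>scaled_asymp\<close>, where solutions at smaller indices enter
  through their differences.\<close>

lemma perturbed_recurrence_asymptotics:
  fixes x A A2 A3 I :: "nat \<Rightarrow> real" and \<theta> :: real
  assumes rec: "eventually (\<lambda>m. x m = A m * x (m - 1) + A2 m * x (m - 2) + A3 m * x (m - 3) + I m) sequentially"
    and A: "(\<lambda>m. A m - 1 - \<theta> / real m) \<in> O(\<lambda>m. 1 / real m ^ 2)"
    and A2: "A2 \<in> O(\<lambda>m. 1 / real m ^ 2)" and A3: "A3 \<in> O(\<lambda>m. 1 / real m ^ 2)"
    and I: "I \<in> O(\<lambda>m. real m powr (\<theta> - 4/3))"
  shows "convergent (\<lambda>m. x m * real m powr (- \<theta>))"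
    and "x \<in> O(\<lambda>m. real m powr \<theta>)"
    and "(\<lambda>m. x m - x (m - 1)) \<in> O(\<lambda>m. real m powr (\<theta> - 1))"
proof -
  define v where "v = (\<lambda>m. x m * real m powr (- \<theta>))"
  \<comment> \<open>Converts x(m - k) m^(-\<theta>) into the normalised value v(m - k).\<close>
  define r where "r = (\<lambda>k m. ((real m - real k) / real m) powr \<theta>)"
  have r1: "(\<lambda>m. r k m) \<in> O(\<lambda>_. 1)" for k unfolding r_def by real_asymp
  define E1 where "E1 = (\<lambda>m. A m * r 1 m - 1)"
  have "(\<lambda>m. (1 + \<theta> / real m) * r 1 m - 1) \<in> O(\<lambda>m. 1 / real m ^ 2)"
    unfolding r_def by real_asymp
  moreover have "(\<lambda>m. (A m - 1 - \<theta> / real m) * r 1 m) \<in> O(\<lambda>m. 1 / real m ^ 2 * 1)"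
    by (intro landau_o.big.mult A r1)
  ultimately have "(\<lambda>m. ((1 + \<theta> / real m) * r 1 m - 1) + (A m - 1 - \<theta> / real m) * r 1 m) \<in> O(\<lambda>m. 1 / real m ^ 2)"
    by (intro sum_in_bigo(1)) simp_all
  also have "(\<lambda>m. ((1 + \<theta> / real m) * r 1 m - 1) + (A m - 1 - \<theta> / real m) * r 1 m) = E1"
    by (auto simp: E1_def fun_eq_iff algebra_simps)
  finally have E1: "E1 \<in> O(\<lambda>m. 1 / real m ^ 2)" .
  have sq: "(\<lambda>m. 1 / real m ^ 2) \<in> O(\<lambda>m. real m powr (- 4/3))" by real_asymp
  have E2: "(\<lambda>m. A2 m * r 2 m) \<in> O(\<lambda>m. 1 / real m ^ 2)" "(\<lambda>m. A3 m * r 3 m) \<in> O(\<lambda>m. 1 / real m ^ 2)"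
    using landau_o.big.mult[OF A2 r1] landau_o.big.mult[OF A3 r1] by simp_all
  have E3: "(\<lambda>m. I m * real m powr (- \<theta>)) \<in> O(\<lambda>m. real m powr (- 4/3))"
  proof -
    have "(\<lambda>m. I m * real m powr (- \<theta>)) \<in> O(\<lambda>m. real m powr (\<theta> - 4/3) * real m powr (- \<theta>))"
      by (intro landau_o.big.mult I) auto
    then show ?thesis by (simp add: powr_add[symmetric])
  qed
  obtain K1 where K1: "K1 > 0" "eventually (\<lambda>m. norm (E1 m) \<le> K1 * norm (real m powr (- 4/3))) sequentially"
    using landau_o.big_trans[OF E1 sq] by (elim landau_o.bigE)
  obtain K2 where K2: "K2 > 0" "eventually (\<lambda>m. norm (A2 m * r 2 m) \<le> K2 * norm (real m powr (- 4/3))) sequentially"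
    using landau_o.big_trans[OF E2(1) sq] by (elim landau_o.bigE)
  obtain K3 where K3: "K3 > 0" "eventually (\<lambda>m. norm (A3 m * r 3 m) \<le> K3 * norm (real m powr (- 4/3))) sequentially"
    using landau_o.big_trans[OF E2(2) sq] by (elim landau_o.bigE)
  obtain K4 where K4: "K4 > 0" "eventually (\<lambda>m. norm (I m * real m powr (- \<theta>)) \<le> K4 * norm (real m powr (- 4/3))) sequentially"
    using E3 by (elim landau_o.bigE)
  define K where "K = K1 + K2 + K3 + K4"
  have "eventually (\<lambda>m. \<bar>v m - v (m - 1)\<bar> \<le> K * real m powr (- 4/3) * (\<bar>v (m - 1)\<bar> + \<bar>v (m - 2)\<bar> + \<bar>v (m - 3)\<bar> + 1)) sequentially"
    using K1(2) K2(2) K3(2) K4(2) rec eventually_gt_at_top[of 3]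
  proof eventually_elim
    case (elim m)
    define h where "h = real m powr (- 4/3)"
    have xv: "x (m - k) * real m powr (- \<theta>) = r k m * v (m - k)" if "k < m" for k
      using that by (simp add: v_def r_def powr_divide powr_minus of_nat_diff field_simps)
    have "v m = A m * (x (m - 1) * real m powr (- \<theta>)) + A2 m * (x (m - 2) * real m powr (- \<theta>))
       + A3 m * (x (m - 3) * real m powr (- \<theta>)) + I m * real m powr (- \<theta>)"
      unfolding v_def by (subst elim(5)) (simp add: algebra_simps)
    also have "\<dots> = v (m - 1) + (E1 m * v (m - 1) + A2 m * r 2 m * v (m - 2) + A3 m * r 3 m * v (m - 3)
       + I m * real m powr (- \<theta>))"
    proof -
      have "1 < m" "2 < m" "3 < m" using elim(6) by auto
      note xvs = this[THEN xv]
      show ?thesis unfolding xvs by (simp add: E1_def algebra_simps)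
    qed
    finally have eq: "v m - v (m - 1) = E1 m * v (m - 1) + A2 m * r 2 m * v (m - 2) + A3 m * r 3 m * v (m - 3)
       + I m * real m powr (- \<theta>)" by simp
    have le: "\<bar>y * w\<bar> \<le> K * h * \<bar>w\<bar>" if "norm y \<le> k * norm (real m powr (- 4/3))" "k \<le> K" for y w k
    proof -
      have "\<bar>y\<bar> \<le> k * h" using that by (simp add: h_def)
      also have "\<dots> \<le> K * h" using that by (intro mult_right_mono) (auto simp: h_def)
      finally show ?thesis by (simp add: abs_mult mult_right_mono)
    qed
    have "\<bar>v m - v (m - 1)\<bar> \<le> \<bar>E1 m * v (m - 1)\<bar> + \<bar>A2 m * r 2 m * v (m - 2)\<bar> + \<bar>A3 m * r 3 m * v (m - 3)\<bar>
       + \<bar>I m * real m powr (- \<theta>) * 1\<bar>" unfolding eq by linarith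
    also have "\<dots> \<le> K * h * \<bar>v (m - 1)\<bar> + K * h * \<bar>v (m - 2)\<bar> + K * h * \<bar>v (m - 3)\<bar> + K * h * \<bar>1\<bar>"
      by (intro add_mono le[OF elim(1)] le[OF elim(2)] le[OF elim(3)] le[OF elim(4)])
         (use K1(1) K2(1) K3(1) K4(1) in \<open>auto simp: K_def\<close>)
    finally show ?case by (simp add: h_def algebra_simps)
  qed
  then obtain N where N: "\<And>m. m \<ge> N \<Longrightarrow>
      \<bar>v m - v (m - 1)\<bar> \<le> K * real m powr (- 4/3) * (\<bar>v (m - 1)\<bar> + \<bar>v (m - 2)\<bar> + \<bar>v (m - 3)\<bar> + 1)"
    unfolding eventually_sequentially by blast
  show conv: "convergent (\<lambda>m. x m * real m powr (- \<theta>))"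
    unfolding v_def[symmetric]
  proof (rule convergent_if_small_increments)
    show "summable (\<lambda>m. K * real (m + 3) powr (- 4/3))"
      by (intro summable_mult summable_ignore_initial_segment) (simp add: summable_real_powr_iff)
    show "K * real (m + 3) powr (- 4/3) \<ge> 0" for m
      using K1(1) K2(1) K3(1) K4(1) by (simp add: K_def)
    show "\<bar>v (m + 3) - v (m + 2)\<bar> \<le> K * real (m + 3) powr (- 4/3) * (\<bar>v (m + 2)\<bar> + \<bar>v (m + 1)\<bar> + \<bar>v m\<bar> + 1)"
      if "m \<ge> N" for m
      using N[of "m + 3"] that by (simp add: eval_nat_numeral)
  qed
  obtain K0 where "\<And>m. norm (v m) \<le> K0"
    using convergent_imp_Bseq[OF conv] unfolding v_def[symmetric] Bseq_def by blast
  then have "v \<in> O(\<lambda>_. 1)"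
    by (intro bigoI[of _ K0]) auto
  then have *: "(\<lambda>m. v m * real m powr \<theta>) \<in> O(\<lambda>m. 1 * real m powr \<theta>)"
    by (intro landau_o.big.mult) auto
  have "x \<in> \<Theta>(\<lambda>m. v m * real m powr \<theta>)"
    by (intro bigthetaI_cong eventually_mono[OF eventually_gt_at_top[of 0]])
       (auto simp: v_def powr_minus field_simps)
  also note *
  finally show x: "x \<in> O(\<lambda>m. real m powr \<theta>)" by simp
  have A1: "(\<lambda>m. A m - 1) \<in> O(\<lambda>m. 1 / real m)"
  proof -
    have sq: "(\<lambda>m. 1 / real m ^ 2) \<in> O(\<lambda>m. 1 / real m)" by real_asymp
    have "(\<lambda>m. \<theta> / real m) \<in> O(\<lambda>m. 1 / real m)" by real_asymp
    from sum_in_bigo(1)[OF landau_o.big_trans[OF A sq] this] show ?thesis by simp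
  qed
  have sq1: "(\<lambda>m. 1 / real m ^ 2) \<in> O(\<lambda>m. 1 / real m)" by real_asymp
  have pw: "(\<lambda>m. 1 / real m * real m powr \<theta>) \<in> O(\<lambda>m. real m powr (\<theta> - 1))" by real_asymp
  have I1: "(\<lambda>m. real m powr (\<theta> - 4/3)) \<in> O(\<lambda>m. real m powr (\<theta> - 1))" by real_asymp
  have "(\<lambda>m. x m - x (m - 1)) \<in> \<Theta>(\<lambda>m. (A m - 1) * x (m - 1) + A2 m * x (m - 2) + A3 m * x (m - 3) + I m)"
    by (intro bigthetaI_cong eventually_mono[OF rec]) (auto simp: algebra_simps)
  also have "(\<lambda>m. (A m - 1) * x (m - 1) + A2 m * x (m - 2) + A3 m * x (m - 3) + I m) \<in> O(\<lambda>m. real m powr (\<theta> - 1))"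
    by (intro sum_in_bigo landau_o.big_trans[OF landau_o.big.mult pw] landau_o.big_trans[OF I I1] A1
         landau_o.big_trans[OF A2 sq1] landau_o.big_trans[OF A3 sq1] bigo_shift_powr x)
  finally show "(\<lambda>m. x m - x (m - 1)) \<in> O(\<lambda>m. real m powr (\<theta> - 1))" .
qed

section \<open>Power-law behaviour of the normalised coefficients\<close>

context parameters
begin

text \<open>To leading order the recurrence reads 18 \<kappa> s0 m c(m) = 9 m^2 c(m - 1). Removing
  the growth m! / (2 \<kappa> s0)^m makes the coefficient of the preceding value tend to 1.\<close>

definition scaled :: "nat \<Rightarrow> nat \<Rightarrow> nat \<Rightarrow> real" where
  "scaled i j m = c (int m) i j * (2 * \<kappa> * s0 B) ^ m / fact m"

text \<open>Read off from the coefficient (p + tau - 3)^2 / (3 m p) with 3 m = p + 2 i + j: it is 1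
  + \<theta>/m + O(1/m^2) for \<theta> = (2 (tau - 3) - (2 i + j)) / 3.\<close>

definition \<theta> :: "nat \<Rightarrow> nat \<Rightarrow> real" where
  "\<theta> i j = 2/3 * tau B \<kappa> - 2 - 2/3 * real i - 1/3 * real j"

abbreviation scaled1 :: "nat \<Rightarrow> nat \<Rightarrow> nat \<Rightarrow> real" where
  "scaled1 i j m \<equiv> shift1 (\<lambda>i j. scaled i j m) i j"

abbreviation scaled2 :: "nat \<Rightarrow> nat \<Rightarrow> nat \<Rightarrow> real" where
  "scaled2 i j m \<equiv> shift2 (\<lambda>i j. scaled i j m) i j"

lemma scaled_rec:
  fixes m :: nat
  assumes m: "m \<ge> 3"
  defines "p \<equiv> \<lambda>i j. 3 * real m - 2 * real i - real j" and "\<sigma> \<equiv> 2 * \<kappa> * s0 B"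
  shows "p i j * scaled i j m + 2 * \<alpha> * scaled1 i j m + \<beta> * scaled2 i j m =
    (((p i j + tau B \<kappa> - 3)\<^sup>2 - L\<^sup>2) * scaled i j (m - 1)
     + (2 * \<alpha> * (p i j + tau B \<kappa> - 2) + (t20 B)\<^sup>2 - B 2) * scaled1 i j (m - 1)
     + (\<beta> * (p i j + tau B \<kappa> - 5/2) - B 1) * scaled2 i j (m - 1)) / (3 * real m)
    - (\<sigma> / 3) / (real m * (real m - 1)) * (D 1 * scaled1 i j (m - 2) + D 2 * scaled2 i j (m - 2) + D 3 * scaled i j (m - 2))
    - (\<sigma>\<^sup>2 / 3) / (real m * (real m - 1) * (real m - 2)) * (D 4 * scaled1 i j (m - 3) + D 5 * scaled2 i j (m - 3) + D 6 * scaled i j (m - 3))"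
proof -
  have \<sigma>: "\<sigma> \<noteq> 0" using s0_pos kappa_nz by (simp add: \<sigma>_def)
  define f where "f = (\<lambda>k. fact k / \<sigma> ^ k)"
  have cx: "c (int k) = (\<lambda>i j. f k * scaled i j k)" for k
    using \<sigma> by (auto simp: scaled_def f_def \<sigma>_def fun_eq_iff)
  have f: "f m = real m * (real m - 1) * (real m - 2) / \<sigma> ^ 3 * f (m - 3)"
     "f (m - 1) = (real m - 1) * (real m - 2) / \<sigma> ^ 2 * f (m - 3)"
     "f (m - 2) = (real m - 2) / \<sigma> * f (m - 3)"
  proof -
    obtain k where k: "m = k + 3" using m by (metis le_add_diff_inverse2)
    show "f m = real m * (real m - 1) * (real m - 2) / \<sigma> ^ 3 * f (m - 3)"
      "f (m - 1) = (real m - 1) * (real m - 2) / \<sigma> ^ 2 * f (m - 3)"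
      "f (m - 2) = (real m - 2) / \<sigma> * f (m - 3)"
      using \<sigma> by (auto simp: f_def k eval_nat_numeral field_simps)
  qed
  have f3: "f (m - 3) \<noteq> 0" using \<sigma> by (simp add: f_def)
  have m': "int m - 1 = int (m - 1)" "int m - 2 = int (m - 2)" "int m - 3 = int (m - 3)"
    using m by auto
  have scaled: "3 * \<sigma> * (p i j * (f m * scaled i j m) + 2 * \<alpha> * (f m * scaled1 i j m) + \<beta> * (f m * scaled2 i j m)) =
    ((p i j + tau B \<kappa> - 3)\<^sup>2 - L\<^sup>2) * (f (m - 1) * scaled i j (m - 1))
    + (2 * \<alpha> * (p i j + tau B \<kappa> - 2) + (t20 B)\<^sup>2 - B 2) * (f (m - 1) * scaled1 i j (m - 1))
    + (\<beta> * (p i j + tau B \<kappa> - 5/2) - B 1) * (f (m - 1) * scaled2 i j (m - 1))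
    - D 1 * (f (m - 2) * scaled1 i j (m - 2)) - D 2 * (f (m - 2) * scaled2 i j (m - 2)) - D 3 * (f (m - 2) * scaled i j (m - 2))
    - D 4 * (f (m - 3) * scaled1 i j (m - 3)) - D 5 * (f (m - 3) * scaled2 i j (m - 3)) - D 6 * (f (m - 3) * scaled i j (m - 3))"
    using c_rec[of "int m" i j] m unfolding m' cx shift_linear by (simp add: p_def \<sigma>_def)
  have key: "3 * \<sigma> * (P * (a3 * F * X) + 2 * al * (a3 * F * X1) + be * (a3 * F * X2)) =
      C0 * (a2 * F * Y) + C1 * (a2 * F * Y1) + C2 * (a2 * F * Y2)
      - d1 * (a1 * F * Z1) - d2 * (a1 * F * Z2) - d3 * (a1 * F * Z)
      - d4 * (F * U1) - d5 * (F * U2) - d6 * (F * U) \<longleftrightarrow>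
      P * X + 2 * al * X1 + be * X2 = (C0 * Y + C1 * Y1 + C2 * Y2) * (a2 / (3 * \<sigma> * a3))
      - (a1 / (3 * \<sigma> * a3)) * (d1 * Z1 + d2 * Z2 + d3 * Z) - (1 / (3 * \<sigma> * a3)) * (d4 * U1 + d5 * U2 + d6 * U)"
    if "a3 \<noteq> 0" "F \<noteq> 0"
    for P a3 F X al X1 be X2 C0 C1 C2 a2 Y Y1 Y2 d1 d2 d3 a1 Z1 Z2 Z d4 d5 d6 U1 U2 U
  proof -
    have "3 * \<sigma> * (P * (a3 * F * X) + 2 * al * (a3 * F * X1) + be * (a3 * F * X2)) =
      C0 * (a2 * F * Y) + C1 * (a2 * F * Y1) + C2 * (a2 * F * Y2)
      - d1 * (a1 * F * Z1) - d2 * (a1 * F * Z2) - d3 * (a1 * F * Z)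
      - d4 * (F * U1) - d5 * (F * U2) - d6 * (F * U) \<longleftrightarrow>
      (3 * \<sigma> * a3 * F) * (P * X + 2 * al * X1 + be * X2) = F * ((C0 * Y + C1 * Y1 + C2 * Y2) * a2
      - a1 * (d1 * Z1 + d2 * Z2 + d3 * Z) - (d4 * U1 + d5 * U2 + d6 * U))"
      by (simp add: algebra_simps)
    also have "\<dots> \<longleftrightarrow> P * X + 2 * al * X1 + be * X2 = ((C0 * Y + C1 * Y1 + C2 * Y2) * a2
      - a1 * (d1 * Z1 + d2 * Z2 + d3 * Z) - (d4 * U1 + d5 * U2 + d6 * U)) / (3 * \<sigma> * a3)"
      using that \<sigma> by (simp add: eq_divide_eq mult_ac)
    finally show ?thesis by (simp add: diff_divide_distrib)
  qed
  have nz: "real m * (real m - 1) * (real m - 2) / \<sigma> ^ 3 \<noteq> 0" using m \<sigma> by auto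
  have "p i j * scaled i j m + 2 * \<alpha> * scaled1 i j m + \<beta> * scaled2 i j m =
    (((p i j + tau B \<kappa> - 3)\<^sup>2 - L\<^sup>2) * scaled i j (m - 1)
     + (2 * \<alpha> * (p i j + tau B \<kappa> - 2) + (t20 B)\<^sup>2 - B 2) * scaled1 i j (m - 1)
     + (\<beta> * (p i j + tau B \<kappa> - 5/2) - B 1) * scaled2 i j (m - 1))
       * (((real m - 1) * (real m - 2) / \<sigma> ^ 2) / (3 * \<sigma> * (real m * (real m - 1) * (real m - 2) / \<sigma> ^ 3)))
    - (((real m - 2) / \<sigma>) / (3 * \<sigma> * (real m * (real m - 1) * (real m - 2) / \<sigma> ^ 3)))
       * (D 1 * scaled1 i j (m - 2) + D 2 * scaled2 i j (m - 2) + D 3 * scaled i j (m - 2))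
    - (1 / (3 * \<sigma> * (real m * (real m - 1) * (real m - 2) / \<sigma> ^ 3)))
       * (D 4 * scaled1 i j (m - 3) + D 5 * scaled2 i j (m - 3) + D 6 * scaled i j (m - 3))"
    by (rule key[THEN iffD1, OF nz f3 scaled[unfolded f]])
  moreover have simps: "((real m - 1) * (real m - 2) / \<sigma> ^ 2) / (3 * \<sigma> * (real m * (real m - 1) * (real m - 2) / \<sigma> ^ 3)) = 1 / (3 * real m)"
    "((real m - 2) / \<sigma>) / (3 * \<sigma> * (real m * (real m - 1) * (real m - 2) / \<sigma> ^ 3)) = (\<sigma> / 3) / (real m * (real m - 1))"
    "1 / (3 * \<sigma> * (real m * (real m - 1) * (real m - 2) / \<sigma> ^ 3)) = (\<sigma>\<^sup>2 / 3) / (real m * (real m - 1) * (real m - 2))"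
    using \<sigma> m by (auto simp: divide_simps eval_nat_numeral)
  ultimately show ?thesis
    unfolding simps by (simp only: times_divide_eq_right mult_1_right)
qed

text \<open>Induction on i + j, with the values at smaller indices as inhomogeneity. They are larger
  by m^(2/3) or m^(1/3), and after division by p alone would still dominate. But 2 \<alpha>
  \<open>scaled1 i j m\<close> on the left meets \<open>scaled1 i j (m - 1)\<close> on the right
  with a coefficient tending to 2 \<alpha>, and likewise for \<beta>: only increments and terms with
  a factor 1/m remain. This gains another power of m and brings the inhomogeneity down to
  m^(\<theta> - 4/3).\<close>

lemma scaled_asymp:
  shows "convergent (\<lambda>m. scaled i j m * real m powr (- \<theta> i j)) \<and> scaled i j \<in> O(\<lambda>m. real m powr \<theta> i j)
    \<and> (\<lambda>m. scaled i j m - scaled i j (m - 1)) \<in> O(\<lambda>m. real m powr (\<theta> i j - 1))"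
proof (induction "i + j" arbitrary: i j rule: less_induct)
  case less
  define t where "t = \<theta> i j"
  define p where "p = (\<lambda>m. 3 * real m - 2 * real i - real j)"
  define \<sigma> where "\<sigma> = 2 * \<kappa> * s0 B"
  have pw: "(\<lambda>m. real m powr (t + 1/3)) \<in> O(\<lambda>m. real m powr (t + 2/3))"
    "(\<lambda>m. real m powr (t + 1/3 - 1)) \<in> O(\<lambda>m. real m powr (t - 1/3))" by real_asymp+
  have X1: "scaled1 i j \<in> O(\<lambda>m. real m powr (t + 2/3)) \<and> (\<lambda>m. scaled1 i j m - scaled1 i j (m - 1)) \<in> O(\<lambda>m. real m powr (t - 1/3))"
  proof (cases i)
    case (Suc i')
    have "\<theta> i' j = t + 2/3" by (simp add: t_def \<theta>_def Suc algebra_simps)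
    then show ?thesis using less.hyps[of i' j] by (simp add: shift1_def Suc)
  qed (simp add: shift1_def)
  have X2: "scaled2 i j \<in> O(\<lambda>m. real m powr (t + 2/3)) \<and> (\<lambda>m. scaled2 i j m - scaled2 i j (m - 1)) \<in> O(\<lambda>m. real m powr (t - 1/3))"
  proof (cases j)
    case (Suc j')
    have "\<theta> i j' = t + 1/3" by (simp add: t_def \<theta>_def Suc algebra_simps)
    then show ?thesis using less.hyps[of i j'] pw by (auto simp: shift2_def Suc intro: landau_o.big_trans)
  qed (simp add: shift2_def)
  have X1s: "(\<lambda>m. scaled1 i j (m - k)) \<in> O(\<lambda>m. real m powr (t + 2/3))"
    and X2s: "(\<lambda>m. scaled2 i j (m - k)) \<in> O(\<lambda>m. real m powr (t + 2/3))" for k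
    using X1 X2 bigo_shift_powr by blast+
  define A where "A = (\<lambda>m. ((p m + tau B \<kappa> - 3)\<^sup>2 - L\<^sup>2) / (3 * real m) / p m)"
  define g1 where "g1 = (\<lambda>m. (\<sigma> / 3) / (real m * (real m - 1)))"
  define g2 where "g2 = (\<lambda>m. (\<sigma>\<^sup>2 / 3) / (real m * (real m - 1) * (real m - 2)))"
  define A2 where "A2 = (\<lambda>m. - g1 m * D 3 / p m)"
  define A3 where "A3 = (\<lambda>m. - g2 m * D 6 / p m)"
  \<comment> \<open>\<open>h1\<close> and \<open>h2\<close> are the coefficients of the neighbours
    at m - 1 minus their limits 2 \<alpha> and \<beta>; the limits go into the differences in
    \<open>J\<close>.\<close>
  define h1 where "h1 = (\<lambda>m. (2 * \<alpha> * (p m + tau B \<kappa> - 2) + (t20 B)\<^sup>2 - B 2) / (3 * real m) - 2 * \<alpha>)"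
  define h2 where "h2 = (\<lambda>m. (\<beta> * (p m + tau B \<kappa> - 5/2) - B 1) / (3 * real m) - \<beta>)"
  define J where "J = (\<lambda>m. (- 2 * \<alpha>) * (scaled1 i j m - scaled1 i j (m - 1)) + h1 m * scaled1 i j (m - 1)
     + ((- \<beta>) * (scaled2 i j m - scaled2 i j (m - 1)) + h2 m * scaled2 i j (m - 1))
     + (- D 1 * g1 m * scaled1 i j (m - 2) + - D 2 * g1 m * scaled2 i j (m - 2))
     + (- D 4 * g2 m * scaled1 i j (m - 3) + - D 5 * g2 m * scaled2 i j (m - 3)))"
  define I where "I = (\<lambda>m. 1 / p m * J m)"
  have ev: "eventually (\<lambda>m. m \<ge> 3 \<and> p m > 0) sequentially"
    unfolding p_def by (intro eventually_conj eventually_ge_at_top; real_asymp)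
  have rec: "eventually (\<lambda>m. scaled i j m = A m * scaled i j (m - 1) + A2 m * scaled i j (m - 2) + A3 m * scaled i j (m - 3) + I m) sequentially"
    using ev
  proof eventually_elim
    case (elim m)
    have "p m * scaled i j m = p m * (A m * scaled i j (m - 1) + A2 m * scaled i j (m - 2) + A3 m * scaled i j (m - 3) + I m)"
    proof -
      have "p m * scaled i j m = ((p m + tau B \<kappa> - 3)\<^sup>2 - L\<^sup>2) / (3 * real m) * scaled i j (m - 1)
        + (- g1 m * D 3) * scaled i j (m - 2) + (- g2 m * D 6) * scaled i j (m - 3) + J m"
      proof -
        have pm: "3 * real m - 2 * real i - real j = p m" by (simp add: p_def)
        have gm: "(\<sigma> / 3) / (real m * (real m - 1)) = g1 m"
          "(\<sigma>\<^sup>2 / 3) / (real m * (real m - 1) * (real m - 2)) = g2 m" by (simp_all add: g1_def g2_def)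
        have hm: "(2 * \<alpha> * (p m + tau B \<kappa> - 2) + (t20 B)\<^sup>2 - B 2) / (3 * real m) = h1 m + 2 * \<alpha>"
          "(\<beta> * (p m + tau B \<kappa> - 5/2) - B 1) / (3 * real m) = h2 m + \<beta>" by (simp_all add: h1_def h2_def)
        have div: "(a * y + a1 * y1 + a2 * y2) / d = a / d * y + a1 / d * y1 + a2 / d * y2" for a a1 a2 y y1 y2 d :: real
          by (simp add: add_divide_distrib)
        have alg: "P * X0 = A0 * Y0 + (- G1 * D3) * Z0 + (- G2 * D6) * U0
          + ((- 2 * al) * (X1 - Y1) + H1 * Y1 + ((- be) * (X2 - Y2) + H2 * Y2)
          + (- D1 * G1 * Z1 + - D2 * G1 * Z2) + (- D4 * G2 * U1 + - D5 * G2 * U2))"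
          if "P * X0 + 2 * al * X1 + be * X2 = A0 * Y0 + (H1 + 2 * al) * Y1 + (H2 + be) * Y2
            - G1 * (D1 * Z1 + D2 * Z2 + D3 * Z0) - G2 * (D4 * U1 + D5 * U2 + D6 * U0)"
          for P X0 A0 Y0 G1 D3 Z0 G2 D6 U0 al X1 Y1 H1 be X2 Y2 H2 D1 Z1 D2 Z2 D4 U1 D5 U2 :: real
          using that by (simp add: algebra_simps)
        show ?thesis
          unfolding J_def
          by (rule alg) (use scaled_rec[of m i j] elim in \<open>simp only: pm \<sigma>_def[symmetric] gm div hm\<close>)
      qed
      also have "\<dots> = p m * (A m * scaled i j (m - 1) + A2 m * scaled i j (m - 2) + A3 m * scaled i j (m - 3) + I m)"
      proof -
        have gen: "a * y + b * z + c * w + J = P * (a / P * y + b / P * z + c / P * w + 1 / P * J)"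
          if "P \<noteq> 0" for a y b z c w J P :: real
          using that by (simp add: field_simps)
        show ?thesis unfolding A_def A2_def A3_def I_def by (rule gen) (use elim in simp)
      qed
      finally show ?thesis .
    qed
    then show ?case using elim by simp
  qed
  have t_eq: "t = (2 * (tau B \<kappa> - 3) - (2 * real i + real j)) / 3" by (simp add: t_def \<theta>_def field_simps)
  \<comment> \<open>The value of t removes exactly the part of the numerator that is linear in p; a
    constant over 3 m p is left.\<close>
  have A: "(\<lambda>m. A m - 1 - t / real m) \<in> O(\<lambda>m. 1 / real m ^ 2)"
  proof -
    have "(\<lambda>m. A m - 1 - t / real m) \<in> \<Theta>(\<lambda>m. ((tau B \<kappa> - 3)\<^sup>2 - L\<^sup>2) / (3 * real m * p m))"
    proof (intro bigthetaI_cong eventually_mono[OF ev])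
      fix m assume m: "m \<ge> 3 \<and> p m > 0"
      have "3 * real m = p m + (2 * real i + real j)" by (simp add: p_def)
      moreover have "(p m + tau B \<kappa> - 3)\<^sup>2 - L\<^sup>2 - p m * (p m + (2 * real i + real j)) - t * (3 * p m)
          = (tau B \<kappa> - 3)\<^sup>2 - L\<^sup>2"
      proof -
        have "t * (3 * p m) = (2 * (tau B \<kappa> - 3) - (2 * real i + real j)) * p m" by (simp add: t_eq)
        then show ?thesis by (simp add: power2_eq_square algebra_simps)
      qed
      ultimately have "(p m + tau B \<kappa> - 3)\<^sup>2 - L\<^sup>2 - p m * (3 * real m) - t * (3 * p m)
          = (tau B \<kappa> - 3)\<^sup>2 - L\<^sup>2" by simp
      moreover have "A m - 1 - t / real m
          = ((p m + tau B \<kappa> - 3)\<^sup>2 - L\<^sup>2 - p m * (3 * real m) - t * (3 * p m)) / (3 * real m * p m)"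
        using m unfolding A_def by (simp add: diff_divide_distrib)
      ultimately show "A m - 1 - t / real m = ((tau B \<kappa> - 3)\<^sup>2 - L\<^sup>2) / (3 * real m * p m)" by simp
    qed
    also have "(\<lambda>m. ((tau B \<kappa> - 3)\<^sup>2 - L\<^sup>2) / (3 * real m * p m)) \<in> O(\<lambda>m. 1 / real m ^ 2)"
    proof -
      define k where "k = 2 * real i + real j"
      have "(\<lambda>m. 1 / (3 * real m * (3 * real m - k))) \<in> O(\<lambda>m. 1 / real m ^ 2)" by real_asymp
      then have "(\<lambda>m. ((tau B \<kappa> - 3)\<^sup>2 - L\<^sup>2) * (1 / (3 * real m * (3 * real m - k)))) \<in> O(\<lambda>m. 1 * (1 / real m ^ 2))"
        by (intro landau_o.big.mult) auto
      then show ?thesis by (simp add: p_def k_def algebra_simps)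
    qed
    finally show ?thesis .
  qed
  have A2: "A2 \<in> O(\<lambda>m. 1 / real m ^ 2)"
    unfolding A2_def g1_def p_def by real_asymp
  have A3: "A3 \<in> O(\<lambda>m. 1 / real m ^ 2)"
    unfolding A3_def g2_def p_def by real_asymp
  have I: "I \<in> O(\<lambda>m. real m powr (t - 4/3))"
  proof -
    have pinv: "(\<lambda>m. 1 / p m) \<in> O(\<lambda>m. 1 / real m)" unfolding p_def by real_asymp
    have inv: "(\<lambda>m. K / (3 * real m)) \<in> O(\<lambda>m. 1 / real m)" for K
      by (rule bigoI[of _ "\<bar>K\<bar>"]) (auto simp: abs_mult divide_simps)
    have "h1 \<in> \<Theta>(\<lambda>m. (2 * \<alpha> * (tau B \<kappa> - 2 - (2 * real i + real j)) + (t20 B)\<^sup>2 - B 2) / (3 * real m))"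
      "h2 \<in> \<Theta>(\<lambda>m. (\<beta> * (tau B \<kappa> - 5/2 - (2 * real i + real j)) - B 1) / (3 * real m))"
      unfolding h1_def h2_def p_def
      by (intro bigthetaI_cong eventually_mono[OF eventually_gt_at_top[of 0]]; simp add: field_simps)+
    then have h: "h1 \<in> O(\<lambda>m. 1 / real m)" "h2 \<in> O(\<lambda>m. 1 / real m)"
      using inv by (auto intro: landau_o.big_trans dest!: bigthetaD1)
    have "(\<lambda>m. 1 / (real m * (real m - 1))) \<in> O(\<lambda>m. 1 / real m)"
      "(\<lambda>m. 1 / (real m * (real m - 1) * (real m - 2))) \<in> O(\<lambda>m. 1 / real m)" by real_asymp+
    then have "(\<lambda>m. (c * (\<sigma> / 3)) * (1 / (real m * (real m - 1)))) \<in> O(\<lambda>m. 1 * (1 / real m))"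
      "(\<lambda>m. (c * (\<sigma>\<^sup>2 / 3)) * (1 / (real m * (real m - 1) * (real m - 2)))) \<in> O(\<lambda>m. 1 * (1 / real m))" for c
      by (intro landau_o.big.mult; simp)+
    then have hg: "(\<lambda>m. c * g1 m) \<in> O(\<lambda>m. 1 / real m)" "(\<lambda>m. c * g2 m) \<in> O(\<lambda>m. 1 / real m)" for c
      unfolding g1_def g2_def by simp_all
    have e: "(\<lambda>m. 1 / real m * real m powr (t + 2/3)) \<in> O(\<lambda>m. real m powr (t - 1/3))"
      "(\<lambda>m. 1 / real m * real m powr (t - 1/3)) \<in> O(\<lambda>m. real m powr (t - 4/3))" by real_asymp+
    have J: "J \<in> O(\<lambda>m. real m powr (t - 1/3))"
    proof -
      have P: "(\<lambda>m. f m * g m) \<in> O(\<lambda>m. real m powr (t - 1/3))"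
        if "f \<in> O(\<lambda>m. 1 / real m)" "g \<in> O(\<lambda>m. real m powr (t + 2/3))" for f g
        using landau_o.big_trans[OF landau_o.big.mult[OF that] e(1)] .
      have Q: "(\<lambda>m. (- 2 * \<alpha>) * (scaled1 i j m - scaled1 i j (m - 1))) \<in> O(\<lambda>m. real m powr (t - 1/3))"
        "(\<lambda>m. (- \<beta>) * (scaled2 i j m - scaled2 i j (m - 1))) \<in> O(\<lambda>m. real m powr (t - 1/3))"
        using landau_o.big.mult[OF bigo_const conjunct2[OF X1]] landau_o.big.mult[OF bigo_const conjunct2[OF X2]]
        by simp_all
      show ?thesis
        unfolding J_def by (intro sum_in_bigo(1) Q P h hg X1s X2s)
    qed
    show ?thesis
      unfolding I_def by (intro landau_o.big_trans[OF landau_o.big.mult e(2)] pinv J)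
  qed
  from perturbed_recurrence_asymptotics[OF rec A A2 A3 I] show ?case by (simp add: t_def)
qed

end

section \<open>An Abelian theorem\<close>

text \<open>The quotient is \<open>Gamma z\<close> divided by the approximants
  \<open>Gamma_series' z n\<close> of Gauss's limit.\<close>

lemma Gamma_plus_nat_asymp:
  fixes z :: complex
  assumes z: "z \<notin> \<int>\<^sub>\<le>\<^sub>0"
  shows "(\<lambda>n. Gamma (z + of_nat n) / (fact n * of_nat n powr (z - 1))) \<longlonglongrightarrow> 1"
proof -
  have G: "Gamma z \<noteq> 0" using z by (simp add: Gamma_eq_zero_iff)
  have "(\<lambda>n. Gamma z / Gamma_series' z n) \<longlonglongrightarrow> Gamma z / Gamma z"
    using G by (intro tendsto_intros Gamma_series'_LIMSEQ)
  then have "(\<lambda>n. Gamma z / Gamma_series' z n) \<longlonglongrightarrow> 1" using G by simp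
  moreover have "eventually (\<lambda>n. Gamma z / Gamma_series' z n = Gamma (z + of_nat n) / (fact n * of_nat n powr (z - 1))) sequentially"
    using eventually_gt_at_top[of 0]
  proof eventually_elim
    case (elim n)
    have "Gamma (z + of_nat n) = pochhammer z n * Gamma z"
      using G by (simp add: pochhammer_Gamma[OF z])
    moreover have "of_nat n powr (z - 1) = exp (z * of_real (ln (of_nat n))) / of_nat n"
      using elim by (simp add: powr_diff) (simp add: powr_def Ln_of_nat)
    moreover have "fact n = of_nat n * (fact (n - 1) :: complex)"
      using elim by (simp add: fact_reduce)
    ultimately show ?case using elim by (simp add: Gamma_series'_def divide_simps mult.commute)
  qed
  ultimately show ?thesis by (simp add: tendsto_cong)
qed

text \<open>The binomial series of (1 - (1 - t))^(-\<beta>), with Pochhammer symbols written as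
  quotients of Gamma values.\<close>

lemma Gamma_series_sums:
  fixes \<beta> :: complex
  assumes \<beta>: "\<beta> \<notin> \<int>\<^sub>\<le>\<^sub>0" and t: "0 < t" "t < 1"
  shows "(\<lambda>k. Gamma (\<beta> + of_nat k) / fact k * of_real (1 - t) ^ k) sums (Gamma \<beta> * of_real t powr (- \<beta>))"
proof -
  have G: "Gamma \<beta> \<noteq> 0" using \<beta> by (simp add: Gamma_eq_zero_iff)
  have "norm (- of_real (1 - t) :: complex) < 1" using t by (simp only: norm_minus_cancel norm_of_real)
  from gen_binomial_complex[OF this, of "- \<beta>"]
  have "(\<lambda>k. Gamma \<beta> * ((- \<beta> gchoose k) * (- of_real (1 - t)) ^ k)) sums (Gamma \<beta> * (1 + - of_real (1 - t)) powr (- \<beta>))"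
    by (intro sums_mult)
  also have "(\<lambda>k. Gamma \<beta> * ((- \<beta> gchoose k) * (- of_real (1 - t)) ^ k)) = (\<lambda>k. Gamma (\<beta> + of_nat k) / fact k * of_real (1 - t) ^ k)"
  proof
    fix k
    have "((-1) ^ k * (-1) ^ k :: complex) = 1" by (simp flip: power_mult_distrib)
    then have "(- \<beta> gchoose k) * (- of_real (1 - t)) ^ k = pochhammer \<beta> k / fact k * of_real (1 - t) ^ k"
      unfolding gbinomial_pochhammer power_minus[of "of_real (1 - t)" k] by (simp add: mult_ac)
    moreover have "pochhammer \<beta> k = Gamma (\<beta> + of_nat k) / Gamma \<beta>" by (rule pochhammer_Gamma[OF \<beta>])
    ultimately show "Gamma \<beta> * ((- \<beta> gchoose k) * (- of_real (1 - t)) ^ k) = Gamma (\<beta> + of_nat k) / fact k * of_real (1 - t) ^ k"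
      using G by simp
  qed
  finally show ?thesis by simp
qed

text \<open>Both sides grow like n! n^(Re \<beta> - 1), so their quotient converges. The positive
  majorant lets errors for complex \<beta> be summed by a real binomial series.\<close>

lemma Gamma_norm_majorant:
  fixes \<beta> :: complex
  assumes \<beta>: "Re \<beta> > 0"
  obtains K where "K > 0" "\<And>k. norm (Gamma (\<beta> + of_nat k)) \<le> K * Gamma (Re \<beta> + real k)"
proof -
  have npos: "z \<notin> \<int>\<^sub>\<le>\<^sub>0" if "Re z > 0" for z :: complex
    using that by (auto elim!: nonpos_Ints_cases)
  have r: "complex_of_real (Re \<beta>) \<notin> \<int>\<^sub>\<le>\<^sub>0" using \<beta> by (intro npos) simp
  have pos: "Gamma (Re \<beta> + real k) > 0" for k using \<beta> by (intro Gamma_real_pos) simp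
  have "(\<lambda>n. norm ((Gamma (\<beta> + of_nat n) / (fact n * of_nat n powr (\<beta> - 1)))
     / (Gamma (of_real (Re \<beta>) + of_nat n) / (fact n * of_nat n powr (of_real (Re \<beta>) - 1))))) \<longlonglongrightarrow> norm (1 / 1 :: complex)"
    by (intro tendsto_intros Gamma_plus_nat_asymp npos[OF \<beta>] r) simp
  moreover have "eventually (\<lambda>n. norm ((Gamma (\<beta> + of_nat n) / (fact n * of_nat n powr (\<beta> - 1)))
     / (Gamma (of_real (Re \<beta>) + of_nat n) / (fact n * of_nat n powr (of_real (Re \<beta>) - 1))))
     = norm (Gamma (\<beta> + of_nat n)) / Gamma (Re \<beta> + real n)) sequentially"
    using eventually_gt_at_top[of 0]
  proof eventually_elim
    case (elim n)
    have "Gamma (of_real (Re \<beta>) + of_nat n :: complex) = of_real (Gamma (Re \<beta> + real n))"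
      using Gamma_complex_of_real[of "Re \<beta> + real n"] by simp
    moreover have "norm (of_nat n powr (\<beta> - 1)) = norm (of_nat n powr (of_real (Re \<beta>) - 1) :: complex)"
      "norm (of_nat n powr (of_real (Re \<beta>) - 1) :: complex) > 0"
      using elim norm_powr_real_powr[of "of_nat n" "\<beta> - 1"] norm_powr_real_powr[of "of_nat n" "of_real (Re \<beta>) - 1"] by auto
    ultimately show ?case using elim pos[of n] by (simp add: norm_divide norm_mult)
  qed
  ultimately have "(\<lambda>n. norm (Gamma (\<beta> + of_nat n)) / Gamma (Re \<beta> + real n)) \<longlonglongrightarrow> norm (1 / 1 :: complex)"
    by (rule Lim_transform_eventually)
  from convergent_imp_Bseq[OF convergentI[OF this]]
  obtain K where "K > 0" "\<forall>n. norm (norm (Gamma (\<beta> + of_nat n)) / Gamma (Re \<beta> + real n)) \<le> K"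
    unfolding Bseq_def by blast
  then have "norm (Gamma (\<beta> + of_nat k)) \<le> K * Gamma (Re \<beta> + real k)" for k
    using pos[of k] by (auto simp: divide_le_eq dest!: spec[of _ k])
  with \<open>K > 0\<close> show ?thesis using that by blast
qed

text \<open>The coefficients are C + o(1) times those of the series for t^(-\<beta>). The part with
  C is summed exactly. In the error part the power t^(Re \<beta>) kills finitely many terms, and it
  cancels the real series for t^(-Re \<beta>) that dominates the tail.\<close>

lemma abelian_Gamma:
  fixes d :: "nat \<Rightarrow> complex"
  assumes \<beta>: "Re \<beta> > 0" and lim: "(\<lambda>k. d k * fact k / Gamma (\<beta> + of_nat k)) \<longlonglongrightarrow> C"
  shows "((\<lambda>t. of_real t powr \<beta> * (\<Sum>k. d k * of_real (1 - t) ^ k)) \<longlongrightarrow> C * Gamma \<beta>) (at_right (0::real))"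
proof -
  have npos: "\<beta> \<notin> \<int>\<^sub>\<le>\<^sub>0" using \<beta> by (auto elim!: nonpos_Ints_cases)
  have npos': "\<beta> + of_nat k \<notin> \<int>\<^sub>\<le>\<^sub>0" for k using \<beta> by (auto elim!: nonpos_Ints_cases dest: arg_cong[of _ _ Re])
  define r where "r = Re \<beta>"
  define g where "g = (\<lambda>k. Gamma (\<beta> + of_nat k) / fact k)"
  define g' where "g' = (\<lambda>k. Gamma (r + real k) / fact k)"
  define \<eta> where "\<eta> = (\<lambda>k. d k * fact k / Gamma (\<beta> + of_nat k) - C)"
  have d: "d k = (C + \<eta> k) * g k" for k
    using npos'[of k] by (simp add: \<eta>_def g_def Gamma_eq_zero_iff)
  have \<eta>: "\<eta> \<longlonglongrightarrow> 0" unfolding \<eta>_def using lim by (simp add: LIM_zero)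
  obtain K where K: "K > 0" "\<And>k. norm (Gamma (\<beta> + of_nat k)) \<le> K * Gamma (Re \<beta> + real k)"
    using Gamma_norm_majorant[OF \<beta>] by blast
  have gg: "norm (g k) \<le> K * g' k" for k
    using K(2)[of k] by (simp add: g_def g'_def norm_divide r_def divide_right_mono)
  have g'0: "g' k \<ge> 0" for k using \<beta> unfolding g'_def r_def by (simp add: Gamma_real_pos less_imp_le)
  have S: "(\<lambda>k. g k * of_real (1 - t) ^ k) sums (Gamma \<beta> * of_real t powr (- \<beta>))" if "0 < t" "t < 1" for t
    unfolding g_def by (rule Gamma_series_sums[OF npos that])
  have S': "(\<lambda>k. g' k * (1 - t) ^ k) sums (Gamma r * t powr (- r))" if "0 < t" "t < 1" for t
  proof -
    have rn: "complex_of_real r \<notin> \<int>\<^sub>\<le>\<^sub>0" using \<beta> by (auto simp: r_def elim!: nonpos_Ints_cases dest: arg_cong[of _ _ Re])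
    have "Gamma (of_real r + of_nat k :: complex) = of_real (Gamma (r + real k))" for k
      using Gamma_complex_of_real[of "r + real k"] by simp
    moreover have "complex_of_real t powr (- of_real r) = of_real (t powr (- r))"
      using that powr_of_real[of t "- r"] by simp
    ultimately have "(\<lambda>k. complex_of_real (g' k * (1 - t) ^ k)) sums of_real (Gamma r * t powr (- r))"
      using Gamma_series_sums[OF rn that] by (simp add: g'_def Gamma_complex_of_real)
    then show ?thesis by (simp only: sums_of_real_iff)
  qed
  define R where "R = (\<lambda>t. of_real t powr \<beta> * (\<Sum>k. \<eta> k * g k * of_real (1 - t) ^ k))"
  obtain H where H: "\<And>k. norm (\<eta> k) \<le> H"
    using convergent_imp_Bseq[OF convergentI[OF \<eta>]] unfolding Bseq_def by blast
  have H0: "H \<ge> 0" using H[of 0] norm_ge_zero order_trans by blast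
  have sum\<eta>: "summable (\<lambda>k. \<eta> k * g k * of_real (1 - t) ^ k)" if "0 < t" "t < 1" for t :: real
  proof (rule summable_comparison_test')
    show "summable (\<lambda>k. H * (K * (g' k * (1 - t) ^ k)))"
      using S'[OF that] by (intro summable_mult) (simp add: sums_iff)
    show "norm (\<eta> k * g k * of_real (1 - t) ^ k) \<le> H * (K * (g' k * (1 - t) ^ k))" if "k \<ge> 0" for k
    proof -
      have "norm (\<eta> k * g k * of_real (1 - t) ^ k) = norm (\<eta> k) * (norm (g k) * (1 - t) ^ k)"
        using \<open>t < 1\<close> by (simp add: norm_mult norm_power del: of_real_diff)
      also have "\<dots> \<le> H * (K * g' k * (1 - t) ^ k)"
        using \<open>t < 1\<close> H0 K(1) g'0[of k] by (intro mult_mono H gg) auto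
      finally show ?thesis by (simp add: mult_ac)
    qed
  qed
  have R: "(R \<longlongrightarrow> 0) (at_right 0)"
  proof (rule tendstoI)
    fix e :: real assume e: "e > 0"
    \<comment> \<open>Chosen so that the tail, after multiplication by t^r, is at most e /
      2.\<close>
    define e' where "e' = e / (2 * (K * Gamma r))"
    have KG: "K * Gamma r > 0" using K \<beta> by (simp add: r_def Gamma_real_pos)
    then have e': "e' > 0" using e by (simp add: e'_def)
    obtain k0 where k0: "\<And>k. k \<ge> k0 \<Longrightarrow> norm (\<eta> k) < e'"
      using \<eta> e' unfolding LIMSEQ_def by (auto simp: dist_norm)
    define M where "M = (\<Sum>k<k0. H * (K * g' k))"
    have M: "M \<ge> 0" unfolding M_def using H0 K g'0 by (intro sum_nonneg) auto
    have bound: "norm (R t) \<le> t powr r * M + e / 2" if t: "0 < t" "t < 1" for t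
    proof -
      have nt: "norm (complex_of_real t powr \<beta>) = t powr r"
        using t by (subst norm_powr_real_powr) (auto simp: r_def)
      have le: "norm (\<eta> k * g k * of_real (1 - t) ^ k) \<le> (if k < k0 then H * (K * g' k) else 0) + e' * (K * (g' k * (1 - t) ^ k))" for k
      proof -
        have eq: "norm (\<eta> k * g k * of_real (1 - t) ^ k) = norm (\<eta> k) * (norm (g k) * (1 - t) ^ k)"
          using t by (simp add: norm_mult norm_power del: of_real_diff)
        have gk: "norm (g k) * (1 - t) ^ k \<le> K * g' k * (1 - t) ^ k"
          using t by (intro mult_right_mono gg) auto
        show ?thesis
        proof (cases "k < k0")
          case True
          have "norm (\<eta> k) * (norm (g k) * (1 - t) ^ k) \<le> H * (K * g' k * 1)"
            using t H0 g'0[of k] K(1) by (intro mult_mono H gg power_le_one) auto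
          moreover have "e' * (K * (g' k * (1 - t) ^ k)) \<ge> 0" using e' K g'0 t by simp
          ultimately show ?thesis using True eq by simp
        next
          case False
          then have "norm (\<eta> k) * (norm (g k) * (1 - t) ^ k) \<le> e' * (K * g' k * (1 - t) ^ k)"
            using k0[of k] t e' gk K(1) g'0[of k] by (intro mult_mono) auto
          then show ?thesis using False eq by (simp add: mult_ac)
        qed
      qed
      have s1: "(\<lambda>k. if k < k0 then H * (K * g' k) else 0) sums M"
        unfolding M_def using sums_If_finite_set[of "{..<k0}" "\<lambda>k. H * (K * g' k)"] by simp
      have s2: "(\<lambda>k. e' * (K * (g' k * (1 - t) ^ k))) sums (e' * (K * (Gamma r * t powr (- r))))"
        by (intro sums_mult S' t)
      have "norm (\<Sum>k. \<eta> k * g k * of_real (1 - t) ^ k) \<le> M + e' * (K * (Gamma r * t powr (- r)))"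
        using norm_suminf_le[OF le sums_summable[OF sums_add[OF s1 s2]]] sums_unique[OF sums_add[OF s1 s2]] by simp
      then have "norm (R t) \<le> t powr r * (M + e' * (K * (Gamma r * t powr (- r))))"
        unfolding R_def norm_mult nt by (intro mult_left_mono) auto
      also have "\<dots> = t powr r * M + e' * (K * Gamma r) * (t powr r * t powr (- r))" by (simp add: algebra_simps)
      also have "t powr r * t powr (- r) = 1" using t by (simp flip: powr_add)
      also have "e' * (K * Gamma r) = e / 2" using KG by (auto simp: e'_def)
      finally show ?thesis by simp
    qed
    have "((\<lambda>t. t powr r * M) \<longlongrightarrow> 0 powr r * M) (at_right 0)"
      using \<beta> by (intro tendsto_intros) (auto simp: r_def eventually_at_right_less intro: eventually_mono[OF eventually_at_right_less[of 0]])
    then have "((\<lambda>t. t powr r * M) \<longlongrightarrow> 0) (at_right 0)" by simp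
    then have "eventually (\<lambda>t. t powr r * M < e / 2) (at_right 0)"
      using e by (intro order_tendstoD) auto
    moreover have "eventually (\<lambda>t. t \<in> {0<..<1::real}) (at_right 0)" by (rule eventually_at_right_real) simp
    ultimately show "eventually (\<lambda>t. dist (R t) 0 < e) (at_right 0)"
    proof eventually_elim
      case (elim t)
      then show ?case using bound[of t] by simp
    qed
  qed
  have "((\<lambda>t. C * Gamma \<beta> + R t) \<longlongrightarrow> C * Gamma \<beta> + 0) (at_right 0)" by (intro tendsto_intros R)
  moreover have "eventually (\<lambda>t. C * Gamma \<beta> + R t = of_real t powr \<beta> * (\<Sum>k. d k * of_real (1 - t) ^ k)) (at_right 0)"
  proof -
    have "eventually (\<lambda>t. t \<in> {0<..<1::real}) (at_right 0)" by (rule eventually_at_right_real) simp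
    then show ?thesis
    proof eventually_elim
      case (elim t)
      then have t: "0 < t" "t < 1" by auto
      have "(\<lambda>k. C * (g k * of_real (1 - t) ^ k) + \<eta> k * g k * of_real (1 - t) ^ k) sums
          (C * (Gamma \<beta> * of_real t powr (- \<beta>)) + (\<Sum>k. \<eta> k * g k * of_real (1 - t) ^ k))"
        by (intro sums_add sums_mult S t summable_sums sum\<eta>)
      moreover have "(\<lambda>k. C * (g k * of_real (1 - t) ^ k) + \<eta> k * g k * of_real (1 - t) ^ k) = (\<lambda>k. d k * of_real (1 - t) ^ k)"
        by (auto simp: d algebra_simps fun_eq_iff)
      ultimately have "(\<Sum>k. d k * of_real (1 - t) ^ k) = C * (Gamma \<beta> * of_real t powr (- \<beta>)) + (\<Sum>k. \<eta> k * g k * of_real (1 - t) ^ k)"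
        by (simp add: sums_iff)
      moreover have "of_real t powr \<beta> * of_real t powr (- \<beta>) = (1::complex)" using t by (simp flip: powr_add)
      ultimately show ?case by (simp add: R_def algebra_simps)
    qed
  qed
  ultimately show ?thesis by (simp add: Lim_transform_eventually)
qed

section \<open>Darboux's method\<close>

text \<open>A power of z times a holomorphic function keeps this shape: differentiating
  z^(\<delta>-N) H gives z^(\<delta>-N-1) times (\<delta>-N) H + z H'. At 0 only the first summand
  counts, which builds up the falling factorial.\<close>

lemma higher_deriv_powr_mult:
  fixes h :: "complex \<Rightarrow> complex"
  assumes h: "h holomorphic_on ball 0 \<epsilon>" and \<epsilon>: "\<epsilon> > 0"
  obtains H where "H holomorphic_on ball 0 \<epsilon>" "H 0 = (\<Prod>i<N. \<delta> - of_nat i) * h 0"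
    "\<And>z. z \<in> ball 0 \<epsilon> \<Longrightarrow> Re z > 0 \<Longrightarrow>
       (deriv ^^ N) (\<lambda>z. z powr \<delta> * h z) z = z powr (\<delta> - of_nat N) * H z"
proof -
  define S where "S = ball (0::complex) \<epsilon> \<inter> {z. Re z > 0}"
  have S: "open S" unfolding S_def by (intro open_Int open_ball open_halfspace_Re_gt)
  have "\<exists>H. H holomorphic_on ball 0 \<epsilon> \<and> H 0 = (\<Prod>i<N. \<delta> - of_nat i) * h 0 \<and>
    (\<forall>z\<in>S. (deriv ^^ N) (\<lambda>z. z powr \<delta> * h z) z = z powr (\<delta> - of_nat N) * H z)"
  proof (induction N)
    case 0
    then show ?case using h by (intro exI[of _ h]) auto
  next
    case (Suc N)
    then obtain H where H: "H holomorphic_on ball 0 \<epsilon>" "H 0 = (\<Prod>i<N. \<delta> - of_nat i) * h 0"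
      "\<And>z. z \<in> S \<Longrightarrow> (deriv ^^ N) (\<lambda>z. z powr \<delta> * h z) z = z powr (\<delta> - of_nat N) * H z"
      by blast
    define H' where "H' = (\<lambda>z. (\<delta> - of_nat N) * H z + z * deriv H z)"
    have "H' holomorphic_on ball 0 \<epsilon>"
      unfolding H'_def by (intro holomorphic_intros H(1)) auto
    moreover have "H' 0 = (\<Prod>i<Suc N. \<delta> - of_nat i) * h 0"
      by (simp add: H'_def H(2))
    moreover have "(deriv ^^ Suc N) (\<lambda>z. z powr \<delta> * h z) z = z powr (\<delta> - of_nat (Suc N)) * H' z" if z: "z \<in> S" for z
    proof -
      have zn: "z \<notin> \<real>\<^sub>\<le>\<^sub>0" using z by (auto simp: S_def complex_nonpos_Reals_iff)
      have "(H has_field_derivative deriv H z) (at z)"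
        using z by (intro holomorphic_derivI[OF H(1)]) (auto simp: S_def)
      then have "((\<lambda>z. z powr (\<delta> - of_nat N) * H z) has_field_derivative
         ((\<delta> - of_nat N) * z powr (\<delta> - of_nat N - 1) * H z + deriv H z * z powr (\<delta> - of_nat N))) (at z)"
        by (intro DERIV_mult has_field_derivative_powr zn)
      then have "((deriv ^^ N) (\<lambda>z. z powr \<delta> * h z) has_field_derivative
         ((\<delta> - of_nat N) * z powr (\<delta> - of_nat N - 1) * H z + deriv H z * z powr (\<delta> - of_nat N))) (at z)"
        by (rule has_field_derivative_transform_within_open[OF _ S z]) (simp add: H(3))
      moreover have "z powr (\<delta> - of_nat N) = z * z powr (\<delta> - of_nat N - 1)"
        using zn by (auto simp: powr_diff)
      ultimately show ?thesis
        by (simp add: DERIV_imp_deriv H'_def algebra_simps)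
    qed
    ultimately show ?case by blast
  qed
  then obtain H where "H holomorphic_on ball 0 \<epsilon>" "H 0 = (\<Prod>i<N. \<delta> - of_nat i) * h 0"
    "\<And>z. z \<in> S \<Longrightarrow> (deriv ^^ N) (\<lambda>z. z powr \<delta> * h z) z = z powr (\<delta> - of_nat N) * H z" by blast
  then show ?thesis by (intro that[of H]) (auto simp: S_def)
qed

lemma powser_holomorphic:
  fixes a :: "nat \<Rightarrow> complex"
  assumes "\<And>z. norm z < R \<Longrightarrow> summable (\<lambda>k. a k * z ^ k)"
  shows "(\<lambda>z. \<Sum>k. a k * z ^ k) holomorphic_on ball 0 R"
proof (rule holomorphic_onI)
  fix z :: complex assume "z \<in> ball 0 R"
  then have "((\<lambda>z. \<Sum>k. a k * z ^ k) has_field_derivative (\<Sum>k. diffs a k * z ^ k)) (at z)"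
    by (intro termdiffs_strong'[of R] assms) auto
  then show "(\<lambda>z. \<Sum>k. a k * z ^ k) field_differentiable at z within ball 0 R"
    using field_differentiable_at_within field_differentiable_def by blast
qed

lemma powser_higher_deriv:
  fixes a :: "nat \<Rightarrow> complex"
  assumes s: "\<And>z. norm z < R \<Longrightarrow> summable (\<lambda>k. a k * z ^ k)" and z: "norm z < R"
  shows "(deriv ^^ N) (\<lambda>z. \<Sum>k. a k * z ^ k) z = (\<Sum>k. fact (k + N) / fact k * a (k + N) * z ^ k)"
proof -
  define d where "d = (\<lambda>N k. fact (k + N) / fact k * a (k + N))"
  have dd: "diffs (d N) = d (Suc N)" for N
    by (auto simp: fun_eq_iff d_def diffs_def simp del: of_nat_Suc)
  have "(\<forall>z. norm z < R \<longrightarrow> summable (\<lambda>k. d N k * z ^ k)) \<and>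
    (\<forall>z. norm z < R \<longrightarrow> (deriv ^^ N) (\<lambda>z. \<Sum>k. a k * z ^ k) z = (\<Sum>k. d N k * z ^ k))"
  proof (induction N)
    case 0
    then show ?case using s by (simp add: d_def)
  next
    case (Suc N)
    have s': "summable (\<lambda>k. d (Suc N) k * z ^ k)" if "norm z < R" for z
      unfolding dd[symmetric] using that Suc by (intro termdiff_converges[of z R]) auto
    have "(deriv ^^ Suc N) (\<lambda>z. \<Sum>k. a k * z ^ k) z = (\<Sum>k. d (Suc N) k * z ^ k)" if z: "norm z < R" for z
    proof -
      have "((\<lambda>z. \<Sum>k. d N k * z ^ k) has_field_derivative (\<Sum>k. diffs (d N) k * z ^ k)) (at z)"
        using Suc z by (intro termdiffs_strong'[of R]) auto
      then have "((deriv ^^ N) (\<lambda>z. \<Sum>k. a k * z ^ k) has_field_derivative (\<Sum>k. diffs (d N) k * z ^ k)) (at z)"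
        by (rule has_field_derivative_transform_within_open[of _ _ _ "ball 0 R"]) (use Suc z in auto)
      then show ?thesis by (simp add: DERIV_imp_deriv dd)
    qed
    with s' show ?case by blast
  qed
  then show ?thesis using z by (simp add: d_def)
qed

lemma tendsto_powr_pos_at_right:
  assumes "\<delta> > 0"
  shows "((\<lambda>t. t powr \<delta>) \<longlongrightarrow> 0) (at_right (0::real))"
proof -
  have "((\<lambda>t. t powr \<delta>) \<longlongrightarrow> 0 powr \<delta>) (at_right (0::real))"
    using assms by (intro tendsto_intros) (auto intro: eventually_mono[OF eventually_at_right_less[of 0]])
  then show ?thesis by simp
qed

lemma tendsto_at_right_of_holomorphic:
  assumes "h holomorphic_on ball 0 \<epsilon>" "\<epsilon> > 0"
  shows "((\<lambda>t. h (of_real t)) \<longlongrightarrow> h 0) (at_right (0::real))"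
proof -
  have "isCont h (of_real 0)"
    using assms by (metis centre_in_ball continuous_on_eq_continuous_at holomorphic_on_imp_continuous_on open_ball of_real_0)
  moreover have "(complex_of_real \<longlongrightarrow> of_real 0) (at_right 0)" by (intro tendsto_intros)
  ultimately have "((\<lambda>t. h (of_real t)) \<longlongrightarrow> h (of_real 0)) (at_right 0)"
    by (rule isCont_tendsto_compose)
  then show ?thesis by simp
qed

text \<open>Converse to Darboux's method: after sufficiently many differentiations the leading
  singularity blows up at \<open>z = 0\<close>, and an Abelian theorem compares it with the
  coefficients.\<close>

lemma darboux_coefficient:
  fixes a :: "nat \<Rightarrow> complex" and \<alpha> C :: complex and \<delta> :: "'i \<Rightarrow> real"
  assumes lim: "(\<lambda>m. a m * fact m / Gamma (of_nat m - \<alpha>)) \<longlonglongrightarrow> C"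
    and \<alpha>: "- \<alpha> \<notin> \<int>\<^sub>\<le>\<^sub>0"
    and \<epsilon>: "0 < \<epsilon>" "\<epsilon> \<le> 1"
    and summ: "\<And>w. norm w < 1 \<Longrightarrow> summable (\<lambda>k. a k * w ^ k)"
    and g0: "g0 holomorphic_on ball 0 \<epsilon>" and h: "h holomorphic_on ball 0 \<epsilon>"
    and fin: "finite I" and g: "\<And>i. i \<in> I \<Longrightarrow> g i holomorphic_on ball 0 \<epsilon>"
    and \<delta>: "\<And>i. i \<in> I \<Longrightarrow> \<delta> i > 0"
    and eq: "\<And>z. norm z < \<epsilon> \<Longrightarrow> norm (1 - z) < 1 \<Longrightarrow>
      (\<Sum>k. a k * (1 - z) ^ k) = z powr \<alpha> * g0 z + (\<Sum>i\<in>I. z powr (\<alpha> + of_real (\<delta> i)) * g i z) + h z"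
  shows "C * Gamma (- \<alpha>) = g0 0"
proof -
  \<comment> \<open>With N above Re \<alpha>, the N-th derivative contains z^(\<alpha> - N), which
    blows up at 0. Its negated exponent \<beta> has positive real part, as the Abelian theorem asks,
    and multiplication by z^\<beta> sends the N-th derivative of h to 0.\<close>
  obtain N :: nat where N: "Re \<alpha> < real N" using reals_Archimedean2 by blast
  define \<beta> where "\<beta> = of_nat N - \<alpha>"
  have \<beta>: "Re \<beta> > 0" using N by (simp add: \<beta>_def)
  \<comment> \<open>Here the series in 1 - z converges, and since Re z > 0 the principal powers of z
    are holomorphic.\<close>
  define S where "S = ball (0::complex) \<epsilon> \<inter> ball 1 1"
  have S: "open S" unfolding S_def by (intro open_Int open_ball)
  have S_Re: "Re z > 0" if "z \<in> S" for z
  proof -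
    have "\<bar>1 - Re z\<bar> < 1"
      using that abs_Re_le_cmod[of "1 - z"] by (simp add: S_def dist_norm)
    then show ?thesis by linarith
  qed
  have S_np: "z \<notin> \<real>\<^sub>\<le>\<^sub>0" if "z \<in> S" for z
    using S_Re[OF that] by (auto simp: complex_nonpos_Reals_iff)
  have S_norm: "norm z < \<epsilon>" "norm (1 - z) < 1" if "z \<in> S" for z
    using that by (auto simp: S_def dist_norm)
  define f where "f = (\<lambda>z. \<Sum>k. a k * z ^ k)"
  have f_hol: "f holomorphic_on ball 0 1" unfolding f_def by (intro powser_holomorphic summ)
  define d where "d = (\<lambda>k. fact (k + N) / fact k * a (k + N))"
  have "(\<lambda>k. a (k + N) * fact (k + N) / Gamma (of_nat (k + N) - \<alpha>)) \<longlonglongrightarrow> C"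
    by (rule LIMSEQ_ignore_initial_segment[OF lim])
  then have "(\<lambda>k. d k * fact k / Gamma (\<beta> + of_nat k)) \<longlonglongrightarrow> C"
    by (simp add: d_def \<beta>_def algebra_simps)
  from abelian_Gamma[OF \<beta> this]
  have lim1: "((\<lambda>t. of_real t powr \<beta> * (\<Sum>k. d k * of_real (1 - t) ^ k)) \<longlongrightarrow> C * Gamma \<beta>) (at_right (0::real))" .
  obtain G0 where G0: "G0 holomorphic_on ball 0 \<epsilon>" "G0 0 = (\<Prod>i<N. \<alpha> - of_nat i) * g0 0"
    "\<And>z. z \<in> ball 0 \<epsilon> \<Longrightarrow> Re z > 0 \<Longrightarrow> (deriv ^^ N) (\<lambda>z. z powr \<alpha> * g0 z) z = z powr (\<alpha> - of_nat N) * G0 z"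
    by (rule higher_deriv_powr_mult[OF g0 \<epsilon>(1), where N = N and \<delta> = \<alpha>]) blast
  have "\<exists>H. H holomorphic_on ball 0 \<epsilon> \<and> (\<forall>z\<in>S. (deriv ^^ N) (\<lambda>z. z powr (\<alpha> + of_real (\<delta> i)) * g i z) z
     = z powr (\<alpha> + of_real (\<delta> i) - of_nat N) * H z)" if i: "i \<in> I" for i
  proof -
    obtain H where "H holomorphic_on ball 0 \<epsilon>"
      "\<And>z. z \<in> ball 0 \<epsilon> \<Longrightarrow> Re z > 0 \<Longrightarrow> (deriv ^^ N) (\<lambda>z. z powr (\<alpha> + of_real (\<delta> i)) * g i z) z
        = z powr (\<alpha> + of_real (\<delta> i) - of_nat N) * H z"
      by (rule higher_deriv_powr_mult[OF g[OF i] \<epsilon>(1), where N = N and \<delta> = "\<alpha> + of_real (\<delta> i)"]) blast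
    then show ?thesis using S_Re S_norm(1) by auto
  qed
  then obtain G where G: "\<And>i. i \<in> I \<Longrightarrow> G i holomorphic_on ball 0 \<epsilon>"
    "\<And>i z. i \<in> I \<Longrightarrow> z \<in> S \<Longrightarrow> (deriv ^^ N) (\<lambda>z. z powr (\<alpha> + of_real (\<delta> i)) * g i z) z
       = z powr (\<alpha> + of_real (\<delta> i) - of_nat N) * G i z" by metis
  define h' where "h' = (deriv ^^ N) h"
  have h': "h' holomorphic_on ball 0 \<epsilon>" unfolding h'_def by (intro holomorphic_higher_deriv h) auto
  have hol0: "(\<lambda>z. z powr \<alpha> * g0 z) holomorphic_on S"
    using g0 S_np by (intro holomorphic_intros) (auto simp: S_def intro: holomorphic_on_subset)
  have holi: "(\<lambda>z. z powr (\<alpha> + of_real (\<delta> i)) * g i z) holomorphic_on S" if "i \<in> I" for i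
    using g[OF that] S_np by (intro holomorphic_intros) (auto simp: S_def intro: holomorphic_on_subset)
  have holsum: "(\<lambda>z. \<Sum>i\<in>J. z powr (\<alpha> + of_real (\<delta> i)) * g i z) holomorphic_on S" if "J \<subseteq> I" for J
    using that by (intro holomorphic_on_sum holi) auto
  have holh: "h holomorphic_on S" using h by (rule holomorphic_on_subset) (auto simp: S_def)
  have dsum: "(deriv ^^ N) (\<lambda>z. \<Sum>i\<in>I. z powr (\<alpha> + of_real (\<delta> i)) * g i z) z
     = (\<Sum>i\<in>I. z powr (\<alpha> + of_real (\<delta> i) - of_nat N) * G i z)" if z: "z \<in> S" for z
  proof -
    have "(deriv ^^ N) (\<lambda>z. \<Sum>i\<in>J. z powr (\<alpha> + of_real (\<delta> i)) * g i z) z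
      = (\<Sum>i\<in>J. (deriv ^^ N) (\<lambda>z. z powr (\<alpha> + of_real (\<delta> i)) * g i z) z)" if "finite J" "J \<subseteq> I" for J
      using that
    proof (induction J rule: finite_induct)
      case empty
      then show ?case by (simp add: higher_deriv_const)
    next
      case (insert i J)
      then show ?case
        by (simp add: higher_deriv_add[OF holi holsum S z])
    qed
    from this[OF fin order.refl] show ?thesis using G(2) z by simp
  qed
  have main: "of_real t powr \<beta> * (\<Sum>k. d k * of_real (1 - t) ^ k) = (-1) ^ N *
     (G0 (of_real t) + (\<Sum>i\<in>I. of_real (t powr \<delta> i) * G i (of_real t)) + of_real t powr \<beta> * h' (of_real t))"
    if t: "0 < t" "t < \<epsilon>" for t :: real
  proof -
    let ?t = "complex_of_real t"
    have "norm (1 - ?t) = 1 - t" using t \<epsilon> by (metis abs_of_pos diff_gt_0_iff_gt less_le_trans norm_of_real of_real_1 of_real_diff)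
    then have tS: "?t \<in> S" using t by (simp add: S_def dist_norm)
    have "(\<Sum>k. d k * of_real (1 - t) ^ k) = (deriv ^^ N) f (1 - ?t)"
      unfolding f_def d_def using S_norm(2)[OF tS] by (subst powser_higher_deriv[OF summ]) auto
    \<comment> \<open>The inserted square of (-1)^N supplies the sign that the chain rule for 1 - z
      consumes in the next step.\<close>
    also have "\<dots> = (-1) ^ N * ((-1) ^ N * (deriv ^^ N) f (- 1 * ?t + 1))"
      by (simp flip: mult.assoc power_mult_distrib)
    also have "(-1) ^ N * (deriv ^^ N) f (- 1 * ?t + 1) = (deriv ^^ N) (\<lambda>z. f (- 1 * z + 1)) ?t"
      by (rule higher_deriv_compose_linear'[symmetric, OF f_hol S open_ball tS])
         (use S_norm in \<open>auto simp: dist_norm norm_minus_commute\<close>)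
    also have "\<dots> = (deriv ^^ N) (\<lambda>z. (z powr \<alpha> * g0 z + (\<Sum>i\<in>I. z powr (\<alpha> + of_real (\<delta> i)) * g i z)) + h z) ?t"
    proof (rule higher_deriv_transform_within_open[OF _ _ S tS])
      have "(f \<circ> (\<lambda>z. - 1 * z + 1)) holomorphic_on S"
        by (rule holomorphic_on_compose_gen[OF _ f_hol]) (use S_norm(2) in \<open>auto intro!: holomorphic_intros\<close>)
      then show "(\<lambda>z. f (- 1 * z + 1)) holomorphic_on S" by (simp add: o_def)
      show "(\<lambda>z. (z powr \<alpha> * g0 z + (\<Sum>i\<in>I. z powr (\<alpha> + of_real (\<delta> i)) * g i z)) + h z) holomorphic_on S"
        by (intro holomorphic_on_add hol0 holsum holh order.refl)
    qed (use eq S_norm in \<open>auto simp: f_def\<close>)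
    also have "\<dots> = ?t powr (\<alpha> - of_nat N) * G0 ?t + (\<Sum>i\<in>I. ?t powr (\<alpha> + of_real (\<delta> i) - of_nat N) * G i ?t) + h' ?t"
      using G0(3)[of ?t] S_norm(1)[OF tS] S_Re[OF tS]
      by (simp add: higher_deriv_add[OF holomorphic_on_add[OF hol0 holsum[OF order.refl]] holh S tS]
          higher_deriv_add[OF hol0 holsum[OF order.refl] S tS] dsum[OF tS] h'_def)
    finally have *: "(\<Sum>k. d k * of_real (1 - t) ^ k) = (-1) ^ N * (?t powr (\<alpha> - of_nat N) * G0 ?t
       + (\<Sum>i\<in>I. ?t powr (\<alpha> + of_real (\<delta> i) - of_nat N) * G i ?t) + h' ?t)" .
    have p: "?t powr \<beta> * ?t powr (\<alpha> - of_nat N) = 1" "?t powr \<beta> * ?t powr (\<alpha> + of_real (\<delta> i) - of_nat N) = of_real (t powr \<delta> i)" for i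
      using t by (simp_all add: \<beta>_def powr_of_real flip: powr_add)
    have "?t powr \<beta> * (?t powr (\<alpha> - of_nat N) * G0 ?t
       + (\<Sum>i\<in>I. ?t powr (\<alpha> + of_real (\<delta> i) - of_nat N) * G i ?t) + h' ?t)
      = (?t powr \<beta> * ?t powr (\<alpha> - of_nat N)) * G0 ?t
       + (\<Sum>i\<in>I. (?t powr \<beta> * ?t powr (\<alpha> + of_real (\<delta> i) - of_nat N)) * G i ?t) + ?t powr \<beta> * h' ?t"
      by (simp only: distrib_left sum_distrib_left mult.assoc)
    also have "\<dots> = G0 ?t + (\<Sum>i\<in>I. of_real (t powr \<delta> i) * G i ?t) + ?t powr \<beta> * h' ?t"
      unfolding p by simp
    finally show ?thesis unfolding * by (simp add: mult.left_commute)
  qed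
  have z\<beta>: "((\<lambda>t. of_real t powr \<beta>) \<longlongrightarrow> 0) (at_right (0::real))"
  proof (rule tendsto_norm_zero_cancel)
    have "eventually (\<lambda>t. norm (of_real t powr \<beta>) = t powr Re \<beta>) (at_right (0::real))"
      using eventually_at_right_less[of 0] by eventually_elim (simp add: norm_powr_real_powr)
    with tendsto_powr_pos_at_right[OF \<beta>] show "((\<lambda>t. norm (of_real t powr \<beta>)) \<longlongrightarrow> 0) (at_right (0::real))"
      by (simp add: tendsto_cong)
  qed
  have z\<delta>: "((\<lambda>t. complex_of_real (t powr \<delta> i)) \<longlongrightarrow> of_real 0) (at_right 0)" if "i \<in> I" for i
    by (intro tendsto_of_real tendsto_powr_pos_at_right \<delta> that)
  have "((\<lambda>t. (-1) ^ N *
     (G0 (of_real t) + (\<Sum>i\<in>I. of_real (t powr \<delta> i) * G i (of_real t)) + of_real t powr \<beta> * h' (of_real t)))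
     \<longlongrightarrow> (-1) ^ N * (G0 0 + (\<Sum>i\<in>I. of_real 0 * G i 0) + 0 * h' 0)) (at_right (0::real))"
    by (intro tendsto_intros z\<beta> z\<delta> tendsto_at_right_of_holomorphic[OF _ \<epsilon>(1)] G0 G h')
  moreover have "eventually (\<lambda>t. (-1) ^ N *
     (G0 (of_real t) + (\<Sum>i\<in>I. of_real (t powr \<delta> i) * G i (of_real t)) + of_real t powr \<beta> * h' (of_real t))
     = of_real t powr \<beta> * (\<Sum>k. d k * of_real (1 - t) ^ k)) (at_right (0::real))"
    using eventually_at_right_real[OF \<epsilon>(1)]
  proof eventually_elim
    case (elim t)
    then show ?case using main[of t] by simp
  qed
  ultimately have "((\<lambda>t. of_real t powr \<beta> * (\<Sum>k. d k * of_real (1 - t) ^ k)) \<longlongrightarrow> (-1) ^ N * G0 0) (at_right (0::real))"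
    by (simp add: tendsto_cong)
  from tendsto_unique[OF _ this lim1] have "C * Gamma \<beta> = (-1) ^ N * G0 0" by simp
  \<comment> \<open>The sign from 1 - z and the falling factorial from the powers of z combine to
    the Pochhammer symbol of -\<alpha>, a quotient of Gamma values in which the part depending on N
    cancels.\<close>
  also have "(-1) ^ N * (\<Prod>i<N. \<alpha> - of_nat i) = pochhammer (- \<alpha>) N"
  proof -
    have "pochhammer (- \<alpha>) N = (\<Prod>i<N. (-1) * (\<alpha> - of_nat i))"
      unfolding pochhammer_prod by (intro prod.cong) auto
    then show ?thesis by (simp only: prod.distrib prod_constant card_lessThan)
  qed
  then have "(-1) ^ N * G0 0 = pochhammer (- \<alpha>) N * g0 0" by (simp add: G0(2) flip: mult.assoc)
  also have "pochhammer (- \<alpha>) N = Gamma \<beta> / Gamma (- \<alpha>)"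
    using pochhammer_Gamma[OF \<alpha>, of N] by (simp add: \<beta>_def algebra_simps)
  finally have "Gamma \<beta> * (C * Gamma (- \<alpha>)) = Gamma \<beta> * g0 0"
    using \<alpha> by (simp add: Gamma_eq_zero_iff field_simps)
  moreover have "Gamma \<beta> \<noteq> 0" using \<beta> by (auto simp: Gamma_eq_zero_iff elim!: nonpos_Ints_cases)
  ultimately show ?thesis by simp
qed

section \<open>Integrals over circles and tori\<close>

text \<open>The majorants give uniform convergence along the finite subsets of I, and uniform limits
  may be integrated termwise.\<close>

lemma integral_infsum_M_test:
  fixes f :: "'i \<Rightarrow> 'b::euclidean_space \<Rightarrow> complex"
  assumes cont: "\<And>i. i \<in> I \<Longrightarrow> continuous_on (cbox a b) (f i)"
    and bound: "\<And>i x. i \<in> I \<Longrightarrow> x \<in> cbox a b \<Longrightarrow> norm (f i x) \<le> M i"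
    and M: "M summable_on I"
  shows "(\<lambda>x. \<Sum>\<^sub>\<infinity>i\<in>I. f i x) integrable_on cbox a b"
    and "((\<lambda>i. integral (cbox a b) (f i)) has_sum integral (cbox a b) (\<lambda>x. \<Sum>\<^sub>\<infinity>i\<in>I. f i x)) I"
proof -
  have "uniform_limit (cbox a b) (\<lambda>X x. \<Sum>i\<in>X. f i x) (\<lambda>x. \<Sum>\<^sub>\<infinity>i\<in>I. f i x) (finite_subsets_at_top I)"
    using bound M by (rule Weierstrass_m_test_general)
  \<comment> \<open>The limit theorem wants integrable sums for every finite set, including sets
    that stick out of I; intersecting with I ensures this without changing the limit.\<close>
  also have "?this \<longleftrightarrow> uniform_limit (cbox a b) (\<lambda>X x. \<Sum>i\<in>X \<inter> I. f i x) (\<lambda>x. \<Sum>\<^sub>\<infinity>i\<in>I. f i x) (finite_subsets_at_top I)"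
    by (intro uniform_limit_cong ballI eventually_mono[OF eventually_finite_subsets_at_top_weakI[of I "\<lambda>X. X \<subseteq> I"]])
       (auto simp: Int_absorb2)
  finally obtain J K where JK: "\<And>X. ((\<lambda>x. \<Sum>i\<in>X \<inter> I. f i x) has_integral J X) (cbox a b)"
    "((\<lambda>x. \<Sum>\<^sub>\<infinity>i\<in>I. f i x) has_integral K) (cbox a b)" "(J \<longlongrightarrow> K) (finite_subsets_at_top I)"
    by (rule uniform_limit_integral_cbox) (auto intro!: continuous_intros cont)
  show "(\<lambda>x. \<Sum>\<^sub>\<infinity>i\<in>I. f i x) integrable_on cbox a b" using JK(2) by blast
  have J: "J X = (\<Sum>i\<in>X. integral (cbox a b) (f i))" if "finite X" "X \<subseteq> I" for X
  proof -
    have "J X = integral (cbox a b) (\<lambda>x. \<Sum>i\<in>X. f i x)"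
      using JK(1)[of X] that by (simp add: Int_absorb2 integral_unique)
    also have "\<dots> = (\<Sum>i\<in>X. integral (cbox a b) (f i))"
      using that by (intro integral_sum integrable_continuous cont) auto
    finally show ?thesis .
  qed
  have "(sum (\<lambda>i. integral (cbox a b) (f i)) \<longlongrightarrow> K) (finite_subsets_at_top I)"
    by (rule Lim_transform_eventually[OF JK(3)]) (auto intro!: eventually_finite_subsets_at_top_weakI J)
  then show "((\<lambda>i. integral (cbox a b) (f i)) has_sum integral (cbox a b) (\<lambda>x. \<Sum>\<^sub>\<infinity>i\<in>I. f i x)) I"
    using JK(2) by (simp add: has_sum_def integral_unique)
qed

text \<open>The Leibniz rule asks for an s-derivative that is jointly continuous in s and t.
  Expressing the derivative by Cauchy's formula on the circle of radius r reduces this to the joint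
  continuity of f.\<close>

lemma holomorphic_on_integral_param:
  fixes f :: "complex \<Rightarrow> 'b::euclidean_space \<Rightarrow> complex"
  assumes cont: "continuous_on (V \<times> cbox a b) (\<lambda>(s, t). f s t)"
    and hol: "\<And>t. t \<in> cbox a b \<Longrightarrow> (\<lambda>s. f s t) holomorphic_on V"
    and r: "cball c r \<subseteq> V"
  shows "(\<lambda>s. integral (cbox a b) (f s)) holomorphic_on ball c r"
proof -
  let ?g = "circlepath c r"
  define G where "G = (\<lambda>p::complex \<times> 'b. \<lambda>u::real. f (?g u) (snd p) / (?g u - fst p)\<^sup>2 * (2 * pi * \<i> * r * exp (2 * of_real pi * \<i> * u)))"
  define fx where "fx = (\<lambda>s t. 1 / (2 * of_real pi * \<i>) * integral (cbox 0 1) (G (s, t)))"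
  have cg: "continuous_on UNIV ?g" unfolding circlepath by (intro continuous_intros)
  have circle: "?g u \<in> sphere c r" if "r > 0" for u
    unfolding circlepath using that by (simp add: dist_norm norm_mult)
  have r_pos: "r > 0" if "s \<in> ball c r" for s
    using that by (metis ball_eq_empty empty_iff not_le)
  show ?thesis
  proof (rule leibniz_rule_holomorphic[where fx = fx])
    fix s t assume st: "s \<in> ball c r" "t \<in> cbox a b"
    have "((\<lambda>s. f s t) has_field_derivative (1 / (2 * of_real pi * \<i>) * contour_integral ?g (\<lambda>u. f u t / (u - s)\<^sup>2))) (at s)"
    proof (rule Cauchy_derivative_integral_circlepath[OF _ _ st(1)])
      show "continuous_on (cball c r) (\<lambda>s. f s t)"
        using hol[OF st(2)] r by (meson holomorphic_on_imp_continuous_on holomorphic_on_subset)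
      show "(\<lambda>s. f s t) holomorphic_on ball c r"
        using hol[OF st(2)] r ball_subset_cball by (meson holomorphic_on_subset)
    qed
    also have "1 / (2 * of_real pi * \<i>) * contour_integral ?g (\<lambda>u. f u t / (u - s)\<^sup>2) = fx s t"
      unfolding fx_def contour_integral_integral vector_derivative_circlepath G_def by (simp add: mult_ac)
    finally show "((\<lambda>s. f s t) has_field_derivative fx s t) (at s within ball c r)"
      by (rule has_field_derivative_at_within)
  next
    fix s assume s: "s \<in> ball c r"
    then have "s \<in> V" using r by auto
    then have "continuous_on (cbox a b) (\<lambda>t. (\<lambda>(s, t). f s t) (s, t))"
      by (intro continuous_on_compose2[OF cont]) (auto intro!: continuous_intros)
    then show "f s integrable_on cbox a b" by (simp add: integrable_continuous)
  next
    have "continuous_on ((ball c r \<times> cbox a b) \<times> cbox 0 1) (\<lambda>(p, u). G p u)"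
    proof -
      have "continuous_on ((ball c r \<times> cbox a b) \<times> cbox (0::real) 1) (\<lambda>q. (\<lambda>(s, t). f s t) (?g (snd q), snd (fst q)))"
      proof (rule continuous_on_compose2[OF cont])
        show "continuous_on ((ball c r \<times> cbox a b) \<times> cbox (0::real) 1) (\<lambda>q. (?g (snd q), snd (fst q)))"
          by (intro continuous_intros continuous_on_compose2[OF cg]) auto
        show "(\<lambda>q. (?g (snd q), snd (fst q))) ` ((ball c r \<times> cbox a b) \<times> cbox (0::real) 1) \<subseteq> V \<times> cbox a b"
          using circle r_pos r by (force simp: sphere_def cball_def)
      qed
      moreover have "?g u - s \<noteq> 0" if "s \<in> ball c r" for s u
        using circle[OF r_pos[OF that], of u] that by auto
      ultimately have "continuous_on ((ball c r \<times> cbox a b) \<times> cbox (0::real) 1) (\<lambda>q. G (fst q) (snd q))"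
        unfolding G_def by (intro continuous_intros continuous_on_compose2[OF cg]) auto
      then show ?thesis by (simp add: case_prod_unfold)
    qed
    then have "continuous_on (ball c r \<times> cbox a b) (\<lambda>p. integral (cbox 0 1) (G p))"
      by (rule integral_continuous_on_param)
    then have "continuous_on (ball c r \<times> cbox a b) (\<lambda>p. 1 / (2 * of_real pi * \<i>) * integral (cbox 0 1) (G p))"
      by (intro continuous_intros) auto
    then show "continuous_on (ball c r \<times> cbox a b) (\<lambda>(s, t). fx s t)"
      by (simp add: fx_def case_prod_unfold)
  qed auto
qed

text \<open>On the circle du = 2 pi i u d\<theta>, so Cauchy's formula gives the Taylor coefficient
  of order N - 1 of u^(P - 1) at a; du uses up one power of u.\<close>

lemma circle_integral_power:
  fixes a :: complex and \<rho> :: real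
  assumes a: "norm a < \<rho>" and P: "P \<ge> 1" and N: "N \<ge> 1"
  shows "integral (cbox 0 1) (\<lambda>\<theta>. circlepath 0 \<rho> \<theta> ^ P / (circlepath 0 \<rho> \<theta> - a) ^ N)
    = (if N \<le> P then of_nat ((P - 1) choose (P - N)) * a ^ (P - N) else 0)"
proof -
  obtain p n where pn: "P = Suc p" "N = Suc n" using P N by (metis Suc_le_D One_nat_def)
  let ?f = "\<lambda>u::complex. u ^ p"
  have "F / x * (x * X) = F * X" if "x \<noteq> 0" for F x X :: complex using that by simp
  then have cancel: "F / (2 * pi * \<i>) * (2 * pi * \<i> * X) = F * X" for F X
    by (metis complex_i_not_zero mult_eq_0_iff of_real_eq_0_iff pi_neq_zero zero_neq_numeral)
  have "(deriv ^^ n) ?f a = fact n / (2 * pi * \<i>) * contour_integral (circlepath 0 \<rho>) (\<lambda>u. ?f u / (u - a) ^ Suc n)"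
    using a by (intro Cauchy_higher_derivative_integral_circlepath) (auto intro!: continuous_intros holomorphic_intros)
  also have "contour_integral (circlepath 0 \<rho>) (\<lambda>u. ?f u / (u - a) ^ Suc n)
      = integral (cbox 0 1) (\<lambda>\<theta>. 2 * pi * \<i> * (circlepath 0 \<rho> \<theta> ^ P / (circlepath 0 \<rho> \<theta> - a) ^ N))"
    unfolding contour_integral_integral vector_derivative_circlepath box_real(2)[symmetric] pn
    by (intro integral_cong) (simp add: circlepath mult_ac)
  also have "\<dots> = 2 * pi * \<i> * integral (cbox 0 1) (\<lambda>\<theta>. circlepath 0 \<rho> \<theta> ^ P / (circlepath 0 \<rho> \<theta> - a) ^ N)"
    by (rule integral_mult_right)
  finally have eq: "(deriv ^^ n) ?f a = fact n * integral (cbox 0 1) (\<lambda>\<theta>. circlepath 0 \<rho> \<theta> ^ P / (circlepath 0 \<rho> \<theta> - a) ^ N)"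
    by (simp only: cancel)
  have "(deriv ^^ n) ?f a = pochhammer (of_nat (Suc p - n)) n * a ^ (p - n)"
    using higher_deriv_power[where z = 0 and j = n and n = p and w = a] by simp
  also have "\<dots> = fact n * (if N \<le> P then of_nat ((P - 1) choose (P - N)) * a ^ (P - N) else 0)"
  proof (cases "n \<le> p")
    case True
    then have "pochhammer (of_nat (Suc p - n)) n = (fact n * of_nat (p choose n) :: complex)"
      by (simp add: binomial_gbinomial gbinomial_pochhammer' of_nat_diff Suc_diff_le algebra_simps)
    moreover have "p choose n = p choose (p - n)" using True by (rule binomial_symmetric)
    ultimately show ?thesis using True by (simp add: pn)
  next
    case False
    then show ?thesis by (simp add: pn pochhammer_0_left)
  qed
  finally have "fact n * integral (cbox 0 1) (\<lambda>\<theta>. circlepath 0 \<rho> \<theta> ^ P / (circlepath 0 \<rho> \<theta> - a) ^ N)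
    = fact n * (if N \<le> P then of_nat ((P - 1) choose (P - N)) * a ^ (P - N) else 0)" by (simp only: eq)
  then show ?thesis by (subst (asm) mult_left_cancel) auto
qed

lemma integral_product_functions:
  fixes f g :: "real \<Rightarrow> complex"
  assumes "continuous_on (cbox 0 1) f" "continuous_on (cbox 0 1) g"
  shows "integral (cbox (0, 0) (1, 1)) (\<lambda>\<theta>. f (fst \<theta>) * g (snd \<theta>)) = integral (cbox 0 1) f * integral (cbox 0 1) g"
proof -
  have "continuous_on (cbox (0, 0) (1, 1)) (\<lambda>\<theta>. f (fst \<theta>) * g (snd \<theta>))"
    using assms by (intro continuous_intros) (auto intro!: continuous_on_compose2[OF assms(1)] continuous_on_compose2[OF assms(2)] continuous_intros simp: cbox_Pair_eq)
  from integral_prod_continuous[OF this]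
  show ?thesis by simp
qed

section \<open>Domination of the series by its first term\<close>

text \<open>The quotient by 1 + k never vanishes and tends to 1/3 in norm, so its reciprocal is
  bounded. All numbers \<mu> + \<open>phi q1 q2\<close> + k have the form \<mu> + l/3 with natural
  l, so one \<delta> serves every q.\<close>

lemma affine_lower_bound:
  fixes \<mu> :: complex
  assumes nz: "\<And>k::nat. \<mu> + of_nat k / 3 \<noteq> 0"
  obtains \<delta> where "\<delta> > 0" "\<And>k::nat. norm (\<mu> + of_nat k / 3) \<ge> \<delta> * (1 + real k)"
proof -
  have "(\<lambda>k::nat. norm ((\<mu> + of_nat k / 3) / of_real (1 + real k))) \<longlonglongrightarrow> norm (1 / 3 :: complex)"
  proof (rule tendsto_norm)
    have "(\<lambda>k::nat. (\<mu> - 1/3) * of_real (1 / (1 + real k)) + 1/3) \<longlonglongrightarrow> (\<mu> - 1/3) * of_real 0 + 1/3"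
      by (intro tendsto_intros) real_asymp
    moreover have "(\<mu> - 1/3) * of_real (1 / (1 + real k)) + 1/3 = (\<mu> + of_nat k / 3) / of_real (1 + real k)" for k
    proof -
      define x where "x = complex_of_real (1 + real k)"
      have "of_nat k = x - 1" by (simp add: x_def)
      moreover have "x \<noteq> 0" unfolding x_def of_real_eq_0_iff by simp
      ultimately show ?thesis unfolding of_real_divide of_real_1 x_def[symmetric]
        by (simp add: field_simps)
    qed
    ultimately show "(\<lambda>k::nat. (\<mu> + of_nat k / 3) / of_real (1 + real k)) \<longlonglongrightarrow> 1/3" by simp
  qed
  then have "(\<lambda>k::nat. inverse (norm ((\<mu> + of_nat k / 3) / of_real (1 + real k)))) \<longlonglongrightarrow> inverse (norm (1 / 3 :: complex))"
    by (intro tendsto_inverse) auto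
  from convergent_imp_Bseq[OF convergentI[OF this]]
  obtain K where K: "K > 0" "\<And>k. norm (inverse (norm ((\<mu> + of_nat k / 3) / of_real (1 + real k)))) \<le> K"
    unfolding Bseq_def by blast
  show ?thesis
  proof (rule that[of "1 / K"])
    show "1 / K > 0" using K by simp
    show "norm (\<mu> + of_nat k / 3) \<ge> 1 / K * (1 + real k)" for k :: nat
    proof -
      have "norm (complex_of_real (1 + real k)) = 1 + real k" by (simp only: norm_of_real)
      then have "(1 + real k) / norm (\<mu> + of_nat k / 3) \<le> K"
        using K(2)[of k] by (simp add: norm_divide norm_inverse)
      moreover have "norm (\<mu> + of_nat k / 3) > 0" using nz[of k] by simp
      ultimately show ?thesis using K(1) by (simp add: field_simps)
    qed
  qed
qed

lemma pochhammer_nonneg_real: "(x::real) \<ge> 0 \<Longrightarrow> pochhammer x n \<ge> 0"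
  unfolding pochhammer_prod by (intro prod_nonneg) auto

lemma pochhammer_mono_real:
  fixes x y :: real
  assumes "0 \<le> x" "x \<le> y"
  shows "pochhammer x n \<le> pochhammer y n"
  unfolding pochhammer_prod using assms by (intro prod_mono) auto

text \<open>The first two symbols fit into the first i + j factors on the right, and the factorial
  quotient, a Pochhammer symbol starting at 1 + i + j, into the remaining ones. Here the
  \<open>fact (i + j)\<close> of \<open>b_bound\<close> pays off.\<close>

lemma pochhammer_fact_ratio_le:
  fixes x y :: real
  assumes x: "x \<ge> 0" and y: "y \<ge> 0" and xy: "x + y \<ge> 1" and ij: "i + j \<le> m"
  shows "pochhammer x i * pochhammer y j * (fact m / fact (i + j)) \<le> pochhammer (x + y) m"
proof -
  have "pochhammer x i * pochhammer y j \<le> pochhammer (x + y) i * pochhammer (x + y + real i) j"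
    using x y by (intro mult_mono pochhammer_mono_real pochhammer_nonneg_real) auto
  also have "\<dots> = pochhammer (x + y) (i + j)" by (rule pochhammer_product'[symmetric])
  finally have 1: "pochhammer x i * pochhammer y j \<le> pochhammer (x + y) (i + j)" .
  have "fact m / fact (i + j) = pochhammer (1 + real (i + j)) (m - (i + j))"
    using pochhammer_product[OF ij, of "1::real"] by (simp add: pochhammer_fact[symmetric])
  also have "\<dots> \<le> pochhammer (x + y + real (i + j)) (m - (i + j))"
    using xy by (intro pochhammer_mono_real) auto
  finally have 2: "fact m / fact (i + j) \<le> pochhammer (x + y + real (i + j)) (m - (i + j))" .
  have "pochhammer x i * pochhammer y j * (fact m / fact (i + j))
    \<le> pochhammer (x + y) (i + j) * pochhammer (x + y + real (i + j)) (m - (i + j))"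
    using 1 2 xy x y by (intro mult_mono pochhammer_nonneg_real) auto
  also have "\<dots> = pochhammer (x + y) m" by (rule pochhammer_product[OF ij, symmetric])
  finally show ?thesis .
qed

lemma powr_add_of_nat:
  "z \<noteq> 0 \<Longrightarrow> z powr (a + of_nat m) = z powr a * (z::complex) ^ m"
  by (simp add: powr_add powr_nat')

section \<open>The series W and its domination by the first term, uniformly in q\<close>

locale series = parameters +
  fixes \<nu>1 \<nu>2 :: nat and lam :: complex
  assumes \<nu>: "\<nu>1 \<ge> 1" "\<nu>2 \<ge> 1"
    and nonint: "\<And>r1 r2. mu B \<nu>1 \<nu>2 lam \<kappa> + phi r1 r2 \<notin> \<int>"
begin

abbreviation \<mu> :: complex where "\<mu> \<equiv> mu B \<nu>1 \<nu>2 lam \<kappa>"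
abbreviation "Wt \<equiv> W_term D B L \<nu>1 \<nu>2 lam \<kappa>"
abbreviation "Ws \<equiv> W D B L \<nu>1 \<nu>2 lam \<kappa>"
text \<open>The local coordinate of the series: 0 at s = \<kappa> s0 and 1 at s = -\<kappa>
  s0.\<close>

abbreviation base :: "complex \<Rightarrow> complex" where "base s \<equiv> 1/2 - s / of_real (2 * \<kappa> * s0 B)"
abbreviation T1 :: complex where "T1 \<equiv> of_real (\<kappa> * t10 B)"
abbreviation T2 :: complex where "T2 \<equiv> of_real (\<kappa> * t20 B)"

text \<open>The point is that K does not depend on q. Relative to the first term, two Gamma factors
  contribute Pochhammer symbols of \<nu>1 + q1 and \<nu>2 + q2, which grow with q. The third
  contributes the reciprocal of a product of numbers \<mu> + \<open>phi q1 q2\<close> + k, which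
  grow with q at the same linear rate.\<close>

lemma W_term_bound:
  obtains K where "K > 0" "\<And>q1 q2 s t1 t2 m i j.
    base s \<noteq> 0 \<Longrightarrow>
    norm (t1 - T1) \<ge> 1 \<Longrightarrow> norm (t2 - T2) \<ge> 1 \<Longrightarrow>
    norm (Wt q1 q2 s t1 t2 (m, i, j))
      \<le> (K * norm (base s)) ^ m
         * norm (Wt q1 q2 s t1 t2 (0, 0, 0))"
proof -
  have nz: "\<mu> + of_nat k / 3 \<noteq> 0" for k :: nat
    using nonint[of 0 k] by (auto simp: phi_def)
  obtain \<delta> where \<delta>: "\<delta> > 0" "\<And>k::nat. norm (\<mu> + of_nat k / 3) \<ge> \<delta> * (1 + real k)"
    using affine_lower_bound[OF nz] by blast
  obtain K1 where K1: "K1 \<ge> 1" "\<And>m i j. \<bar>b (int m) (int i) (int j)\<bar> * fact (i + j) \<le> K1 ^ m * fact m"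
    using b_bound by blast
  define \<nu> where "\<nu> = real \<nu>1 + real \<nu>2"
  have \<nu>': "\<nu> \<ge> 1" using \<nu> by (simp add: \<nu>_def)
  \<comment> \<open>K1 comes from b, 2 s0 from the powers of -2 \<kappa> s0, and \<nu>/\<delta> from
    comparing the two products factor by factor.\<close>
  define K where "K = K1 * (2 * s0 B) * \<nu> / \<delta>"
  have K0: "K > 0" using K1(1) s0_pos \<nu>' \<delta>(1) by (simp add: K_def)
  have poch: "pochhammer (\<nu> + real (q1 + q2)) m \<le> (\<nu> / \<delta>) ^ m * norm (pochhammer (- \<mu> - phi q1 q2 - of_nat m) m)" for q1 q2 m
  proof -
    have "pochhammer (\<nu> + real (q1 + q2)) m = (\<Prod>k<m. \<nu> + real (q1 + q2) + real k)"
      by (simp add: pochhammer_prod atLeast0LessThan)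
    also have "\<dots> \<le> (\<Prod>k<m. \<nu> / \<delta> * norm (\<mu> + phi q1 q2 + of_nat (Suc k)))"
    proof (rule prod_mono)
      fix k
      have e: "\<mu> + phi q1 q2 + of_nat (Suc k) = \<mu> + of_nat (2 * q1 + q2 + 3 * Suc k) / 3"
        by (simp add: phi_def field_simps)
      have "\<nu> + real (q1 + q2) + real k \<le> \<nu> * (1 + real (2 * q1 + q2 + 3 * Suc k))"
      proof -
        have "real (q1 + q2) + real k \<le> 1 * real (2 * q1 + q2 + 3 * Suc k)" by simp
        also have "\<dots> \<le> \<nu> * real (2 * q1 + q2 + 3 * Suc k)" using \<nu>' by (intro mult_right_mono) auto
        finally show ?thesis by (simp add: algebra_simps)
      qed
      also have "\<dots> = \<nu> / \<delta> * (\<delta> * (1 + real (2 * q1 + q2 + 3 * Suc k)))" using \<delta>(1) by simp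
      also have "\<dots> \<le> \<nu> / \<delta> * norm (\<mu> + phi q1 q2 + of_nat (Suc k))"
        unfolding e using \<delta>(1) \<nu>' by (intro mult_left_mono \<delta>(2)) auto
      finally show "0 \<le> \<nu> + real (q1 + q2) + real k \<and> \<nu> + real (q1 + q2) + real k \<le> \<nu> / \<delta> * norm (\<mu> + phi q1 q2 + of_nat (Suc k))"
        using \<nu>' by simp
    qed
    also have "\<dots> = (\<nu> / \<delta>) ^ m * (\<Prod>k<m. norm (\<mu> + phi q1 q2 + of_nat (Suc k)))"
      by (simp only: prod.distrib prod_constant card_lessThan)
    also have "(\<Prod>k<m. norm (\<mu> + phi q1 q2 + of_nat (Suc k))) = (\<Prod>k<m. norm (- \<mu> - phi q1 q2 - of_nat m + of_nat (m - Suc k)))"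
    proof (rule prod.cong[OF refl])
      fix k assume "k \<in> {..<m}"
      then have "- \<mu> - phi q1 q2 - of_nat m + of_nat (m - Suc k) = - (\<mu> + phi q1 q2 + of_nat (Suc k))"
        by (simp add: of_nat_diff algebra_simps)
      then show "norm (\<mu> + phi q1 q2 + of_nat (Suc k)) = norm (- \<mu> - phi q1 q2 - of_nat m + of_nat (m - Suc k))"
        by (simp only: norm_minus_cancel)
    qed
    also have "\<dots> = (\<Prod>k<m. norm (- \<mu> - phi q1 q2 - of_nat m + of_nat k))"
      by (rule prod.nat_diff_reindex)
    also have "\<dots> = norm (pochhammer (- \<mu> - phi q1 q2 - of_nat m) m)"
      by (simp add: pochhammer_prod prod_norm atLeast0LessThan)
    finally show ?thesis .
  qed
  show ?thesis
  proof (rule that[OF K0])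
    fix q1 q2 m i j :: nat and s t1 t2 :: complex
    define z where "z = base s"
    define y1 where "y1 = t1 - T1"
    define y2 where "y2 = t2 - T2"
    assume "base s \<noteq> 0" "norm (t1 - T1) \<ge> 1" "norm (t2 - T2) \<ge> 1"
    then have z: "z \<noteq> 0" and y: "norm y1 \<ge> 1" "norm y2 \<ge> 1" by (auto simp: z_def y1_def y2_def)
    define w where "w = - \<mu> - phi q1 q2"
    define T where "T = (\<lambda>m i j. Wt q1 q2 s t1 t2 (m, i, j))"
    have T: "T m i j = Gamma (of_nat (\<nu>1 + q1 + i)) * Gamma (of_nat (\<nu>2 + q2 + j)) * Gamma (w - of_nat m)
       * of_real (b (int m) (int i) (int j)) * of_real (- 2 * \<kappa> * s0 B) ^ m * z powr (- w + of_nat m)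
       / y1 ^ (\<nu>1 + q1 + i) / y2 ^ (\<nu>2 + q2 + j)" for m i j
    proof -
      have e: "\<mu> + phi q1 q2 = - w" "- \<mu> - phi q1 q2 = w"
        by (simp_all add: w_def)
      show ?thesis
        unfolding T_def W_term_def prod.case z_def y1_def y2_def e by (rule refl)
    qed
    have "norm (T m i j) \<le> (K * norm z) ^ m * norm (T 0 0 0)"
    proof (cases "i + j \<le> m")
      case False
      then have "T m i j = 0" by (simp add: T b_eq_0_order)
      then show ?thesis using K0 by simp
    next
      case ij: True
      have wn: "w - of_nat m \<notin> \<int>"
        using nonint[of q1 q2] by (metis Ints_minus Ints_add Ints_of_nat w_def add_uminus_conv_diff
              diff_add_cancel minus_add_distrib minus_minus)
      have Gw: "Gamma w = pochhammer (w - of_nat m) m * Gamma (w - of_nat m)" "Gamma (w - of_nat m) \<noteq> 0"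
      proof -
        have np: "w - of_nat m \<notin> \<int>\<^sub>\<le>\<^sub>0" using wn nonpos_Ints_Int by blast
        then show "Gamma (w - of_nat m) \<noteq> 0" by (simp add: Gamma_eq_zero_iff)
        then show "Gamma w = pochhammer (w - of_nat m) m * Gamma (w - of_nat m)"
          using pochhammer_Gamma[OF np, of m] by simp
      qed
      have G: "norm (Gamma (of_nat (n + k)) :: complex) = pochhammer (real n) k * norm (Gamma (of_nat n) :: complex)"
        if "n \<ge> 1" for n k :: nat
      proof -
        have "(of_nat n :: complex) \<notin> \<int>\<^sub>\<le>\<^sub>0" using that by (auto elim!: nonpos_Ints_cases dest: arg_cong[of _ _ Re])
        then have "Gamma (of_nat (n + k) :: complex) = pochhammer (of_nat n) k * Gamma (of_nat n)"
          using pochhammer_Gamma[of "of_nat n :: complex" k] by (simp add: Gamma_eq_zero_iff)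
        moreover have "norm (pochhammer (of_nat n :: complex) k) = pochhammer (real n) k"
          by (simp only: pochhammer_of_nat norm_of_nat)
        ultimately show ?thesis by (simp add: norm_mult)
      qed
      define g1 g2 gw where "g1 = norm (Gamma (of_nat (\<nu>1 + q1)) :: complex)" and "g2 = norm (Gamma (of_nat (\<nu>2 + q2)) :: complex)"
        and "gw = norm (Gamma (w - of_nat m))"
      define \<beta>' where "\<beta>' = \<bar>b (int m) (int i) (int j)\<bar>"
      define Z where "Z = norm (z powr (- w))"
      define Y1 Y2 where "Y1 = norm y1 ^ (\<nu>1 + q1)" and "Y2 = norm y2 ^ (\<nu>2 + q2)"
      have Ypos: "Y1 > 0" "Y2 > 0"
      proof -
        have "norm y1 > 0" "norm y2 > 0" using y by linarith+
        then show "Y1 > 0" "Y2 > 0" by (auto simp: Y1_def Y2_def)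
      qed
      have T0: "norm (T 0 0 0) = g1 * g2 * (norm (pochhammer (w - of_nat m) m) * gw) * Z / Y1 / Y2"
      proof -
        have "norm (pochhammer (w - of_nat m) m) * gw = norm (Gamma w)"
          unfolding Gw(1) norm_mult gw_def by (rule refl)
        then show ?thesis
          by (simp add: T b_000 norm_mult norm_divide norm_power g1_def g2_def Z_def Y1_def Y2_def)
      qed
      have "norm (T m i j) = (pochhammer (real (\<nu>1 + q1)) i * g1) * (pochhammer (real (\<nu>2 + q2)) j * g2) * gw * \<beta>'
          * (2 * s0 B) ^ m * (Z * norm z ^ m) / (Y1 * norm y1 ^ i) / (Y2 * norm y2 ^ j)"
      proof -
        have "norm (complex_of_real (- 2 * \<kappa> * s0 B)) = 2 * s0 B"
          using s0_pos abs_kappa by (simp only: norm_of_real abs_mult abs_minus_cancel)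
        then show ?thesis
          using \<nu> G[of "\<nu>1 + q1" i] G[of "\<nu>2 + q2" j]
          unfolding T powr_add_of_nat[OF z] norm_mult norm_divide norm_power power_add
          by (simp only: g1_def g2_def gw_def \<beta>'_def Z_def Y1_def Y2_def norm_of_real power_add)
      qed
      also have "\<dots> \<le> (pochhammer (real (\<nu>1 + q1)) i * g1) * (pochhammer (real (\<nu>2 + q2)) j * g2) * gw * \<beta>'
          * (2 * s0 B) ^ m * (Z * norm z ^ m) / Y1 / Y2"
      proof -
        define X where "X = (pochhammer (real (\<nu>1 + q1)) i * g1) * (pochhammer (real (\<nu>2 + q2)) j * g2) * gw * \<beta>'
          * (2 * s0 B) ^ m * (Z * norm z ^ m)"
        have X: "X \<ge> 0" unfolding X_def g1_def g2_def gw_def \<beta>'_def Z_def using s0_pos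
          by (intro mult_nonneg_nonneg pochhammer_nonneg_real) auto
        have "X / (Y1 * norm y1 ^ i) / (Y2 * norm y2 ^ j) = (X / Y1 / Y2) / (norm y1 ^ i * norm y2 ^ j)" by simp
        also have "\<dots> \<le> (X / Y1 / Y2) / 1"
        proof (rule divide_left_mono)
          have "1 * 1 \<le> norm y1 ^ i * norm y2 ^ j"
            by (intro mult_mono one_le_power y) auto
          then show "1 \<le> norm y1 ^ i * norm y2 ^ j" "0 < norm y1 ^ i * norm y2 ^ j * 1" by linarith+
          show "0 \<le> X / Y1 / Y2" using X Ypos by simp
        qed
        finally show ?thesis by (simp add: X_def)
      qed
      also have "\<dots> = (pochhammer (real (\<nu>1 + q1)) i * pochhammer (real (\<nu>2 + q2)) j * \<beta>')
          * (g1 * g2 * gw * (2 * s0 B) ^ m * (Z * norm z ^ m) / Y1 / Y2)" by simp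
      also have "\<dots> \<le> (K1 ^ m * ((\<nu> / \<delta>) ^ m * norm (pochhammer (w - of_nat m) m)))
          * (g1 * g2 * gw * (2 * s0 B) ^ m * (Z * norm z ^ m) / Y1 / Y2)"
      proof (rule mult_right_mono)
        have "\<beta>' \<le> K1 ^ m * (fact m / fact (i + j))"
          using K1(2)[of m i j] by (simp add: \<beta>'_def field_simps)
        then have "pochhammer (real (\<nu>1 + q1)) i * pochhammer (real (\<nu>2 + q2)) j * \<beta>'
          \<le> pochhammer (real (\<nu>1 + q1)) i * pochhammer (real (\<nu>2 + q2)) j * (K1 ^ m * (fact m / fact (i + j)))"
          by (intro mult_left_mono mult_nonneg_nonneg pochhammer_nonneg_real) (use \<nu> in auto)
        also have "\<dots> = K1 ^ m * (pochhammer (real (\<nu>1 + q1)) i * pochhammer (real (\<nu>2 + q2)) j * (fact m / fact (i + j)))"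
          by simp
        also have "\<dots> \<le> K1 ^ m * pochhammer (real (\<nu>1 + q1) + real (\<nu>2 + q2)) m"
          using K1(1) \<nu> ij by (intro mult_left_mono pochhammer_fact_ratio_le) auto
        also have "real (\<nu>1 + q1) + real (\<nu>2 + q2) = \<nu> + real (q1 + q2)" by (simp add: \<nu>_def)
        also have "K1 ^ m * pochhammer (\<nu> + real (q1 + q2)) m \<le> K1 ^ m * ((\<nu> / \<delta>) ^ m * norm (pochhammer (w - of_nat m) m))"
          unfolding w_def using K1(1) by (intro mult_left_mono poch) auto
        finally show "pochhammer (real (\<nu>1 + q1)) i * pochhammer (real (\<nu>2 + q2)) j * \<beta>'
          \<le> K1 ^ m * ((\<nu> / \<delta>) ^ m * norm (pochhammer (w - of_nat m) m))" .
        show "0 \<le> g1 * g2 * gw * (2 * s0 B) ^ m * (Z * norm z ^ m) / Y1 / Y2"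
          using Ypos s0_pos by (simp add: g1_def g2_def gw_def Z_def)
      qed
      also have "\<dots> = (K * norm z) ^ m * norm (T 0 0 0)"
        unfolding T0 K_def by (simp add: power_mult_distrib power_divide)
      finally show ?thesis .
    qed
    then show "norm (Wt q1 q2 s t1 t2 (m, i, j))
      \<le> (K * norm (base s)) ^ m
         * norm (Wt q1 q2 s t1 t2 (0, 0, 0))" by (simp add: T_def z_def)
  qed
qed

end

text \<open>Level m has (m + 1)^2 \<le> 4^m index triples, so x \<le> 1/12 leaves the geometric
  series of 1/3 from m = 1 on, whose sum is 1/2.\<close>

lemma W_index_geometric_sum:
  fixes x :: real
  assumes x: "0 \<le> x" "x \<le> 1 / 12"
  shows "(\<lambda>(m, i, j). x ^ m) summable_on (W_index - {(0, 0, 0)})" (is ?fst)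
    and "(\<Sum>\<^sub>\<infinity>(m, i, j)\<in>W_index - {(0, 0, 0)}. x ^ m) \<le> 1 / 2" (is ?snd)
proof -
  have fin: "(\<Sum>(m, i, j)\<in>F. x ^ m) \<le> 1 / 2" if F: "finite F" "F \<subseteq> W_index - {(0, 0, 0)}" for F
  proof -
    define N where "N = Suc (Max (insert 0 (fst ` F)))"
    have F_sub: "F \<subseteq> (SIGMA m:{1..<N}. {..m} \<times> {..m})"
    proof
      fix p assume p: "p \<in> F"
      obtain m i j where mij: "p = (m, i, j)" by (cases p) auto
      have "m \<in> insert 0 (fst ` F)" using p mij by force
      then have "m \<le> Max (insert 0 (fst ` F))" using F(1) by (intro Max_ge) auto
      then show "p \<in> (SIGMA m:{1..<N}. {..m} \<times> {..m})"
        using p F(2) by (auto simp: mij N_def W_index_def Suc_le_eq)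
    qed
    have "(\<Sum>(m, i, j)\<in>F. x ^ m) \<le> (\<Sum>(m, i, j)\<in>(SIGMA m:{1..<N}. {..m} \<times> {..m}). x ^ m)"
      using x by (intro sum_mono2 F_sub) auto
    also have "\<dots> = (\<Sum>m\<in>{1..<N}. \<Sum>ij\<in>{..m} \<times> {..m}. x ^ m)"
      by (subst sum.Sigma) (auto simp: case_prod_unfold)
    also have "\<dots> = (\<Sum>m\<in>{1..<N}. real ((m + 1) * (m + 1)) * x ^ m)"
      by (simp add: card_cartesian_product)
    also have "\<dots> \<le> (\<Sum>m\<in>{1..<N}. (1/3) ^ m)"
    proof (rule sum_mono)
      fix m :: nat
      have "m + 1 \<le> 2 ^ m" by (induction m) auto
      then have "(m + 1) * (m + 1) \<le> 2 ^ m * 2 ^ m" by (intro mult_mono) auto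
      also have "\<dots> = 4 ^ m" by (simp flip: power_mult_distrib)
      finally have "real ((m + 1) * (m + 1)) \<le> 4 ^ m" by (metis of_nat_le_iff of_nat_numeral of_nat_power)
      then have "real ((m + 1) * (m + 1)) * x ^ m \<le> 4 ^ m * (1/12) ^ m"
        using x by (intro mult_mono power_mono) auto
      also have "\<dots> = (1/3) ^ m" by (simp flip: power_mult_distrib)
      finally show "real ((m + 1) * (m + 1)) * x ^ m \<le> (1/3) ^ m" .
    qed
    also have "\<dots> \<le> 1 / 2"
    proof -
      have "(\<Sum>m\<in>{1..<N}. (1/3::real) ^ m) = (\<Sum>m<N - 1. (1/3) ^ Suc m)"
        by (rule sum.reindex_bij_witness[of _ Suc "\<lambda>m. m - 1"]) auto
      also have "\<dots> = 1/3 * (\<Sum>m<N - 1. (1/3) ^ m)" by (simp add: sum_distrib_left)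
      also have "\<dots> \<le> 1 / 2" by (simp add: geometric_sum)
      finally show ?thesis .
    qed
    finally show ?thesis .
  qed
  show s: ?fst
  proof (rule nonneg_bdd_above_summable_on)
    show "bdd_above (sum (\<lambda>(m, i, j). x ^ m) ` {F. F \<subseteq> W_index - {(0, 0, 0)} \<and> finite F})"
      by (rule bdd_aboveI2[where M = "1/2"], rule fin) blast+
  qed (use x in \<open>simp add: case_prod_unfold\<close>)
  show ?snd
    by (rule infsum_le_finite_sums[OF s fin])
qed

context series
begin

text \<open>If the other terms add up to at most half of the first one, A, then |W| is at least A/2
  while the absolute series is at most 3 A/2. Thus W controls its own absolute series, which carries
  the summability of E W over to the family of all terms.\<close>

lemma W_abs_bound:
  obtains \<epsilon> where "\<epsilon> > 0" "\<And>q1 q2 s t1 t2.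
    base s \<noteq> 0 \<Longrightarrow> norm (base s) \<le> \<epsilon> \<Longrightarrow>
    norm (t1 - T1) \<ge> 1 \<Longrightarrow> norm (t2 - T2) \<ge> 1 \<Longrightarrow>
    (\<lambda>i. norm (Wt q1 q2 s t1 t2 i)) summable_on W_index \<and>
    (\<Sum>\<^sub>\<infinity>i\<in>W_index. norm (Wt q1 q2 s t1 t2 i))
      \<le> 3 * norm (Ws q1 q2 s t1 t2)"
proof -
  obtain K where K: "K > 0" "\<And>q1 q2 s t1 t2 m i j.
    base s \<noteq> 0 \<Longrightarrow>
    norm (t1 - T1) \<ge> 1 \<Longrightarrow> norm (t2 - T2) \<ge> 1 \<Longrightarrow>
    norm (Wt q1 q2 s t1 t2 (m, i, j))
      \<le> (K * norm (base s)) ^ m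
         * norm (Wt q1 q2 s t1 t2 (0, 0, 0))"
    by (rule W_term_bound) blast
  show ?thesis
  proof (rule that[of "1 / (12 * K)"])
    show "1 / (12 * K) > 0" using K(1) by simp
  next
    fix q1 q2 :: nat and s t1 t2 :: complex
    define z where "z = base s"
    define T where "T = Wt q1 q2 s t1 t2"
    define A where "A = norm (T (0, 0, 0))"
    define x where "x = K * norm z"
    assume a: "base s \<noteq> 0" "norm (base s) \<le> 1 / (12 * K)"
      "norm (t1 - T1) \<ge> 1" "norm (t2 - T2) \<ge> 1"
    have x: "0 \<le> x" "x \<le> 1 / 12" using a(2) K(1) by (auto simp: x_def z_def field_simps)
    define J where "J = W_index - {(0, 0, 0)}"
    have J: "(0, 0, 0) \<notin> J" "W_index = insert (0, 0, 0) J" by (auto simp: J_def W_index_def)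
    note geo = W_index_geometric_sum[OF x, folded J_def]
    have le: "norm (T p) \<le> (\<lambda>(m, i, j). x ^ m) p * A" for p
      using K(2)[OF a(1,3,4)] by (cases p) (auto simp: T_def x_def z_def A_def)
    have gs: "(\<lambda>p. (\<lambda>(m, i, j). x ^ m) p * A) summable_on J"
      by (intro summable_on_cmult_left geo(1))
    have s1: "(\<lambda>p. norm (T p)) summable_on J"
      by (rule summable_on_comparison_test[OF gs]) (use le in auto)
    have "(\<Sum>\<^sub>\<infinity>p\<in>J. norm (T p)) \<le> (\<Sum>\<^sub>\<infinity>p\<in>J. (\<lambda>(m, i, j). x ^ m) p * A)"
      by (intro infsum_mono s1 gs le)
    also have "\<dots> = (\<Sum>\<^sub>\<infinity>p\<in>J. (\<lambda>(m, i, j). x ^ m) p) * A"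
      by (intro infsum_cmult_left geo(1))
    also have "\<dots> \<le> 1 / 2 * A"
      by (intro mult_right_mono geo(2)) (simp add: A_def)
    finally have rest: "(\<Sum>\<^sub>\<infinity>p\<in>J. norm (T p)) \<le> A / 2" by simp
    have s2: "(\<lambda>p. norm (T p)) summable_on W_index"
      unfolding J(2) by (subst summable_on_insert_iff) (auto intro: s1)
    have sumn: "(\<Sum>\<^sub>\<infinity>p\<in>W_index. norm (T p)) = A + (\<Sum>\<^sub>\<infinity>p\<in>J. norm (T p))"
      unfolding J(2) by (subst infsum_insert) (use s1 J(1) in \<open>auto simp: A_def\<close>)
    have s1': "T summable_on J" using s1 by (rule abs_summable_summable)
    have sum: "Ws q1 q2 s t1 t2 = T (0, 0, 0) + (\<Sum>\<^sub>\<infinity>p\<in>J. T p)"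
      unfolding W_def T_def[symmetric] unfolding J(2) by (subst infsum_insert) (use s1' J(1) in auto)
    have "norm (\<Sum>\<^sub>\<infinity>p\<in>J. T p) \<le> A / 2"
      using norm_infsum_bound[OF s1] rest by linarith
    then have "A / 2 \<le> norm (Ws q1 q2 s t1 t2)"
      unfolding sum A_def using norm_diff_ineq[of "T (0, 0, 0)" "\<Sum>\<^sub>\<infinity>p\<in>J. T p"] by linarith
    then show "(\<lambda>i. norm (Wt q1 q2 s t1 t2 i)) summable_on W_index \<and>
      (\<Sum>\<^sub>\<infinity>i\<in>W_index. norm (Wt q1 q2 s t1 t2 i))
      \<le> 3 * norm (Ws q1 q2 s t1 t2)"
      using s2 sumn rest unfolding T_def[symmetric] by linarith
  qed
qed

end

section \<open>Torus coefficients of the series\<close>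

abbreviation torus_fn ::
  "real \<Rightarrow> complex \<Rightarrow> complex \<Rightarrow> nat \<Rightarrow> nat \<Rightarrow> (complex \<Rightarrow> complex \<Rightarrow> complex) \<Rightarrow> real \<times> real \<Rightarrow> complex" where
  "torus_fn \<rho> c1 c2 P1 P2 f \<equiv> \<lambda>\<theta>.
     f (circlepath 0 \<rho> (fst \<theta>) + c1) (circlepath 0 \<rho> (snd \<theta>) + c2)
       * circlepath 0 \<rho> (fst \<theta>) ^ P1 * circlepath 0 \<rho> (snd \<theta>) ^ P2"

text \<open>The Laurent coefficient with exponents -P1, -P2 in t1 - c1 and t2 - c2: the mean of u^k
  over a circle about 0 vanishes unless k = 0.\<close>

definition torus_coeff ::
  "real \<Rightarrow> complex \<Rightarrow> complex \<Rightarrow> nat \<Rightarrow> nat \<Rightarrow> (complex \<Rightarrow> complex \<Rightarrow> complex) \<Rightarrow> complex" where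
  "torus_coeff \<rho> c1 c2 P1 P2 f = integral (cbox (0, 0) (1, 1)) (torus_fn \<rho> c1 c2 P1 P2 f)"

lemma norm_circlepath_0: "\<rho> \<ge> 0 \<Longrightarrow> norm (circlepath 0 \<rho> \<theta>) = \<rho>"
  by (simp add: circlepath norm_mult)

lemma continuous_on_circlepath: "continuous_on A (circlepath z r)"
  unfolding circlepath by (intro continuous_intros)

text \<open>Trades the Gamma value of a single term for one that depends on the extracted exponent
  only, leaving the reciprocal factorial of an exponential series.\<close>

lemma Gamma_times_binomial:
  assumes "1 \<le> N" "N \<le> P"
  shows "Gamma (of_nat N) * of_nat ((P - 1) choose (P - N)) = (Gamma (of_nat P) / fact (P - N) :: complex)"
proof -
  obtain n p where np: "N = Suc n" "P = Suc p" using assms by (cases N; cases P) auto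
  have G: "Gamma (of_nat (Suc k) :: complex) = fact k" for k using Gamma_fact[of k] by (simp add: add.commute)
  have "of_nat (p choose (p - n)) = (fact p / (fact (p - n) * fact (p - (p - n))) :: complex)"
    by (rule binomial_fact) simp
  then show ?thesis using assms unfolding np G by simp
qed

context series
begin

abbreviation "tf \<rho> c1 c2 n1 n2 \<equiv> torus_fn \<rho> c1 c2 (\<nu>1 + n1) (\<nu>2 + n2)"
abbreviation "tc \<rho> c1 c2 n1 n2 \<equiv> torus_coeff \<rho> c1 c2 (\<nu>1 + n1) (\<nu>2 + n2)"

text \<open>The two variables separate. A term with centre T, seen from a circle about c,
  contributes a power of the offset T - c, and only if its pole order is at most the extracted
  one.\<close>

lemma torus_coeff_W_term:
  fixes n1 n2 q1 q2 m i j :: nat and s c1 c2 :: complex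
  defines "a1 \<equiv> T1 - c1" and "a2 \<equiv> T2 - c2"
  assumes \<rho>: "norm a1 < \<rho>" "norm a2 < \<rho>"
  shows "tc \<rho> c1 c2 n1 n2 (\<lambda>t1 t2. Wt q1 q2 s t1 t2 (m, i, j))
    = (if q1 + i \<le> n1 \<and> q2 + j \<le> n2 then
        Gamma (of_nat (\<nu>1 + n1)) * Gamma (of_nat (\<nu>2 + n2))
        * (a1 ^ (n1 - (q1 + i)) / fact (n1 - (q1 + i))) * (a2 ^ (n2 - (q2 + j)) / fact (n2 - (q2 + j)))
        * (Gamma (- \<mu> - phi q1 q2 - of_nat m) * of_real (b (int m) (int i) (int j)) * of_real (- 2 * \<kappa> * s0 B) ^ m
          * base s powr (\<mu> + phi q1 q2 + of_nat m))
      else 0)"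
proof -
  let ?g = "circlepath 0 \<rho>"
  define C where "C = Gamma (- \<mu> - phi q1 q2 - of_nat m) * of_real (b (int m) (int i) (int j)) * of_real (- 2 * \<kappa> * s0 B) ^ m
          * base s powr (\<mu> + phi q1 q2 + of_nat m)"
  define G1 G2 :: complex where "G1 = Gamma (of_nat (\<nu>1 + q1 + i))" and "G2 = Gamma (of_nat (\<nu>2 + q2 + j))"
  define P1 P2 N1 N2 where "P1 = \<nu>1 + n1" and "P2 = \<nu>2 + n2" and "N1 = \<nu>1 + q1 + i" and "N2 = \<nu>2 + q2 + j"
  define f1 f2 where "f1 = (\<lambda>\<theta>. ?g \<theta> ^ P1 / (?g \<theta> - a1) ^ N1)" and "f2 = (\<lambda>\<theta>. ?g \<theta> ^ P2 / (?g \<theta> - a2) ^ N2)"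
  have \<rho>0: "\<rho> \<ge> 0" using \<rho>(1) norm_ge_zero[of a1] by linarith
  have "?g \<theta> \<noteq> a1" "?g \<theta> \<noteq> a2" for \<theta> using norm_circlepath_0[OF \<rho>0, of \<theta>] \<rho> by auto
  then have cont: "continuous_on (cbox 0 1) f1" "continuous_on (cbox 0 1) f2"
    unfolding f1_def f2_def by (auto intro!: continuous_intros continuous_on_circlepath)
  have "tc \<rho> c1 c2 n1 n2 (\<lambda>t1 t2. Wt q1 q2 s t1 t2 (m, i, j))
     = integral (cbox (0, 0) (1, 1)) (\<lambda>\<theta>. (C * G1 * G2) * (f1 (fst \<theta>) * f2 (snd \<theta>)))"
  proof -
    have "X1 + c1 - T1 = X1 - a1" "X1 + c2 - T2 = X1 - a2" for X1
      by (simp_all add: a1_def a2_def)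
    then show ?thesis
      unfolding torus_coeff_def W_term_def prod.case f1_def f2_def C_def G1_def G2_def P1_def P2_def N1_def N2_def
      by (intro integral_cong) (simp only: times_divide_eq_right times_divide_eq_left divide_divide_eq_left mult_ac)
  qed
  also have "\<dots> = (C * G1 * G2) * (integral (cbox 0 1) f1 * integral (cbox 0 1) f2)"
    by (simp only: integral_mult_right integral_product_functions[OF cont])
  also have "\<dots> = (G1 * integral (cbox 0 1) f1) * (G2 * integral (cbox 0 1) f2) * C" by simp
  also have "G1 * integral (cbox 0 1) f1 = (if q1 + i \<le> n1 then Gamma (of_nat (\<nu>1 + n1)) * (a1 ^ (n1 - (q1 + i)) / fact (n1 - (q1 + i))) else 0)"
  proof -
    have "integral (cbox 0 1) f1 = (if N1 \<le> P1 then of_nat ((P1 - 1) choose (P1 - N1)) * a1 ^ (P1 - N1) else 0)"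
      unfolding f1_def by (rule circle_integral_power[OF \<rho>(1)]) (use \<nu> in \<open>auto simp: P1_def N1_def\<close>)
    moreover have "N1 \<le> P1 \<longleftrightarrow> q1 + i \<le> n1" "P1 - N1 = n1 - (q1 + i)" by (auto simp: P1_def N1_def)
    moreover have "G1 * of_nat ((P1 - 1) choose (P1 - N1)) = Gamma (of_nat P1) / fact (P1 - N1)" if "N1 \<le> P1"
      unfolding G1_def N1_def[symmetric] by (rule Gamma_times_binomial) (use \<nu> that in \<open>auto simp: N1_def\<close>)
    ultimately show ?thesis by (simp add: P1_def flip: mult.assoc)
  qed
  also have "G2 * integral (cbox 0 1) f2 = (if q2 + j \<le> n2 then Gamma (of_nat (\<nu>2 + n2)) * (a2 ^ (n2 - (q2 + j)) / fact (n2 - (q2 + j))) else 0)"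
  proof -
    have "integral (cbox 0 1) f2 = (if N2 \<le> P2 then of_nat ((P2 - 1) choose (P2 - N2)) * a2 ^ (P2 - N2) else 0)"
      unfolding f2_def by (rule circle_integral_power[OF \<rho>(2)]) (use \<nu> in \<open>auto simp: P2_def N2_def\<close>)
    moreover have "N2 \<le> P2 \<longleftrightarrow> q2 + j \<le> n2" "P2 - N2 = n2 - (q2 + j)" by (auto simp: P2_def N2_def)
    moreover have "G2 * of_nat ((P2 - 1) choose (P2 - N2)) = Gamma (of_nat P2) / fact (P2 - N2)" if "N2 \<le> P2"
      unfolding G2_def N2_def[symmetric] by (rule Gamma_times_binomial) (use \<nu> that in \<open>auto simp: N2_def\<close>)
    ultimately show ?thesis by (simp add: P2_def flip: mult.assoc)
  qed
  finally show ?thesis unfolding C_def[symmetric] by simp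
qed

text \<open>Summability at one point suffices: the norm of each term decreases in the distances of
  t1, t2 from T1, T2, and that point has the distances \<rho> - |a1| and \<rho> - |a2|, below which
  the torus never comes. Q is a single pair for W(\<kappa>) and all pairs for the other side.
  Integrability is recorded because integrals are added later.\<close>

lemma torus_coeff_W_series:
  fixes n1 n2 :: nat and s c1 c2 :: complex and e :: "nat \<times> nat \<Rightarrow> complex"
  defines "a1 \<equiv> T1 - c1" and "a2 \<equiv> T2 - c2"
  assumes \<rho>: "norm a1 < \<rho>" "norm a2 < \<rho>"
  defines "T \<equiv> \<lambda>q t1 t2 p. Wt (fst q) (snd q) s t1 t2 p"
  assumes summ: "(\<lambda>qp. norm ((\<lambda>(q, p). e q * T q (T1 + of_real (\<rho> - norm a1))
      (T2 + of_real (\<rho> - norm a2)) p) qp)) summable_on Q \<times> W_index"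
  defines "f \<equiv> \<lambda>t1 t2. \<Sum>\<^sub>\<infinity>(q, p)\<in>Q \<times> W_index. e q * T q t1 t2 p"
  shows "tf \<rho> c1 c2 n1 n2 f integrable_on cbox (0, 0) (1, 1)" (is ?fst)
    and "(\<lambda>m. \<Sum>(q, i, j)\<in>(Q \<inter> ({..n1} \<times> {..n2})) \<times> {..n1} \<times> {..n2}.
        e q * tc \<rho> c1 c2 n1 n2 (\<lambda>t1 t2. T q t1 t2 (m, i, j)))
      sums tc \<rho> c1 c2 n1 n2 f" (is ?snd)
proof -
  let ?g = "circlepath 0 \<rho>"
  let ?X = "\<lambda>\<theta>. ?g (fst \<theta>) + c1" and ?Y = "\<lambda>\<theta>. ?g (snd \<theta>) + c2"
  let ?t1 = "T1 + of_real (\<rho> - norm a1)"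
  let ?t2 = "T2 + of_real (\<rho> - norm a2)"
  have \<rho>0: "\<rho> \<ge> 0" using \<rho>(1) norm_ge_zero[of a1] by linarith
  define h where "h = (\<lambda>(q, p) \<theta>. e q * T q (?X \<theta>) (?Y \<theta>) p * ?g (fst \<theta>) ^ (\<nu>1 + n1) * ?g (snd \<theta>) ^ (\<nu>2 + n2))"
  define M where "M = (\<lambda>qp. norm ((\<lambda>(q, p). e q * T q ?t1 ?t2 p) qp) * \<rho> ^ (\<nu>1 + n1) * \<rho> ^ (\<nu>2 + n2))"
  have dist1: "norm (?X \<theta> - T1) \<ge> \<rho> - norm a1" for \<theta> :: "real \<times> real"
  proof -
    have eq: "?X \<theta> - T1 = ?g (fst \<theta>) - a1" by (simp add: a1_def)
    show ?thesis
      unfolding eq using norm_triangle_ineq2[of "?g (fst \<theta>)" a1] unfolding norm_circlepath_0[OF \<rho>0] .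
  qed
  have dist2: "norm (?Y \<theta> - T2) \<ge> \<rho> - norm a2" for \<theta> :: "real \<times> real"
  proof -
    have eq: "?Y \<theta> - T2 = ?g (snd \<theta>) - a2" by (simp add: a2_def)
    show ?thesis
      unfolding eq using norm_triangle_ineq2[of "?g (snd \<theta>)" a2] unfolding norm_circlepath_0[OF \<rho>0] .
  qed
  have T_le: "norm (T q (?X \<theta>) (?Y \<theta>) p) \<le> norm (T q ?t1 ?t2 p)" for q p and \<theta> :: "real \<times> real"
  proof -
    obtain m i j where p: "p = (m, i, j)" by (cases p) auto
    define C where "C = norm (Gamma (of_nat (\<nu>1 + fst q + i)) * Gamma (of_nat (\<nu>2 + snd q + j))
     * Gamma (- \<mu> - phi (fst q) (snd q) - of_nat m)
     * of_real (b_coeff D B L \<kappa> (int m) (int i) (int j)) * of_real (- 2 * \<kappa> * s0 B) ^ m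
     * base s powr (\<mu> + phi (fst q) (snd q) + of_nat m))"
    have nT: "norm (T q t1 t2 p) = C / norm (t1 - T1) ^ (\<nu>1 + fst q + i) / norm (t2 - T2) ^ (\<nu>2 + snd q + j)" for t1 t2
      unfolding T_def W_term_def p prod.case C_def by (simp only: norm_divide norm_power)
    have star: "norm (?t1 - T1) = \<rho> - norm a1" "norm (?t2 - T2) = \<rho> - norm a2"
      using \<rho> by (simp_all only: add_diff_cancel_left' norm_of_real)
    have mono: "C / d1 ^ k / d2 ^ l \<le> C / r1 ^ k / r2 ^ l"
      if "0 < r1" "r1 \<le> d1" "0 < r2" "r2 \<le> d2" "0 \<le> C" for C d1 d2 r1 r2 :: real and k l
    proof -
      have "r1 ^ k * r2 ^ l \<le> d1 ^ k * d2 ^ l" using that by (intro mult_mono power_mono) auto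
      then show ?thesis using that by (auto simp: intro!: divide_left_mono mult_pos_pos)
    qed
    show ?thesis
      unfolding nT star
      by (rule mono[OF _ dist1 _ dist2]) (use \<rho> in \<open>simp_all add: C_def del: norm_mult\<close>)
  qed
  have cont: "continuous_on (cbox (0, 0) (1, 1)) (h qp)" for qp
  proof -
    obtain q m i j where qp: "qp = (q, m, i, j)" by (cases qp) auto
    have "norm (?X \<theta> - T1) > 0" "norm (?Y \<theta> - T2) > 0" for \<theta> :: "real \<times> real"
      using \<rho> dist1[of \<theta>] dist2[of \<theta>] by linarith+
    then have nz: "?X \<theta> - T1 \<noteq> 0" "?Y \<theta> - T2 \<noteq> 0" for \<theta> :: "real \<times> real"
      by (metis norm_zero less_irrefl)+
    have cc: "continuous_on (cbox (0, 0) (1, 1)) (\<lambda>\<theta>::real \<times> real. ?g (fst \<theta>))"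
      "continuous_on (cbox (0, 0) (1, 1)) (\<lambda>\<theta>::real \<times> real. ?g (snd \<theta>))"
      by (auto intro!: continuous_on_compose2[OF continuous_on_circlepath[of UNIV]] continuous_intros)
    show ?thesis
      unfolding h_def qp prod.case T_def W_term_def
      by (intro continuous_intros cc) (use nz in \<open>auto simp del: of_real_mult\<close>)
  qed
  have bound: "norm (h qp \<theta>) \<le> M qp" for qp \<theta>
  proof -
    obtain q p where qp: "qp = (q, p)" by (cases qp) auto
    have "norm (h qp \<theta>) = norm (e q) * norm (T q (?X \<theta>) (?Y \<theta>) p) * \<rho> ^ (\<nu>1 + n1) * \<rho> ^ (\<nu>2 + n2)"
      unfolding h_def qp prod.case norm_mult norm_power norm_circlepath_0[OF \<rho>0] by (rule refl)
    also have "\<dots> \<le> norm (e q) * norm (T q ?t1 ?t2 p) * \<rho> ^ (\<nu>1 + n1) * \<rho> ^ (\<nu>2 + n2)"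
      using \<rho>0 by (intro mult_right_mono mult_left_mono T_le) auto
    finally show ?thesis by (simp add: M_def qp norm_mult)
  qed
  have M: "M summable_on Q \<times> W_index"
    unfolding M_def by (intro summable_on_cmult_left summ)
  have hf: "(\<Sum>\<^sub>\<infinity>qp\<in>Q \<times> W_index. h qp \<theta>) = f (?X \<theta>) (?Y \<theta>) * ?g (fst \<theta>) ^ (\<nu>1 + n1) * ?g (snd \<theta>) ^ (\<nu>2 + n2)" for \<theta>
  proof -
    have "(\<lambda>(q, p). e q * T q (?X \<theta>) (?Y \<theta>) p) summable_on Q \<times> W_index"
      by (rule abs_summable_summable, rule Infinite_Sum.abs_summable_on_comparison_test[OF summ])
         (auto simp: norm_mult simp del: of_real_diff of_real_mult intro!: mult_left_mono T_le)
    then have "f (?X \<theta>) (?Y \<theta>) * (?g (fst \<theta>) ^ (\<nu>1 + n1) * ?g (snd \<theta>) ^ (\<nu>2 + n2))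
       = (\<Sum>\<^sub>\<infinity>qp\<in>Q \<times> W_index. (\<lambda>(q, p). e q * T q (?X \<theta>) (?Y \<theta>) p) qp * (?g (fst \<theta>) ^ (\<nu>1 + n1) * ?g (snd \<theta>) ^ (\<nu>2 + n2)))"
      unfolding f_def by (intro infsum_cmult_left[symmetric]) simp
    also have "\<dots> = (\<Sum>\<^sub>\<infinity>qp\<in>Q \<times> W_index. h qp \<theta>)"
      by (intro infsum_cong) (auto simp: h_def mult.assoc)
    finally show ?thesis by (simp add: mult.assoc)
  qed
  note MT = integral_infsum_M_test[OF cont bound M]
  show "(\<lambda>\<theta>. f (?X \<theta>) (?Y \<theta>) * ?g (fst \<theta>) ^ (\<nu>1 + n1) * ?g (snd \<theta>) ^ (\<nu>2 + n2)) integrable_on cbox (0, 0) (1, 1)"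
    using MT(1) unfolding hf .
  define TC where "TC = (\<lambda>q p. e q * tc \<rho> c1 c2 n1 n2 (\<lambda>t1 t2. T q t1 t2 p))"
  have h_int: "integral (cbox (0, 0) (1, 1)) (h qp) = (\<lambda>(q, p). TC q p) qp" for qp
    by (cases qp) (simp add: TC_def h_def torus_coeff_def mult.assoc flip: integral_mult_right)
  have hs: "((\<lambda>(q, p). TC q p) has_sum tc \<rho> c1 c2 n1 n2 f) (Q \<times> W_index)"
    using MT(2) unfolding hf h_int torus_coeff_def[symmetric] .
  define F where "F = (Q \<inter> ({..n1} \<times> {..n2})) \<times> {..n1} \<times> {..n2}"
  \<comment> \<open>Brings m to the outside, so that the unordered sum becomes an ordinary series in
    m with finite inner sums.\<close>
  define \<Phi> where "\<Phi> = (\<lambda>(m::nat, (q::nat \<times> nat), (i::nat), (j::nat)). (q, (m, i, j)))"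
  have inj: "inj_on \<Phi> (UNIV \<times> F)" by (auto simp: inj_on_def \<Phi>_def)
  \<comment> \<open>Either the pole order exceeds the extracted one, or the triple lies outside
    \<open>W_index\<close> and b vanishes. The second case occurs inside the box of i, j when m is
    small.\<close>
  have TC_zero: "TC q (m, i, j) = 0" if "\<not> (fst q + i \<le> n1 \<and> snd q + j \<le> n2) \<or> (m, i, j) \<notin> W_index" for q m i j
  proof -
    note TCW = torus_coeff_W_term[OF \<rho>[unfolded a1_def a2_def]]
    show ?thesis
    proof (cases "(m, i, j) \<in> W_index")
      case True
      then have "\<not> (fst q + i \<le> n1 \<and> snd q + j \<le> n2)" using that by blast
      then show ?thesis unfolding TC_def T_def TCW by (simp only: if_False mult_zero_right)
    next
      case False
      then have "b (int m) (int i) (int j) = 0" by (intro b_eq_0_order) (auto simp: W_index_def)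
      then show ?thesis
        unfolding TC_def T_def TCW by (simp only: of_real_0 mult_zero_right mult_zero_left if_cancel)
    qed
  qed
  have "((\<lambda>(q, p). TC q p) has_sum tc \<rho> c1 c2 n1 n2 f) (\<Phi> ` (UNIV \<times> F))"
  proof (subst has_sum_cong_neutral[where T = "Q \<times> W_index" and g = "\<lambda>(q, p). TC q p"])
    fix x assume x: "x \<in> Q \<times> W_index - \<Phi> ` (UNIV \<times> F)"
    obtain q m i j where eq: "x = (q, m, i, j)" by (cases x) auto
    have "\<not> (fst q + i \<le> n1 \<and> snd q + j \<le> n2)"
    proof
      assume le: "fst q + i \<le> n1 \<and> snd q + j \<le> n2"
      then have "(m, q, i, j) \<in> UNIV \<times> F" using x eq by (cases q) (auto simp: F_def)
      then have "\<Phi> (m, q, i, j) \<in> \<Phi> ` (UNIV \<times> F)" by (rule imageI)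
      then show False using x eq by (simp add: \<Phi>_def)
    qed
    then show "(\<lambda>(q, p). TC q p) x = 0" using TC_zero eq by simp
  next
    fix x assume x: "x \<in> \<Phi> ` (UNIV \<times> F) - Q \<times> W_index"
    then obtain m q i j where eq: "x = (q, m, i, j)" "q \<in> Q" by (auto simp: \<Phi>_def F_def)
    then have "(m, i, j) \<notin> W_index" using x by auto
    then show "(\<lambda>(q, p). TC q p) x = 0" using TC_zero eq by simp
  qed (use hs in auto)
  then have "((\<lambda>(q, p). TC q p) \<circ> \<Phi> has_sum tc \<rho> c1 c2 n1 n2 f) (UNIV \<times> F)"
    by (subst (asm) has_sum_reindex[OF inj])
  then have "((\<lambda>m. \<Sum>qij\<in>F. ((\<lambda>(q, p). TC q p) \<circ> \<Phi>) (m, qij)) has_sum tc \<rho> c1 c2 n1 n2 f) UNIV"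
    by (rule has_sum_Sigma') (auto simp: F_def intro: has_sum_finite)
  then have "(\<lambda>m. \<Sum>qij\<in>F. ((\<lambda>(q, p). TC q p) \<circ> \<Phi>) (m, qij)) sums tc \<rho> c1 c2 n1 n2 f"
    by (rule has_sum_imp_sums)
  then show ?snd
    unfolding F_def[symmetric] \<Phi>_def TC_def by (simp add: case_prod_unfold)
qed

end

section \<open>The reflection formula at arguments shifted by integers\<close>

lemma sin_pi_add_nat: "sin (of_real pi * (z + of_nat n)) = (-1) ^ n * sin (of_real pi * z :: complex)"
proof (induction n)
  case (Suc n)
  have "of_real pi * (z + of_nat (Suc n)) = of_real pi * (z + of_nat n) + of_real pi"
    by (simp add: algebra_simps)
  then have "sin (of_real pi * (z + of_nat (Suc n))) = - sin (of_real pi * (z + of_nat n))"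
    by (simp only: sin_add sin_of_real_pi cos_of_real_pi) simp
  then show ?case using Suc by simp
qed simp

lemma Gamma_reflection_shift:
  fixes w :: complex
  assumes "w \<notin> \<int>"
  shows "Gamma (- w - of_nat m) = - of_real pi * (-1) ^ m / (sin (of_real pi * w) * Gamma (1 + w + of_nat m))"
proof -
  have "1 + w + of_nat m \<notin> \<int>"
    using assms Ints_diff[of "1 + w + of_nat m" "of_nat (Suc m)"] by auto
  then have G: "Gamma (1 + w + of_nat m) \<noteq> 0" using nonpos_Ints_Int by (auto simp: Gamma_eq_zero_iff)
  have "Gamma (1 + w + of_nat m) * Gamma (- w - of_nat m) = of_real pi / sin (of_real pi * (w + of_nat (Suc m)))"
    using Gamma_reflection_complex[of "1 + w + of_nat m"] by (simp add: algebra_simps)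
  also have "\<dots> = - of_real pi * (-1) ^ m / sin (of_real pi * w)"
    unfolding sin_pi_add_nat by (cases "even m") auto
  finally have eq: "Gamma (1 + w + of_nat m) * Gamma (- w - of_nat m) = - of_real pi * (-1) ^ m / sin (of_real pi * w)" .
  have "Gamma (- w - of_nat m) = Gamma (1 + w + of_nat m) * Gamma (- w - of_nat m) / Gamma (1 + w + of_nat m)"
    using G by simp
  then show ?thesis unfolding eq divide_divide_eq_left .
qed

lemma sum_single_pair:
  fixes f :: "nat \<Rightarrow> nat \<Rightarrow> complex"
  assumes "k \<le> n1" "l \<le> n2" "\<And>i j. i \<le> n1 \<Longrightarrow> j \<le> n2 \<Longrightarrow> (i, j) \<noteq> (k, l) \<Longrightarrow> f i j = 0"
  shows "(\<Sum>(i, j)\<in>{..n1} \<times> {..n2}. f i j) = f k l"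
proof -
  have "(\<Sum>(i, j)\<in>{..n1} \<times> {..n2}. f i j) = (\<Sum>(i, j)\<in>{(k, l)}. f i j)"
    using assms by (intro sum.mono_neutral_right) auto
  then show ?thesis by simp
qed

section \<open>Torus expansions of the two sides of the continuation formula\<close>

context series
begin

lemma parameters_neg: "parameters B (- \<kappa>)"
  using B6 kappa by (auto simp: parameters_def)

text \<open>The circles are centred at -T1 and -T2, the centres belonging to -\<kappa>. The offsets
  become 2 \<kappa> t10 and 2 \<kappa> t20, and the sum over i, j is the convolution that defines
  \<open>c\<close>.\<close>

lemma W_torus_sums:
  fixes n1 n2 :: nat and s :: complex
  assumes \<rho>: "\<bar>\<alpha>\<bar> < \<rho>" "\<bar>\<beta>\<bar> < \<rho>"
    and conv: "W_converges D B L \<nu>1 \<nu>2 lam \<kappa> 0 0 s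
      (T1 + of_real (\<rho> - \<bar>\<alpha>\<bar>)) (T2 + of_real (\<rho> - \<bar>\<beta>\<bar>))"
  defines "c1 \<equiv> - T1" and "c2 \<equiv> - T2"
  defines "f \<equiv> Ws 0 0 s"
  shows "tf \<rho> c1 c2 n1 n2 f integrable_on cbox (0, 0) (1, 1)" (is ?fst)
    and "(\<lambda>m. Gamma (of_nat (\<nu>1 + n1)) * Gamma (of_nat (\<nu>2 + n2))
        * (Gamma (- \<mu> - of_nat m) * of_real (- 2 * \<kappa> * s0 B) ^ m * of_real (c (int m) n1 n2)
           * base s powr (\<mu> + of_nat m)))
      sums tc \<rho> c1 c2 n1 n2 f" (is ?snd)
proof -
  have a: "T1 - c1 = of_real \<alpha>" "T2 - c2 = of_real \<beta>"
    by (simp_all add: c1_def c2_def)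
  have a': "norm (T1 - c1) = \<bar>\<alpha>\<bar>" "norm (T2 - c2) = \<bar>\<beta>\<bar>"
    unfolding a by (simp_all only: norm_of_real)
  define Q where "Q = {(0::nat, 0::nat)}"
  have Q: "Q \<times> W_index = Pair (0, 0) ` W_index" by (auto simp: Q_def)
  have inj: "inj_on (Pair (0, 0)) W_index" by (auto simp: inj_on_def)
  have n: "(\<lambda>p. norm (Wt 0 0 s
      (T1 + of_real (\<rho> - \<bar>\<alpha>\<bar>)) (T2 + of_real (\<rho> - \<bar>\<beta>\<bar>)) p)) summable_on W_index"
    using conv unfolding W_converges_def by (simp only: summable_on_iff_abs_summable_on_complex)
  then have summ: "(\<lambda>qp. norm ((\<lambda>(q, p). 1 * Wt (fst q) (snd q) s
      (T1 + of_real (\<rho> - norm (T1 - c1)))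
      (T2 + of_real (\<rho> - norm (T2 - c2))) p) qp)) summable_on Q \<times> W_index"
    unfolding Q a' by (subst summable_on_reindex[OF inj]) (simp add: o_def)
  have fQ: "(\<Sum>\<^sub>\<infinity>(q, p)\<in>Q \<times> W_index. 1 * Wt (fst q) (snd q) s t1 t2 p) = f t1 t2" for t1 t2
    unfolding Q f_def W_def by (subst infsum_reindex[OF inj]) (simp add: o_def)
  note TS = torus_coeff_W_series[OF \<rho>[folded a'] summ, of n1 n2, unfolded fQ]
  show ?fst
    by (rule TS(1))
  have coeff: "(\<Sum>(q, i, j)\<in>(Q \<inter> ({..n1} \<times> {..n2})) \<times> {..n1} \<times> {..n2}.
        1 * tc \<rho> c1 c2 n1 n2 (\<lambda>t1 t2. Wt (fst q) (snd q) s t1 t2 (m, i, j)))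
    = Gamma (of_nat (\<nu>1 + n1)) * Gamma (of_nat (\<nu>2 + n2))
        * (Gamma (- \<mu> - of_nat m) * of_real (- 2 * \<kappa> * s0 B) ^ m * of_real (c (int m) n1 n2)
           * base s powr (\<mu> + of_nat m))" for m
  proof -
    define G :: complex where "G = Gamma (of_nat (\<nu>1 + n1)) * Gamma (of_nat (\<nu>2 + n2))"
    define X where "X = Gamma (- \<mu> - of_nat m) * of_real (- 2 * \<kappa> * s0 B) ^ m
      * base s powr (\<mu> + of_nat m)"
    have phi0: "phi 0 0 = 0" by (simp add: phi_def)
    have tc_W: "tc \<rho> c1 c2 n1 n2 (\<lambda>t1 t2. Wt 0 0 s t1 t2 (m, i, j))
        = G * X * of_real (b (int m) (int i) (int j) * (\<alpha> ^ (n1 - i) / fact (n1 - i)) * (\<beta> ^ (n2 - j) / fact (n2 - j)))"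
      if ij: "i \<le> n1" "j \<le> n2" for i j
    proof -
      have re: "complex_of_real x ^ k / fact k = of_real (x ^ k / fact k)" for x k by simp
      have "tc \<rho> c1 c2 n1 n2 (\<lambda>t1 t2. Wt 0 0 s t1 t2 (m, i, j))
        = G * of_real (\<alpha> ^ (n1 - i) / fact (n1 - i)) * of_real (\<beta> ^ (n2 - j) / fact (n2 - j))
          * (Gamma (- \<mu> - of_nat m) * of_real (b (int m) (int i) (int j)) * of_real (- 2 * \<kappa> * s0 B) ^ m
             * base s powr (\<mu> + of_nat m))"
        using ij unfolding torus_coeff_W_term[OF \<rho>[folded a']] a re phi0 G_def by simp
      then show ?thesis
        by (simp only: X_def of_real_mult mult_ac)
    qed
    have "(\<Sum>(q, i, j)\<in>(Q \<inter> ({..n1} \<times> {..n2})) \<times> {..n1} \<times> {..n2}.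
        1 * tc \<rho> c1 c2 n1 n2 (\<lambda>t1 t2. Wt (fst q) (snd q) s t1 t2 (m, i, j)))
     = (\<Sum>(i, j)\<in>{..n1} \<times> {..n2}. tc \<rho> c1 c2 n1 n2 (\<lambda>t1 t2. Wt 0 0 s t1 t2 (m, i, j)))"
      by (rule sum.reindex_bij_witness[of _ "Pair (0, 0)" snd]) (auto simp: Q_def)
    also have "\<dots> = (\<Sum>(i, j)\<in>{..n1} \<times> {..n2}. G * X * of_real (b (int m) (int i) (int j)
        * (\<alpha> ^ (n1 - i) / fact (n1 - i)) * (\<beta> ^ (n2 - j) / fact (n2 - j))))"
      by (intro sum.cong refl) (simp only: split_paired_all mem_Sigma_iff prod.case atMost_iff tc_W)
    also have "\<dots> = G * X * of_real (\<Sum>(i, j)\<in>{..n1} \<times> {..n2}. b (int m) (int i) (int j)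
        * (\<alpha> ^ (n1 - i) / fact (n1 - i)) * (\<beta> ^ (n2 - j) / fact (n2 - j)))"
      unfolding of_real_sum sum_distrib_left case_prod_unfold by (rule refl)
    also have "(\<Sum>(i, j)\<in>{..n1} \<times> {..n2}. b (int m) (int i) (int j)
        * (\<alpha> ^ (n1 - i) / fact (n1 - i)) * (\<beta> ^ (n2 - j) / fact (n2 - j))) = c (int m) n1 n2"
      unfolding c_def emult_def atLeast0AtMost by (subst sum.cartesian_product) (rule refl)
    finally show ?thesis by (simp only: G_def X_def mult_ac)
  qed
  show ?snd
    using TS(2) unfolding coeff .
qed

text \<open>What W(q) contributes on circles about its own centre: the offsets are 0 there, so only
  i = n1 - q1 and j = n2 - q2 survive. The truncated subtractions have this meaning for q within the
  box up to (n1, n2).\<close>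

definition local_coeff :: "nat \<Rightarrow> nat \<Rightarrow> nat \<times> nat \<Rightarrow> nat \<Rightarrow> complex" where
  "local_coeff n1 n2 q m = Gamma (- \<mu> - phi (fst q) (snd q) - of_nat m)
     * of_real (b (int m) (int (n1 - fst q)) (int (n2 - snd q))) * of_real (- 2 * \<kappa> * s0 B) ^ m"

text \<open>To be applied at -\<kappa> with e given by E. Zero offsets leave one pair (i, j) for
  each q, and q + (i, j) = (n1, n2) leaves finitely many q.\<close>

lemma W_combination_torus_sums:
  fixes n1 n2 :: nat and s :: complex and e :: "nat \<times> nat \<Rightarrow> complex"
  assumes \<rho>: "0 < \<rho>"
  defines "c1 \<equiv> T1" and "c2 \<equiv> T2"
  defines "T \<equiv> \<lambda>q t1 t2 p. Wt (fst q) (snd q) s t1 t2 p"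
  assumes summ: "(\<lambda>qp. norm ((\<lambda>(q, p). e q * T q (c1 + of_real \<rho>) (c2 + of_real \<rho>) p) qp)) summable_on UNIV \<times> W_index"
  defines "f \<equiv> \<lambda>t1 t2. \<Sum>\<^sub>\<infinity>(q, p)\<in>UNIV \<times> W_index. e q * T q t1 t2 p"
  shows "tf \<rho> c1 c2 n1 n2 f integrable_on cbox (0, 0) (1, 1)" (is ?fst)
    and "(\<lambda>m. Gamma (of_nat (\<nu>1 + n1)) * Gamma (of_nat (\<nu>2 + n2)) * (\<Sum>q\<in>{..n1} \<times> {..n2}. e q *
          (local_coeff n1 n2 q m
            * base s powr (\<mu> + phi (fst q) (snd q) + of_nat m))))
      sums tc \<rho> c1 c2 n1 n2 f" (is ?snd)
proof -
  have a: "T1 - c1 = 0" "T2 - c2 = 0"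
    by (simp_all add: c1_def c2_def)
  have \<rho>': "norm (T1 - c1) < \<rho>" "norm (T2 - c2) < \<rho>"
    unfolding a using \<rho> by simp_all
  have summ': "(\<lambda>qp. norm ((\<lambda>(q, p). e q * Wt (fst q) (snd q) s
      (T1 + of_real (\<rho> - norm (T1 - c1)))
      (T2 + of_real (\<rho> - norm (T2 - c2))) p) qp)) summable_on UNIV \<times> W_index"
    using summ unfolding a T_def c1_def[symmetric] c2_def[symmetric] by simp
  note TS = torus_coeff_W_series[OF \<rho>' summ', of n1 n2]
  show ?fst
    using TS(1) unfolding f_def T_def .
  have coeff: "(\<Sum>(q, i, j)\<in>(UNIV \<inter> ({..n1} \<times> {..n2})) \<times> {..n1} \<times> {..n2}.
        e q * tc \<rho> c1 c2 n1 n2 (\<lambda>t1 t2. T q t1 t2 (m, i, j)))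
    = Gamma (of_nat (\<nu>1 + n1)) * Gamma (of_nat (\<nu>2 + n2)) * (\<Sum>q\<in>{..n1} \<times> {..n2}. e q *
          (local_coeff n1 n2 q m
            * base s powr (\<mu> + phi (fst q) (snd q) + of_nat m)))" for m
  proof -
    define G :: complex where "G = Gamma (of_nat (\<nu>1 + n1)) * Gamma (of_nat (\<nu>2 + n2))"
    define Y where "Y = (\<lambda>q. local_coeff n1 n2 q m
            * base s powr (\<mu> + phi (fst q) (snd q) + of_nat m))"
    define t where "t = (\<lambda>q i j. tc \<rho> c1 c2 n1 n2 (\<lambda>t1 t2. T q t1 t2 (m, i, j)))"
    note TCW = torus_coeff_W_term[OF \<rho>']
    have inner: "(\<Sum>(i, j)\<in>{..n1} \<times> {..n2}. t q i j) = G * Y q" if q: "q \<in> {..n1} \<times> {..n2}" for q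
    proof -
      have "(\<Sum>(i, j)\<in>{..n1} \<times> {..n2}. t q i j) = t q (n1 - fst q) (n2 - snd q)"
      proof (rule sum_single_pair)
        fix i j assume ij: "(i, j) \<noteq> (n1 - fst q, n2 - snd q)"
        have "0 ^ (n1 - (fst q + i)) * 0 ^ (n2 - (snd q + j)) = (0 :: complex)" if "fst q + i \<le> n1 \<and> snd q + j \<le> n2"
          using ij that by (auto simp: power_0_left)
        then show "t q i j = 0" unfolding t_def T_def TCW a by auto
      qed auto
      also have "\<dots> = G * Y q"
        using q unfolding t_def T_def TCW a Y_def G_def local_coeff_def by (auto simp: mult_ac)
      finally show ?thesis .
    qed
    have "(\<Sum>(q, i, j)\<in>(UNIV \<inter> ({..n1} \<times> {..n2})) \<times> {..n1} \<times> {..n2}. e q * t q i j)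
       = (\<Sum>q\<in>{..n1} \<times> {..n2}. \<Sum>(i, j)\<in>{..n1} \<times> {..n2}. e q * t q i j)"
      by (simp add: sum.cartesian_product case_prod_unfold)
    also have "\<dots> = (\<Sum>q\<in>{..n1} \<times> {..n2}. e q * (\<Sum>(i, j)\<in>{..n1} \<times> {..n2}. t q i j))"
      by (simp add: sum_distrib_left case_prod_unfold)
    also have "\<dots> = (\<Sum>q\<in>{..n1} \<times> {..n2}. G * (e q * Y q))"
      by (intro sum.cong refl) (simp add: inner)
    also have "\<dots> = G * (\<Sum>q\<in>{..n1} \<times> {..n2}. e q * Y q)" by (simp add: sum_distrib_left)
    finally show ?thesis by (simp only: G_def Y_def t_def)
  qed
  show ?snd
    using TS(2) unfolding coeff[unfolded T_def] f_def T_def .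
qed

text \<open>Up to a nonzero Gamma factor the coefficient is a term of the series at base 1 with t1 -
  T1 = t2 - T2 = 1, so \<open>W_term_bound\<close> makes it at most a constant times K^m. The shift
  k is for series whose vanishing initial terms are split off.\<close>

lemma local_coeff_bound:
  obtains R where "R > 0" "\<And>n1 n2 q k z. norm z < R \<Longrightarrow> summable (\<lambda>m. local_coeff n1 n2 q (m + k) * z ^ m)"
proof -
  obtain K where K: "K > 0" "\<And>q1 q2 s t1 t2 m i j.
    base s \<noteq> 0 \<Longrightarrow>
    norm (t1 - T1) \<ge> 1 \<Longrightarrow> norm (t2 - T2) \<ge> 1 \<Longrightarrow>
    norm (Wt q1 q2 s t1 t2 (m, i, j))
      \<le> (K * norm (base s)) ^ m
         * norm (Wt q1 q2 s t1 t2 (0, 0, 0))"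
    by (rule W_term_bound) blast
  define R where "R = 1 / K"
  show ?thesis
  proof (rule that[of R])
    show "R > 0" using K(1) by (simp add: R_def)
  next
    fix n1 n2 k :: nat and q :: "nat \<times> nat" and z :: complex assume z: "norm z < R"
    define s where "s = - complex_of_real (\<kappa> * s0 B)"
    define i j where "i = n1 - fst q" and "j = n2 - snd q"
    define t1 t2 where "t1 = T1 + 1" and "t2 = T2 + 1"
    have sv: "base s = 1"
      using s0_pos kappa_nz by (simp add: s_def)
    define G :: complex where "G = Gamma (of_nat (\<nu>1 + fst q + i)) * Gamma (of_nat (\<nu>2 + snd q + j))"
    have G: "G \<noteq> 0"
    proof -
      have "Gamma (of_nat n :: complex) \<noteq> 0" if "n \<ge> 1" for n
        using that by (auto simp: Gamma_eq_zero_iff elim!: nonpos_Ints_cases dest: arg_cong[of _ _ Re])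
      then show ?thesis using \<nu> unfolding G_def by (metis mult_eq_0_iff trans_le_add1)
    qed
    have WT: "Wt (fst q) (snd q) s t1 t2 (m, i, j) = G * local_coeff n1 n2 q m" for m
      unfolding W_term_def prod.case sv local_coeff_def G_def i_def[symmetric] j_def[symmetric] t1_def t2_def
      by (simp add: mult_ac)
    define A where "A = norm (Wt (fst q) (snd q) s t1 t2 (0, 0, 0)) / norm G"
    have bd: "norm (local_coeff n1 n2 q m) \<le> A * K ^ m" for m
    proof -
      have "norm (Wt (fst q) (snd q) s t1 t2 (m, i, j))
        \<le> (K * norm (base s)) ^ m
         * norm (Wt (fst q) (snd q) s t1 t2 (0, 0, 0))"
        by (rule K(2)) (unfold sv, simp_all add: t1_def t2_def)
      then have "norm G * norm (local_coeff n1 n2 q m) \<le> K ^ m * (A * norm G)"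
        unfolding WT sv norm_mult using G by (simp add: A_def)
      then show ?thesis using G by (simp add: mult_ac)
    qed
    have "summable (\<lambda>m. (A * K ^ k) * (K * norm z) ^ m)"
      using z K(1) by (intro summable_mult summable_geometric) (simp add: R_def field_simps)
    then show "summable (\<lambda>m. local_coeff n1 n2 q (m + k) * z ^ m)"
    proof (rule summable_comparison_test'[where N = 0])
      fix m :: nat
      have "norm (local_coeff n1 n2 q (m + k) * z ^ m) \<le> (A * K ^ (m + k)) * norm z ^ m"
        unfolding norm_mult norm_power by (intro mult_right_mono bd) auto
      then show "norm (local_coeff n1 n2 q (m + k) * z ^ m) \<le> (A * K ^ k) * (K * norm z) ^ m"
        by (simp add: power_add power_mult_distrib mult_ac)
    qed
  qed
qed

end

section \<open>Identification of the limit\<close>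

context series
begin

text \<open>The part of tau beyond 3/2 is odd in \<kappa>. This ties the exponent obtained from the
  recurrence at \<kappa> to the exponent of the singularity at the opposite point.\<close>

lemma tau_neg: "tau B (- \<kappa>) = 3 - tau B \<kappa>"
  by (simp add: tau_def)

lemma \<mu>_nonint: "\<mu> \<notin> \<int>"
  using nonint[of 0 0] by (simp add: phi_def)

text \<open>The two Gamma factors grow like (m!)^2 m^(\<mu> - \<alpha>' - 1), and this exponent
  equals \<open>\<theta> n1 n2\<close> by \<open>tau_neg\<close>; \<nu>1, \<nu>2 and lam cancel in
  the difference. The rest is \<open>scaled_asymp\<close>.\<close>

lemma normalized_coeff_convergent:
  fixes n1 n2 :: nat
  defines "\<alpha>' \<equiv> mu B \<nu>1 \<nu>2 lam (- \<kappa>) + phi n1 n2"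
  assumes nonint': "\<alpha>' \<notin> \<int>"
  shows "convergent (\<lambda>m. fact m / (Gamma (1 + \<mu> + of_nat m) * Gamma (of_nat m - \<alpha>'))
     * of_real (2 * \<kappa> * s0 B) ^ m * of_real (c (int m) n1 n2))"
proof -
  define t where "t = \<theta> n1 n2"
  obtain l where l: "(\<lambda>m. scaled n1 n2 m * real m powr (- t)) \<longlonglongrightarrow> l"
    using scaled_asymp[of n1 n2] unfolding t_def convergent_def by blast
  define A where "A = (\<lambda>m. Gamma ((1 + \<mu>) + of_nat m) / (fact m * of_nat m powr ((1 + \<mu>) - 1)))"
  define A' where "A' = (\<lambda>m. Gamma (- \<alpha>' + of_nat m) / (fact m * of_nat m powr (- \<alpha>' - 1)))"
  have "1 + \<mu> \<notin> \<int>"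
    using \<mu>_nonint Ints_diff[of "1 + \<mu>" 1] by auto
  moreover have "- \<alpha>' \<notin> \<int>" using nonint' Ints_minus[of "- \<alpha>'"] by auto
  ultimately have "A \<longlonglongrightarrow> 1" "A' \<longlonglongrightarrow> 1"
    unfolding A_def A'_def using nonpos_Ints_Int by (blast intro!: Gamma_plus_nat_asymp)+
  then have lim: "(\<lambda>m. of_real (scaled n1 n2 m * real m powr (- t)) / (A m * A' m)) \<longlonglongrightarrow> of_real l / (1 * 1)"
    by (intro tendsto_intros l) auto
  have t: "complex_of_real t = \<mu> + (- \<alpha>' - 1)"
    by (simp add: t_def \<theta>_def \<alpha>'_def mu_def tau_neg phi_def algebra_simps)
  have ev: "eventually (\<lambda>m. of_real (scaled n1 n2 m * real m powr (- t)) / (A m * A' m)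
    = fact m / (Gamma (1 + \<mu> + of_nat m) * Gamma (of_nat m - \<alpha>'))
     * of_real (2 * \<kappa> * s0 B) ^ m * of_real (c (int m) n1 n2)) sequentially"
    using eventually_gt_at_top[of 0]
  proof eventually_elim
    case (elim m)
    define g1 g2 where "g1 = Gamma (1 + \<mu> + of_nat m)" and "g2 = Gamma (of_nat m - \<alpha>')"
    define p where "p = complex_of_real (real m powr t)"
    have p: "p \<noteq> 0" using elim by (simp add: p_def)
    have "of_nat m powr \<mu> * of_nat m powr (- \<alpha>' - 1) = p"
    proof -
      have "p = of_nat m powr complex_of_real t"
        unfolding p_def using elim powr_of_real[of "real m" t] by simp
      then show ?thesis using elim by (simp only: t powr_add)
    qed
    then have "A m * A' m = g1 * g2 / (fact m * fact m * p)"
      by (simp add: A_def A'_def g1_def g2_def field_simps)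
    moreover have "complex_of_real (scaled n1 n2 m * real m powr (- t)) = of_real (2 * \<kappa> * s0 B) ^ m * of_real (c (int m) n1 n2) / (fact m * p)"
      using elim by (simp add: scaled_def p_def powr_minus divide_inverse mult_ac)
    ultimately show ?case unfolding g1_def[symmetric] g2_def[symmetric] using p by simp
  qed
  show ?thesis
    by (rule convergentI, rule Lim_transform_eventually[OF lim ev])
qed

text \<open>The torus coefficient of the continuation formula, freed of a Gamma constant and of (1 -
  z)^\<mu>, has the form required by \<open>darboux_coefficient\<close>, with leading factor E times
  Gamma(-\<alpha>') at z = 0.\<close>

lemma continuation_coeff_eq_limit:
  fixes n1 n2 :: nat and E :: "real \<Rightarrow> nat \<Rightarrow> nat \<Rightarrow> nat \<Rightarrow> nat \<Rightarrow> complex"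
  assumes nonint': "\<And>r1 r2. mu B \<nu>1 \<nu>2 lam (- \<kappa>) + phi r1 r2 \<notin> \<int>"
    and cf: "continuation_formula D B L \<nu>1 \<nu>2 lam \<kappa> E"
  defines "\<alpha>' \<equiv> mu B \<nu>1 \<nu>2 lam (- \<kappa>) + phi n1 n2"
    and "a \<equiv> \<lambda>m. Gamma (- \<mu> - of_nat m) * of_real (- 2 * \<kappa> * s0 B) ^ m * of_real (c (int m) n1 n2)"
  assumes lim: "(\<lambda>m. a m * fact m / Gamma (of_nat m - \<alpha>')) \<longlonglongrightarrow> C"
  shows "C = E (- \<kappa>) 0 0 n1 n2"
proof -
  interpret neg: series D B L "- \<kappa>" \<nu>1 \<nu>2 lam
    by (intro series.intro parameters_neg series_axioms.intro \<nu> nonint')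
  define \<mu>' where "\<mu>' = mu B \<nu>1 \<nu>2 lam (- \<kappa>)"
  define Eq where "Eq = (\<lambda>q. E (- \<kappa>) 0 0 (fst q) (snd q))"
  obtain R V U where R: "R > 0" and V: "open V" "- of_real (\<kappa> * s0 B) \<in> V"
    and Ucont: "continuous_on (V \<times> {t. R < cmod t} \<times> {t. R < cmod t}) (\<lambda>(s, t1, t2). U s t1 t2)"
    and UW: "\<And>t1 t2. R < cmod t1 \<Longrightarrow> R < cmod t2 \<Longrightarrow> (\<lambda>s. U s t1 t2) holomorphic_on V"
      "\<And>t1 t2 s. R < cmod t1 \<Longrightarrow> R < cmod t2 \<Longrightarrow> s \<in> lens B \<Longrightarrow> W_converges D B L \<nu>1 \<nu>2 lam \<kappa> 0 0 s t1 t2"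
      "\<And>t1 t2 s. R < cmod t1 \<Longrightarrow> R < cmod t2 \<Longrightarrow> s \<in> lens B \<Longrightarrow>
        (\<lambda>q. Eq q * neg.Ws (fst q) (snd q) s t1 t2) summable_on UNIV"
      "\<And>t1 t2 s. R < cmod t1 \<Longrightarrow> R < cmod t2 \<Longrightarrow> s \<in> lens B \<Longrightarrow>
        Ws 0 0 s t1 t2
          = (\<Sum>\<^sub>\<infinity>q. Eq q * neg.Ws (fst q) (snd q) s t1 t2) + U s t1 t2"
  proof -
    have U0: "{0..} \<times> {0..} = (UNIV :: (nat \<times> nat) set)" by auto
    from cf[unfolded continuation_formula_def, rule_format, of 0 0]
    show ?thesis
      unfolding U0 case_prod_unfold
      by (elim exE conjE, intro that) (auto simp: Eq_def case_prod_unfold)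
  qed
  obtain r where r: "r > 0" "cball (- of_real (\<kappa> * s0 B)) r \<subseteq> V"
    using V open_contains_cball by blast
  obtain \<epsilon>1 where \<epsilon>1: "\<epsilon>1 > 0" "\<And>q1 q2 s t1 t2.
    neg.base s \<noteq> 0 \<Longrightarrow> norm (neg.base s) \<le> \<epsilon>1 \<Longrightarrow>
    norm (t1 - neg.T1) \<ge> 1 \<Longrightarrow> norm (t2 - neg.T2) \<ge> 1 \<Longrightarrow>
    (\<lambda>i. norm (neg.Wt q1 q2 s t1 t2 i)) summable_on W_index \<and>
    (\<Sum>\<^sub>\<infinity>i\<in>W_index. norm (neg.Wt q1 q2 s t1 t2 i))
      \<le> 3 * norm (neg.Ws q1 q2 s t1 t2)"
    by (rule neg.W_abs_bound) blast
  define d where "d = neg.local_coeff n1 n2"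
  obtain R2 where R2: "R2 > 0" "\<And>q k z. norm z < R2 \<Longrightarrow> summable (\<lambda>m. d q (m + k) * z ^ m)"
    unfolding d_def by (rule neg.local_coeff_bound) blast
  \<comment> \<open>1 is for the lens, \<epsilon>1 for the domination by first terms, R2 for the
    convergence of the local series, and r / (2 s0) keeps \<open>\<sigma> z\<close> in the disc
    about -\<kappa> s0 on which the torus coefficient of U is holomorphic.\<close>
  define \<epsilon> where "\<epsilon> = min (min 1 \<epsilon>1) (min R2 (r / (2 * s0 B)))"
  have \<epsilon>: "0 < \<epsilon>" "\<epsilon> \<le> 1" "\<epsilon> \<le> \<epsilon>1" "\<epsilon> \<le> R2" "\<epsilon> \<le> r / (2 * s0 B)"
    using \<epsilon>1(1) R2(1) r(1) s0_pos by (auto simp: \<epsilon>_def)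
  \<comment> \<open>From the coordinate z back to s; the base of W(\<kappa>) becomes 1 - z and that
    of W(-\<kappa>) becomes z.\<close>
  define \<sigma> where "\<sigma> = (\<lambda>z. of_real (2 * \<kappa> * s0 B) * (z - 1/2 :: complex))"
  have \<sigma>0: "complex_of_real (2 * \<kappa> * s0 B) \<noteq> 0" using s0_pos kappa_nz by simp
  have \<sigma>w: "base (\<sigma> z) = 1 - z" for z
    using \<sigma>0 unfolding \<sigma>_def by simp
  have \<sigma>z: "neg.base (\<sigma> z) = z" for z
  proof -
    have "complex_of_real (2 * (- \<kappa>) * s0 B) = - of_real (2 * \<kappa> * s0 B)" by simp
    then show ?thesis using \<sigma>0 unfolding \<sigma>_def by (simp only: divide_minus_right) simp
  qed
  have norm_k: "norm (complex_of_real (2 * \<kappa> * s0 B)) = 2 * s0 B"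
    unfolding norm_of_real using abs_kappa s0_pos by (simp add: abs_mult)
  have \<sigma>_dist: "norm (\<sigma> z + of_real (\<kappa> * s0 B)) = 2 * s0 B * norm z" "norm (\<sigma> z - of_real (\<kappa> * s0 B)) = 2 * s0 B * norm (1 - z)" for z
  proof -
    have "\<sigma> z + of_real (\<kappa> * s0 B) = of_real (2 * \<kappa> * s0 B) * z" "\<sigma> z - of_real (\<kappa> * s0 B) = - (of_real (2 * \<kappa> * s0 B) * (1 - z))"
      by (simp_all add: \<sigma>_def algebra_simps)
    then show "norm (\<sigma> z + of_real (\<kappa> * s0 B)) = 2 * s0 B * norm z" "norm (\<sigma> z - of_real (\<kappa> * s0 B)) = 2 * s0 B * norm (1 - z)"
      by (simp_all only: norm_minus_cancel norm_mult norm_k)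
  qed
  have \<sigma>_lens: "\<sigma> z \<in> lens B" if "norm z < 1" "norm (1 - z) < 1" for z
  proof -
    have "norm (\<sigma> z + of_real (\<kappa> * s0 B)) < 2 * s0 B" "norm (\<sigma> z - of_real (\<kappa> * s0 B)) < 2 * s0 B"
      unfolding \<sigma>_dist using that s0_pos by simp_all
    then show ?thesis
      using kappa unfolding lens_def by (auto simp: dist_norm norm_minus_commute add.commute)
  qed
  \<comment> \<open>The circles about c1, c2 and also the auxiliary points T1 + (\<rho> -
    |\<alpha>|), T2 + (\<rho> - |\<beta>|) must lie beyond R. For the latter |\<alpha>| costs 2
    |t10| and T1 another |t10|, hence the 3. The 1 guarantees distance at least 1 from the centres
    of W(-\<kappa>).\<close>
  define \<rho> where "\<rho> = R + 1 + 3 * \<bar>t10 B\<bar> + 3 * \<bar>t20 B\<bar>"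
  define c1 c2 where "c1 = - T1" and "c2 = - T2"
  have nc: "norm c1 = \<bar>t10 B\<bar>" "norm c2 = \<bar>t20 B\<bar>"
    using abs_kappa by (simp_all add: c1_def c2_def abs_mult norm_mult)
  have ab: "\<bar>\<alpha>\<bar> = 2 * \<bar>t10 B\<bar>" "\<bar>\<beta>\<bar> = 2 * \<bar>t20 B\<bar>"
    using abs_kappa by (simp_all add: abs_mult)
  have \<rho>: "\<rho> \<ge> 1" "\<rho> > 0" "\<bar>\<alpha>\<bar> < \<rho>" "\<bar>\<beta>\<bar> < \<rho>" using R unfolding ab by (auto simp: \<rho>_def)
  let ?g = "circlepath 0 \<rho>"
  define G :: complex where "G = Gamma (of_nat (\<nu>1 + n1)) * Gamma (of_nat (\<nu>2 + n2))"
  have G: "G \<noteq> 0"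
  proof -
    have "Gamma (of_nat n :: complex) \<noteq> 0" if "n \<ge> 1" for n
      using that by (auto simp: Gamma_eq_zero_iff elim!: nonpos_Ints_cases dest: arg_cong[of _ _ Re])
    then show ?thesis using \<nu> unfolding G_def by (metis mult_eq_0_iff trans_le_add1)
  qed
  have far: "R < norm (?g u + c1)" "R < norm (?g u + c2)" for u
  proof -
    have "norm (?g u) = \<rho>" using \<rho> by (intro norm_circlepath_0) simp
    moreover have "R < \<rho> - norm c1" "R < \<rho> - norm c2" unfolding nc by (simp_all add: \<rho>_def)
    ultimately show "R < norm (?g u + c1)" "R < norm (?g u + c2)"
      using norm_diff_ineq[of "?g u" c1] norm_diff_ineq[of "?g u" c2] by linarith+
  qed
  define TC where "TC = tc \<rho> c1 c2 n1 n2"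
  let ?ph = "tf \<rho> c1 c2 n1 n2"
  let ?box = "cbox (0::real, 0::real) (1, 1)"

  have F: "(\<lambda>m. G * (a m * (1 - z) powr (\<mu> + of_nat m))) sums TC (Ws 0 0 (\<sigma> z))"
    "?ph (Ws 0 0 (\<sigma> z)) integrable_on ?box"
    if z: "norm z < 1" "norm (1 - z) < 1" for z
  proof -
    have fr: "R < norm (T1 + of_real (\<rho> - \<bar>\<alpha>\<bar>))"
      "R < norm (T2 + of_real (\<rho> - \<bar>\<beta>\<bar>))"
      unfolding of_real_add[symmetric] norm_of_real ab using kappa R by (auto simp: \<rho>_def)
    note WT = W_torus_sums[OF \<rho>(3,4) UW(2)[OF fr \<sigma>_lens[OF z]], of n1 n2]
    show "(\<lambda>m. G * (a m * (1 - z) powr (\<mu> + of_nat m))) sums TC (Ws 0 0 (\<sigma> z))"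
      using WT(2) unfolding \<sigma>w G_def a_def TC_def c1_def c2_def .
    show "?ph (Ws 0 0 (\<sigma> z)) integrable_on ?box"
      using WT(1) unfolding c1_def c2_def .
  qed
  \<comment> \<open>The torus series converges at real z with 1 - z = y, where y lies between |w|
    and 1. Without the factor y^\<mu> and the Gamma constant it is the power series at y.\<close>
  have summ_a: "summable (\<lambda>m. a m * w ^ m)" if w: "norm w < 1" for w
  proof -
    obtain y where y: "norm w < y" "y < 1" using w dense by blast
    define z where "z = complex_of_real (1 - y)"
    have y0: "y > 0" using y(1) norm_ge_zero[of w] by linarith
    have z: "1 - z = of_real y" "norm z < 1" "norm (1 - z) < 1"
    proof -
      show "1 - z = of_real y" by (simp add: z_def)
      then show "norm (1 - z) < 1" using y y0 by simp
      show "norm z < 1" unfolding z_def norm_of_real using y y0 by linarith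
    qed
    have "summable (\<lambda>m. G * (a m * (1 - z) powr (\<mu> + of_nat m)))" using F(1)[OF z(2,3)] by (rule sums_summable)
    then have "summable (\<lambda>m. (G * of_real y powr \<mu>) * (a m * of_real y ^ m))"
      using y0 unfolding z by (simp add: powr_add_of_nat mult_ac)
    then have "summable (\<lambda>m. a m * of_real y ^ m)"
      using G y0 by (subst (asm) summable_cmult_iff) auto
    then show ?thesis by (rule powser_inside) (use y y0 in simp)
  qed

  define T where "T = (\<lambda>s q t1 t2 p. neg.Wt (fst q) (snd q) s t1 t2 p)"
  define f where "f = (\<lambda>s t1 t2. \<Sum>\<^sub>\<infinity>(q, p)\<in>UNIV \<times> W_index. Eq q * T s q t1 t2 p)"
  \<comment> \<open>For complex values summability over q is absolute. The factor 3 from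
    \<open>W_abs_bound\<close> extends it to the family of all pairs (q, p), whose sum may then be
    regrouped.\<close>
  have joint: "(\<lambda>qp. norm ((\<lambda>(q, p). Eq q * T (\<sigma> z) q t1 t2 p) qp)) summable_on UNIV \<times> W_index"
    "Ws 0 0 (\<sigma> z) t1 t2 = f (\<sigma> z) t1 t2 + U (\<sigma> z) t1 t2"
    if z: "norm z < \<epsilon>" "norm (1 - z) < 1" and t: "R < norm t1" "R < norm t2" "norm (t1 - c1) \<ge> 1" "norm (t2 - c2) \<ge> 1" for z t1 t2
  proof -
    have z0: "z \<noteq> 0" using z(2) by auto
    have lens: "\<sigma> z \<in> lens B" using z \<epsilon>(2) by (intro \<sigma>_lens) auto
    have bd: "(\<lambda>p. norm (T (\<sigma> z) q t1 t2 p)) summable_on W_index \<and>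
      (\<Sum>\<^sub>\<infinity>p\<in>W_index. norm (T (\<sigma> z) q t1 t2 p)) \<le> 3 * norm (neg.Ws (fst q) (snd q) (\<sigma> z) t1 t2)" for q
      unfolding T_def by (rule \<epsilon>1(2)[where s = "\<sigma> z", unfolded \<sigma>z]) (use z0 z \<epsilon>(3) t in \<open>auto simp: c1_def c2_def\<close>)
    have in1: "(\<lambda>p. norm (Eq q * T (\<sigma> z) q t1 t2 p)) summable_on W_index" for q
      unfolding norm_mult by (intro summable_on_cmult_right) (use bd in blast)
    have in2: "(\<lambda>q. \<Sum>\<^sub>\<infinity>p\<in>W_index. norm (Eq q * T (\<sigma> z) q t1 t2 p)) summable_on UNIV"
    proof (rule summable_on_comparison_test)
      show "(\<lambda>q. 3 * norm (Eq q * neg.Ws (fst q) (snd q) (\<sigma> z) t1 t2)) summable_on UNIV"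
        using UW(3)[OF t(1,2) lens] by (intro summable_on_cmult_right) (simp only: summable_on_iff_abs_summable_on_complex)
      fix q
      have "(\<Sum>\<^sub>\<infinity>p\<in>W_index. norm (Eq q * T (\<sigma> z) q t1 t2 p)) = norm (Eq q) * (\<Sum>\<^sub>\<infinity>p\<in>W_index. norm (T (\<sigma> z) q t1 t2 p))"
        unfolding norm_mult by (intro infsum_cmult_right) (use bd in blast)
      also have "\<dots> \<le> norm (Eq q) * (3 * norm (neg.Ws (fst q) (snd q) (\<sigma> z) t1 t2))"
        using bd by (intro mult_left_mono) auto
      finally show "(\<Sum>\<^sub>\<infinity>p\<in>W_index. norm (Eq q * T (\<sigma> z) q t1 t2 p)) \<le> 3 * norm (Eq q * neg.Ws (fst q) (snd q) (\<sigma> z) t1 t2)"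
        by (simp add: norm_mult)
    qed (auto intro!: infsum_nonneg)
    show js: "(\<lambda>qp. norm ((\<lambda>(q, p). Eq q * T (\<sigma> z) q t1 t2 p) qp)) summable_on UNIV \<times> W_index"
      by (subst Infinite_Sum.abs_summable_on_Sigma_iff) (use in1 in2 in \<open>auto simp: infsum_nonneg\<close>)
    have "f (\<sigma> z) t1 t2 = (\<Sum>\<^sub>\<infinity>q. \<Sum>\<^sub>\<infinity>p\<in>W_index. Eq q * T (\<sigma> z) q t1 t2 p)"
      unfolding f_def by (rule infsum_Sigma'_banach[symmetric]) (use js in \<open>rule Infinite_Sum.abs_summable_summable\<close>)
    also have "\<dots> = (\<Sum>\<^sub>\<infinity>q. Eq q * neg.Ws (fst q) (snd q) (\<sigma> z) t1 t2)"
    proof (rule infsum_cong)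
      fix q
      have "T (\<sigma> z) q t1 t2 summable_on W_index"
        by (rule Infinite_Sum.abs_summable_summable) (use bd in blast)
      then show "(\<Sum>\<^sub>\<infinity>p\<in>W_index. Eq q * T (\<sigma> z) q t1 t2 p) = Eq q * neg.Ws (fst q) (snd q) (\<sigma> z) t1 t2"
        unfolding W_def T_def by (intro infsum_cmult_right)
    qed
    finally show "Ws 0 0 (\<sigma> z) t1 t2 = f (\<sigma> z) t1 t2 + U (\<sigma> z) t1 t2"
      using UW(4)[OF t(1,2) lens] by simp
  qed
  have near: "norm (?g u + c1 - c1) \<ge> 1" "norm (?g u + c2 - c2) \<ge> 1" for u
    using norm_circlepath_0[of \<rho> u] \<rho> by auto
  define Fn where "Fn = {..n1} \<times> {..n2}"
  have H: "(\<lambda>m. G * (\<Sum>q\<in>Fn. Eq q * (d q m * z powr (\<mu>' + phi (fst q) (snd q) + of_nat m)))) sums TC (f (\<sigma> z))"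
    "?ph (f (\<sigma> z)) integrable_on ?box"
    if z: "norm z < \<epsilon>" "norm (1 - z) < 1" for z
  proof -
    have c12: "neg.T1 = c1" "neg.T2 = c2" by (simp_all add: c1_def c2_def)
    have fr: "R < norm (c1 + of_real \<rho>)" "R < norm (c2 + of_real \<rho>)" "norm (c1 + of_real \<rho> - c1) \<ge> 1" "norm (c2 + of_real \<rho> - c2) \<ge> 1"
      using far[of 0] \<rho> by (simp_all add: circlepath add.commute)
    note NT = neg.W_combination_torus_sums[OF \<rho>(2), where s = "\<sigma> z" and e = Eq, unfolded c12, OF joint(1)[OF z fr, unfolded T_def], of n1 n2]
    show "(\<lambda>m. G * (\<Sum>q\<in>Fn. Eq q * (d q m * z powr (\<mu>' + phi (fst q) (snd q) + of_nat m)))) sums TC (f (\<sigma> z))"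
      using NT(2) unfolding \<sigma>z G_def d_def TC_def f_def T_def Fn_def \<mu>'_def .
    show "?ph (f (\<sigma> z)) integrable_on ?box"
      using NT(1) unfolding f_def T_def .
  qed
  have U_hol: "(\<lambda>s. TC (U s)) holomorphic_on ball (- of_real (\<kappa> * s0 B)) r"
    unfolding TC_def torus_coeff_def
  proof (rule holomorphic_on_integral_param[OF _ _ r(2)])
    have "continuous_on (V \<times> ?box) (\<lambda>p. (\<lambda>(s, t1, t2). U s t1 t2) (fst p, ?g (fst (snd p)) + c1, ?g (snd (snd p)) + c2))"
      using far by (intro continuous_on_compose2[OF Ucont] continuous_intros continuous_on_compose2[OF continuous_on_circlepath[of UNIV]]) auto
    then have "continuous_on (V \<times> ?box) (\<lambda>p. ?ph (U (fst p)) (snd p))"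
      by (intro continuous_intros continuous_on_compose2[OF continuous_on_circlepath[of UNIV]]) auto
    then show "continuous_on (V \<times> ?box) (\<lambda>(s, \<theta>). ?ph (U s) \<theta>)" by (simp add: case_prod_unfold)
    show "(\<lambda>s. ?ph (U s) \<theta>) holomorphic_on V" for \<theta>
      by (intro holomorphic_intros UW(1) far)
  qed
  have U_int: "?ph (U s) integrable_on ?box" if "s \<in> V" for s
  proof (rule integrable_continuous)
    have "continuous_on ?box (\<lambda>\<theta>. (\<lambda>(s, t1, t2). U s t1 t2) (s, ?g (fst \<theta>) + c1, ?g (snd \<theta>) + c2))"
      using far that by (intro continuous_on_compose2[OF Ucont] continuous_intros continuous_on_compose2[OF continuous_on_circlepath[of UNIV]]) auto
    then show "continuous_on ?box (?ph (U s))"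
      by (intro continuous_intros continuous_on_compose2[OF continuous_on_circlepath[of UNIV]]) auto
  qed
  have \<sigma>V: "\<sigma> z \<in> ball (- of_real (\<kappa> * s0 B)) r" if "norm z < \<epsilon>" for z
  proof -
    have "2 * s0 B * norm z < 2 * s0 B * (r / (2 * s0 B))"
      using that \<epsilon>(5) s0_pos by (intro mult_strict_left_mono) auto
    then have "norm (\<sigma> z + of_real (\<kappa> * s0 B)) < r" unfolding \<sigma>_dist using s0_pos by simp
    then show ?thesis by (simp add: dist_norm norm_minus_commute[of _ "\<sigma> z"])
  qed
  have TC_eq: "TC (Ws 0 0 (\<sigma> z)) = TC (f (\<sigma> z)) + TC (U (\<sigma> z))"
    if z: "norm z < \<epsilon>" "norm (1 - z) < 1" for z
  proof -
    have "TC (Ws 0 0 (\<sigma> z)) = integral ?box (\<lambda>\<theta>. ?ph (f (\<sigma> z)) \<theta> + ?ph (U (\<sigma> z)) \<theta>)"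
      unfolding TC_def torus_coeff_def
      by (intro integral_cong) (simp add: joint(2)[OF z far(1) far(2) near(1) near(2)] distrib_right)
    also have "\<dots> = TC (f (\<sigma> z)) + TC (U (\<sigma> z))"
      unfolding TC_def torus_coeff_def
      using \<sigma>V[OF z(1)] r(2) ball_subset_cball by (intro integral_add H(2)[OF z] U_int) blast
    finally show ?thesis .
  qed
  define N where "N = (n1, n2)"
  have N: "N \<in> Fn" "finite Fn" by (auto simp: N_def Fn_def)
  \<comment> \<open>For q other than N this is the least m with 3 m > 2 (n1 - q1) + (n2 - q2); below
    it the coefficients vanish by weight. Splitting off z^(M q) raises the exponent to \<alpha>' +
    \<delta> q with \<delta> q > 0. For q = N the seed of b makes the series start at m = 0.\<close>
  define M where "M = (\<lambda>q. if q = N then 0 else (2 * (n1 - fst q) + (n2 - snd q)) div 3 + 1)"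
  define \<delta> where "\<delta> = (\<lambda>q. real (M q) - (2 * real (n1 - fst q) + real (n2 - snd q)) / 3)"
  have \<delta>: "\<delta> q > 0" if "q \<in> Fn - {N}" for q
  proof -
    have "2 * (n1 - fst q) + (n2 - snd q) < 3 * M q" using that by (simp add: M_def)
    then have "real (2 * (n1 - fst q) + (n2 - snd q)) < real (3 * M q)" by (simp only: of_nat_less_iff)
    then show ?thesis by (simp add: \<delta>_def)
  qed
  have d_zero: "d q m = 0" if q: "q \<in> Fn" and m: "m < M q" for q m
  proof -
    have "q \<noteq> N" using m by (auto simp: M_def)
    then have *: "n1 - fst q \<noteq> 0 \<or> n2 - snd q \<noteq> 0" using q by (cases q) (auto simp: N_def Fn_def)
    have "3 * m \<le> 2 * (n1 - fst q) + (n2 - snd q)" using m \<open>q \<noteq> N\<close> by (simp add: M_def)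
    then have "b_coeff D B L (- \<kappa>) (int m) (int (n1 - fst q)) (int (n2 - snd q)) = 0"
      by (intro neg.b_eq_0_weight') (use * in auto)
    then show ?thesis by (simp add: d_def neg.local_coeff_def)
  qed
  have shift: "(\<Sum>m. d q m * z ^ m) = z ^ M q * (\<Sum>m. d q (m + M q) * z ^ m)" if q: "q \<in> Fn" and z: "norm z < \<epsilon>" for q z
  proof -
    have z': "norm z < R2" using z \<epsilon>(4) by simp
    have "(\<Sum>m. d q m * z ^ m) = (\<Sum>m. d q (m + M q) * z ^ (m + M q)) + (\<Sum>m<M q. d q m * z ^ m)"
      using R2(2)[OF z', of q 0] by (intro suminf_split_initial_segment) simp
    also have "(\<Sum>m<M q. d q m * z ^ m) = 0" using d_zero[OF q] by simp
    also have "(\<Sum>m. d q (m + M q) * z ^ (m + M q)) = (\<Sum>m. z ^ M q * (d q (m + M q) * z ^ m))"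
      by (simp add: power_add mult_ac)
    also have "\<dots> = z ^ M q * (\<Sum>m. d q (m + M q) * z ^ m)" by (intro suminf_mult R2(2) z')
    finally show ?thesis by simp
  qed
  have \<alpha>\<delta>: "\<mu>' + phi (fst q) (snd q) + of_nat (M q) = \<alpha>' + of_real (\<delta> q)" if "q \<in> Fn" for q
    using that by (auto simp: \<delta>_def \<alpha>'_def \<mu>'_def phi_def Fn_def of_nat_diff field_simps)
  have main: "(\<Sum>k. a k * (1 - z) ^ k) = z powr \<alpha>' * ((1 - z) powr (- \<mu>) * (Eq N * (\<Sum>m. d N m * z ^ m)))
      + (\<Sum>q\<in>Fn - {N}. z powr (\<alpha>' + of_real (\<delta> q)) * ((1 - z) powr (- \<mu>) * (Eq q * (\<Sum>m. d q (m + M q) * z ^ m))))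
      + (1 - z) powr (- \<mu>) * (TC (U (\<sigma> z)) / G)"
    if z: "norm z < \<epsilon>" "norm (1 - z) < 1" for z
  proof -
    have z1: "norm z < 1" "z \<noteq> 0" "1 - z \<noteq> 0" using z \<epsilon>(2) by auto
    define P where "P = (\<lambda>q. z powr (\<alpha>' + of_real (\<delta> q)) * (Eq q * (\<Sum>m. d q (m + M q) * z ^ m)))"
    have "(\<lambda>m. G * ((1 - z) powr \<mu> * (a m * (1 - z) ^ m))) sums (G * ((1 - z) powr \<mu> * (\<Sum>k. a k * (1 - z) ^ k)))"
      by (intro sums_mult summable_sums summ_a z)
    then have "TC (Ws 0 0 (\<sigma> z)) = G * ((1 - z) powr \<mu> * (\<Sum>k. a k * (1 - z) ^ k))"
      using sums_unique2[OF F(1)[OF z1(1) z(2)]] z1(3) by (simp add: powr_add_of_nat mult_ac)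
    moreover have "TC (f (\<sigma> z)) = G * (\<Sum>q\<in>Fn. P q)"
    proof -
      have "(\<lambda>m. G * (\<Sum>q\<in>Fn. Eq q * (z powr (\<mu>' + phi (fst q) (snd q)) * (d q m * z ^ m))))
        sums (G * (\<Sum>q\<in>Fn. Eq q * (z powr (\<mu>' + phi (fst q) (snd q)) * (\<Sum>m. d q m * z ^ m))))"
        using R2(2)[of z _ 0] z(1) \<epsilon>(4) by (intro sums_mult sums_sum summable_sums) simp
      then have "TC (f (\<sigma> z)) = G * (\<Sum>q\<in>Fn. Eq q * (z powr (\<mu>' + phi (fst q) (snd q)) * (\<Sum>m. d q m * z ^ m)))"
        using sums_unique2[OF H(1)[OF z]] z1(2) by (simp add: powr_add_of_nat mult_ac)
      also have "(\<Sum>q\<in>Fn. Eq q * (z powr (\<mu>' + phi (fst q) (snd q)) * (\<Sum>m. d q m * z ^ m))) = (\<Sum>q\<in>Fn. P q)"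
      proof (rule sum.cong[OF refl])
        fix q assume q: "q \<in> Fn"
        have "z powr (\<alpha>' + of_real (\<delta> q)) = z powr (\<mu>' + phi (fst q) (snd q)) * z ^ M q"
          unfolding \<alpha>\<delta>[OF q, symmetric] by (rule powr_add_of_nat[OF z1(2)])
        then show "Eq q * (z powr (\<mu>' + phi (fst q) (snd q)) * (\<Sum>m. d q m * z ^ m)) = P q"
          unfolding P_def shift[OF q z(1)] by simp
      qed
      finally show ?thesis .
    qed
    ultimately have "G * ((1 - z) powr \<mu> * (\<Sum>k. a k * (1 - z) ^ k)) = G * ((\<Sum>q\<in>Fn. P q) + TC (U (\<sigma> z)) / G)"
      using TC_eq[OF z] G by (simp add: distrib_left)
    then have "(1 - z) powr \<mu> * (\<Sum>k. a k * (1 - z) ^ k) = (\<Sum>q\<in>Fn. P q) + TC (U (\<sigma> z)) / G"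
      using G by (simp only: mult_cancel_left) simp
    moreover have "(1 - z) powr (- \<mu>) * (1 - z) powr \<mu> = 1" using z1(3) by (simp flip: powr_add)
    ultimately have "(\<Sum>k. a k * (1 - z) ^ k) = (1 - z) powr (- \<mu>) * ((\<Sum>q\<in>Fn. P q) + TC (U (\<sigma> z)) / G)"
      by (metis mult.assoc mult_1)
    also have "(\<Sum>q\<in>Fn. P q) = P N + (\<Sum>q\<in>Fn - {N}. P q)" using N by (simp add: sum.remove)
    also have "P N = z powr \<alpha>' * (Eq N * (\<Sum>m. d N m * z ^ m))"
      by (simp add: P_def \<delta>_def M_def) (simp add: N_def)
    finally show ?thesis
      by (simp add: P_def distrib_left sum_distrib_left mult_ac)
  qed
  have hol1: "(\<lambda>z. (1 - z) powr (- \<mu>)) holomorphic_on ball 0 \<epsilon>"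
  proof (intro holomorphic_intros)
    fix z :: complex assume "z \<in> ball 0 \<epsilon>"
    then have "norm z < 1" using \<epsilon>(2) by simp
    then have "Re (1 - z) > 0" using complex_Re_le_cmod[of z] by simp
    then show "1 - z \<notin> \<real>\<^sub>\<le>\<^sub>0" by (auto simp: complex_nonpos_Reals_iff)
  qed
  have hold: "(\<lambda>z. \<Sum>m. d q (m + k) * z ^ m) holomorphic_on ball 0 \<epsilon>" for q k
    by (rule powser_holomorphic) (use R2(2) \<epsilon>(4) in auto)
  have holU: "(\<lambda>z. TC (U (\<sigma> z))) holomorphic_on ball 0 \<epsilon>"
  proof -
    have "((\<lambda>s. TC (U s)) \<circ> \<sigma>) holomorphic_on ball 0 \<epsilon>"
      by (rule holomorphic_on_compose_gen[OF _ U_hol]) (use \<sigma>V in \<open>auto simp: \<sigma>_def intro!: holomorphic_intros\<close>)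
    then show ?thesis by (simp add: o_def)
  qed
  have "\<alpha>' \<notin> \<int>" unfolding \<alpha>'_def by (rule nonint')
  then have "- \<alpha>' \<notin> \<int>" using Ints_minus[of "- \<alpha>'"] by auto
  then have \<alpha>'_np: "- \<alpha>' \<notin> \<int>\<^sub>\<le>\<^sub>0" using nonpos_Ints_Int by blast
  \<comment> \<open>At z = 0 only the constant term of the series for N remains: Gamma(-\<alpha>')
    times the seed of b. The same Gamma value on the left cancels.\<close>
  have "C * Gamma (- \<alpha>') = (1 - 0) powr (- \<mu>) * (Eq N * (\<Sum>m. d N m * 0 ^ m))"
    by (rule darboux_coefficient[OF lim \<alpha>'_np \<epsilon>(1,2) summ_a _ _ _ _ \<delta> main])
       (use N hold[of N 0] in \<open>auto intro!: holomorphic_intros hol1 hold holU\<close>)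
  also have "\<dots> = Eq N * d N 0" by (simp add: powser_zero)
  also have "d N 0 = Gamma (- \<alpha>')"
    by (simp add: d_def neg.local_coeff_def N_def neg.b_000 \<alpha>'_def)
  finally show ?thesis using \<alpha>'_np by (simp add: Eq_def N_def Gamma_eq_zero_iff)
qed

end

theorem mainTheorem5:
  fixes D B :: "nat \<Rightarrow> real" and L \<kappa> :: real and \<nu>1 \<nu>2 n1 n2 :: nat and lam :: complex
    and E :: "real \<Rightarrow> nat \<Rightarrow> nat \<Rightarrow> nat \<Rightarrow> nat \<Rightarrow> complex"
  assumes "B 6 > 0" and "L \<ge> 0"
    and "\<kappa> \<in> {1, -1}"
    and "\<nu>1 \<ge> 1" and "\<nu>2 \<ge> 1"
    and "\<And>\<sigma> r1 r2. \<sigma> \<in> {1, -1} \<Longrightarrow> mu B \<nu>1 \<nu>2 lam \<sigma> + phi r1 r2 \<notin> \<int>"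
    and "continuation_formula D B L \<nu>1 \<nu>2 lam \<kappa> E"
  shows "(\<lambda>m. - of_real pi *
      (Gamma (1 + of_nat m)
        / (Gamma (1 + mu B \<nu>1 \<nu>2 lam \<kappa> + of_nat m)
           * Gamma (- mu B \<nu>1 \<nu>2 lam (- \<kappa>) - 2/3 * of_nat n1 - 1/3 * of_nat n2 + of_nat m))
        * of_real (2 * \<kappa> * s0 B) ^ m
        * (\<Sum>j1=0..n1. \<Sum>j2=0..n2.
             of_real (b_coeff D B L \<kappa> (int m) (int j1) (int j2)
               * ((2 * \<kappa> * t10 B) ^ (n1 - j1) / fact (n1 - j1))
               * ((2 * \<kappa> * t20 B) ^ (n2 - j2) / fact (n2 - j2))))))
    \<longlonglongrightarrow> e_coeff B \<nu>1 \<nu>2 lam E (- \<kappa>) n1 n2"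
proof -
  interpret series D B L \<kappa> \<nu>1 \<nu>2 lam
    by unfold_locales (use assms(1,3,4,5,6) in auto)
  define \<alpha>' where "\<alpha>' = mu B \<nu>1 \<nu>2 lam (- \<kappa>) + phi n1 n2"
  have nonint': "mu B \<nu>1 \<nu>2 lam (- \<kappa>) + phi r1 r2 \<notin> \<int>" for r1 r2
    using assms(3,6) by auto
  define u where "u = (\<lambda>m. fact m / (Gamma (1 + \<mu> + of_nat m) * Gamma (of_nat m - \<alpha>'))
     * of_real (2 * \<kappa> * s0 B) ^ m * of_real (c (int m) n1 n2))"
  obtain l where l: "u \<longlonglongrightarrow> l"
    using normalized_coeff_convergent[OF nonint', of n1 n2]
    unfolding u_def \<alpha>'_def convergent_def by blast
  have sin: "sin (of_real pi * \<mu>) \<noteq> 0"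
  proof
    assume "sin (of_real pi * \<mu>) = 0"
    then obtain k :: int where "of_real pi * \<mu> = of_real (of_int k * pi)" by (auto simp: sin_eq_0)
    then have "of_real pi * \<mu> = of_real pi * of_int k" by simp
    then have "\<mu> = of_int k" by (simp only: mult_cancel_left) simp
    then show False using \<mu>_nonint by simp
  qed
  define a where "a = (\<lambda>m. Gamma (- \<mu> - of_nat m) * of_real (- 2 * \<kappa> * s0 B) ^ m * of_real (c (int m) n1 n2))"
  \<comment> \<open>Reflection turns Gamma(-\<mu> - m) into the reciprocal of Gamma(1 + \<mu> + m)
    at the price of -pi / sin(pi \<mu>) and a sign (-1)^m, which cancels against that of (-2
    \<kappa> s0)^m. Hence the -pi in the limit formula and the sine in e.\<close>
  have a: "a m * fact m / Gamma (of_nat m - \<alpha>') = - of_real pi / sin (of_real pi * \<mu>) * u m" for m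
  proof -
    have "complex_of_real (- 2 * \<kappa> * s0 B) ^ m = (-1) ^ m * of_real (2 * \<kappa> * s0 B) ^ m"
      by (simp flip: power_mult_distrib)
    moreover have "(-1) ^ m * (-1) ^ m = (1 :: complex)" by (simp flip: power_mult_distrib)
    ultimately show ?thesis
      unfolding a_def u_def Gamma_reflection_shift[OF \<mu>_nonint] by (simp add: mult_ac)
  qed
  have "(\<lambda>m. a m * fact m / Gamma (of_nat m - \<alpha>')) \<longlonglongrightarrow> - of_real pi / sin (of_real pi * \<mu>) * l"
    unfolding a by (intro tendsto_intros l)
  then have "- of_real pi / sin (of_real pi * \<mu>) * l = E (- \<kappa>) 0 0 n1 n2"
    unfolding a_def \<alpha>'_def
    by (intro continuation_coeff_eq_limit[OF nonint' assms(7)])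
  then have "e_coeff B \<nu>1 \<nu>2 lam E (- \<kappa>) n1 n2 = - of_real pi * l"
    unfolding e_coeff_def using sin by (simp add: field_simps)
  moreover have "(\<lambda>m. - of_real pi * u m) \<longlonglongrightarrow> - of_real pi * l"
    by (intro tendsto_intros l)
  moreover have "u m = Gamma (1 + of_nat m)
        / (Gamma (1 + mu B \<nu>1 \<nu>2 lam \<kappa> + of_nat m)
           * Gamma (- mu B \<nu>1 \<nu>2 lam (- \<kappa>) - 2/3 * of_nat n1 - 1/3 * of_nat n2 + of_nat m))
        * of_real (2 * \<kappa> * s0 B) ^ m
        * (\<Sum>j1=0..n1. \<Sum>j2=0..n2.
             of_real (b_coeff D B L \<kappa> (int m) (int j1) (int j2)
               * ((2 * \<kappa> * t10 B) ^ (n1 - j1) / fact (n1 - j1))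
               * ((2 * \<kappa> * t20 B) ^ (n2 - j2) / fact (n2 - j2))))" for m
  proof -
    have eq: "of_nat m - \<alpha>' = - mu B \<nu>1 \<nu>2 lam (- \<kappa>) - 2/3 * of_nat n1 - 1/3 * of_nat n2 + of_nat m"
      by (simp add: \<alpha>'_def phi_def)
    show ?thesis
      unfolding u_def c_def emult_def Gamma_fact of_real_sum eq by (rule refl)
  qed
  ultimately show ?thesis by simp
qed

end
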